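(* Let $Z(t)$, $t\ge0$, be a symmetric stable process with index $\alpha\in(1,2)$, let $a:\mathbb{R}\to\mathbb{R}$ be a measurable function with $a\in L_\infty(\mathbb{R})$, and let $x\in\mathbb{R}$. Then there exists a unique strong solution to the equation $$\xi(t)=x+\int_0^t a(\xi(s))\,ds+Z(t),\qquad t\ge 0.$$
   Context: A symmetric stable process with index $\alpha$ is a càdlàg process $Z$ with $Z(0)=0$ and stationary independent increments such that, for some $c>0$, $E\exp\{i\lambda Z(t)\}=\exp\{-ct|\lambda|^\alpha\}$ for all $\lambda\in\mathbb{R}$, $t\ge0$. It is considered on a filtered probability space $(\Omega,\mathcal{F},(\mathcal{F}_t),P)$, is $(\mathcal{F}_t)$-adapted, and its increments $Z(t+s)-Z(t)$ are independent of $\mathcal{F}_t$. A solution is an $(\mathcal{F}_t)$-adapted process $\xi$ such that almost surely $\int_0^T|a(\xi(s))|\,ds<\infty$ for all $T>0$ and the equation holds for all $t\ge0$. A solution is strong if it is adapted to the completed filtration generated by $Z$. Uniqueness is understood pathwise: any two solutions on the same filtered probability space with the same $Z$ and $x$ coincide for all $t\ge0$ almost surely. *)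

theory Defs
  imports "HOL-Probability.Probability"
begin

text \<open>Time is the half-line \<open>t \<ge> 0\<close> inside \<^typ>\<open>real\<close>; values of processes and
  \<open>\<sigma>\<close>-algebras at negative times are never used. Neither completeness nor right-continuity of
  the filtration is required.\<close>

locale filtered_prob_space = prob_space M
  for M :: "'w measure" +
  fixes F :: "real \<Rightarrow> 'w measure"
  assumes subalgebra_F: "0 \<le> t \<Longrightarrow> subalgebra M (F t)"
    and sets_F_mono: "0 \<le> s \<Longrightarrow> s \<le> t \<Longrightarrow> sets (F s) \<subseteq> sets (F t)"

definition adapted :: "(real \<Rightarrow> 'w measure) \<Rightarrow> (real \<Rightarrow> 'w \<Rightarrow> real) \<Rightarrow> bool" where
  "adapted F X \<longleftrightarrow> (\<forall>t\<ge>0. X t \<in> borel_measurable (F t))"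

definition cadlag :: "(real \<Rightarrow> real) \<Rightarrow> bool" where
  "cadlag f \<longleftrightarrow> (\<forall>t\<ge>0. continuous (at_right t) f) \<and> (\<forall>t>0. \<exists>l. (f \<longlongrightarrow> l) (at_left t))"

definition stationary_increments :: "'w measure \<Rightarrow> (real \<Rightarrow> 'w \<Rightarrow> real) \<Rightarrow> bool" where
  "stationary_increments M Z \<longleftrightarrow>
     (\<forall>t\<ge>0. \<forall>s\<ge>0. distr M borel (\<lambda>\<omega>. Z (t + s) \<omega> - Z t \<omega>) = distr M borel (\<lambda>\<omega>. Z s \<omega> - Z 0 \<omega>))"

definition independent_increments :: "'w measure \<Rightarrow> (real \<Rightarrow> 'w \<Rightarrow> real) \<Rightarrow> bool" where
  "independent_increments M Z \<longleftrightarrow>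
     (\<forall>(n::nat) (\<tau>::nat \<Rightarrow> real). 0 \<le> \<tau> 0 \<longrightarrow> mono \<tau> \<longrightarrow>
        prob_space.indep_vars M (\<lambda>_. borel) (\<lambda>i \<omega>. Z (\<tau> (Suc i)) \<omega> - Z (\<tau> i) \<omega>) {..<n})"

text \<open>\<open>Z(0) = 0\<close> and the cadlag property are only required almost surely.\<close>

definition symmetric_stable_process ::
  "'w measure \<Rightarrow> real \<Rightarrow> (real \<Rightarrow> 'w \<Rightarrow> real) \<Rightarrow> bool" where
  "symmetric_stable_process M \<alpha> Z \<longleftrightarrow>
     (\<forall>t\<ge>0. Z t \<in> borel_measurable M) \<and>
     (AE \<omega> in M. cadlag (\<lambda>t. Z t \<omega>)) \<and>
     (AE \<omega> in M. Z 0 \<omega> = 0) \<and>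
     stationary_increments M Z \<and>
     independent_increments M Z \<and>
     (\<exists>c>0. \<forall>t\<ge>0. \<forall>u::real.
        char (distr M borel (Z t)) u = complex_of_real (exp (- (c * t * \<bar>u\<bar> powr \<alpha>))))"

definition increments_independent_of ::
  "'w measure \<Rightarrow> (real \<Rightarrow> 'w measure) \<Rightarrow> (real \<Rightarrow> 'w \<Rightarrow> real) \<Rightarrow> bool" where
  "increments_independent_of M F Z \<longleftrightarrow>
     (\<forall>t\<ge>0. \<forall>s\<ge>0. prob_space.indep_set M (sets (F t))
        (sets (vimage_algebra (space M) (\<lambda>\<omega>. Z (t + s) \<omega> - Z t \<omega>) borel)))"

text \<open>The drift is allowed to be merely Lebesgue measurable and essentially bounded. Accordingly
  time integrals are taken with respect to the completed measure \<^const>\<open>lebesgue\<close>.\<close>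

definition L_infinity :: "(real \<Rightarrow> real) \<Rightarrow> bool" where
  "L_infinity a \<longleftrightarrow> a \<in> borel_measurable lebesgue \<and> (\<exists>K. AE y in lebesgue. \<bar>a y\<bar> \<le> K)"

definition sde_solution ::
  "'w measure \<Rightarrow> (real \<Rightarrow> 'w measure) \<Rightarrow> (real \<Rightarrow> 'w \<Rightarrow> real) \<Rightarrow> (real \<Rightarrow> real) \<Rightarrow> real \<Rightarrow>
    (real \<Rightarrow> 'w \<Rightarrow> real) \<Rightarrow> bool" where
  "sde_solution M F Z a x \<xi> \<longleftrightarrow>
     adapted F \<xi> \<and>
     (AE \<omega> in M.
        (\<forall>T>0. set_integrable lebesgue {0..T} (\<lambda>s. a (\<xi> s \<omega>))) \<and>
        (\<forall>t\<ge>0. \<xi> t \<omega> = x + (LINT s:{0..t}|lebesgue. a (\<xi> s \<omega>)) + Z t \<omega>))"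

text \<open>The \<open>\<sigma>\<close>-algebra generated by \<open>Z(s)\<close>, \<open>s \<le> t\<close>, and all subsets of \<open>M\<close>-null sets. As \<open>M\<close>
  need not be complete, these subsets need not be measurable in \<open>M\<close>.\<close>

definition completed_natural_filtration ::
  "'w measure \<Rightarrow> (real \<Rightarrow> 'w \<Rightarrow> real) \<Rightarrow> real \<Rightarrow> 'w measure" where
  "completed_natural_filtration M Z t =
     sigma (space M)
       ({Z s -` B \<inter> space M | s B. 0 \<le> s \<and> s \<le> t \<and> B \<in> sets borel} \<union>
        {N. \<exists>N'\<in>null_sets M. N \<subseteq> N'})"

definition strong_solution ::
  "'w measure \<Rightarrow> (real \<Rightarrow> 'w measure) \<Rightarrow> (real \<Rightarrow> 'w \<Rightarrow> real) \<Rightarrow> (real \<Rightarrow> real) \<Rightarrow> real \<Rightarrow>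
    (real \<Rightarrow> 'w \<Rightarrow> real) \<Rightarrow> bool" where
  "strong_solution M F Z a x \<xi> \<longleftrightarrow>
     sde_solution M F Z a x \<xi> \<and> adapted (completed_natural_filtration M Z) \<xi>"

definition pathwise_unique ::
  "'w measure \<Rightarrow> (real \<Rightarrow> 'w measure) \<Rightarrow> (real \<Rightarrow> 'w \<Rightarrow> real) \<Rightarrow> (real \<Rightarrow> real) \<Rightarrow> real \<Rightarrow> bool" where
  "pathwise_unique M F Z a x \<longleftrightarrow>
     (\<forall>\<xi> \<eta>. sde_solution M F Z a x \<xi> \<longrightarrow> sde_solution M F Z a x \<eta> \<longrightarrow>
        (AE \<omega> in M. \<forall>t\<ge>0. \<xi> t \<omega> = \<eta> t \<omega>))"

end

theory Submission
  imports Defs "HOL-Real_Asymp.Real_Asymp"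
begin

text \<open>
  The noise regularises. An increment of \<open>Z\<close> over a time \<open>r > 0\<close> has the law of
  \<open>r powr (1 / \<alpha>)\<close> times a variable with a smooth density, so averaging a function bounded by
  \<open>1\<close> over this increment produces a Lipschitz function with constant of order
  \<open>r powr (- 1 / \<alpha>)\<close>. Since \<open>\<alpha> > 1\<close>, this blow-up is integrable at \<open>r = 0\<close>, and that single fact
  drives all parts of the proof.

  \<^emph>\<open>Occupation times.\<close> Let \<open>X - Z\<close> be continuous with variation at most \<open>v\<close> on \<open>[0, T]\<close>. On a
  time grid, the effect of the noise is computed exactly by its semigroup, and each displacement by the drift
  costs one difference of an averaged indicator function. Summing up, \<open>X\<close> spends an expected time of at most \<open>const * m powr \<theta> * (1 + v)\<close> in an open set of Lebesgue measure \<open>m\<close>,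
  for some \<open>\<theta> > 0\<close> (\<open>occupation_bound\<close>). Consequently solutions spend no time in Lebesgue null sets,
  and the Lebesgue measurable, essentially bounded drift \<open>a\<close> may be replaced by a bounded Borel
  function \<open>b\<close> without changing the set of solutions (\<open>sde_solution_imp_solves\<close>,
  \<open>solves_imp_sde_solution\<close>).

  \<^emph>\<open>Uniqueness.\<close> Let \<open>P r g y\<close> be the mean of \<open>g (y + Z r)\<close>. Every solution satisfies
  \<open>E (g (X T)) = P T g x + \<integral> E (b (X s) * (P (T - s) g)' (X s)) ds\<close> over \<open>0 \<le> s \<le> T\<close>, up to a
  smoothing parameter (\<open>duhamel\<close>). Subtracting this for two solutions, the distance of their laws at
  time \<open>T\<close> is at most a constant times the integral of \<open>(T - s) powr (- 1 / \<alpha>)\<close> times the distance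
  at time \<open>s\<close>, so it vanishes (\<open>law_unique\<close>). In dimension one this already gives pathwise
  uniqueness: the maximum of two solutions is a solution as well (\<open>solves_max\<close>), it dominates
  both and has their laws at each time, hence it equals both (\<open>solves_unique\<close>).

  \<^emph>\<open>Existence.\<close> For a Lipschitz drift the equation is solved path by path by Picard iteration, and
  larger drifts give larger solutions (\<open>drift_comparison\<close>). The drift is an almost everywhere
  limit of uniformly bounded Lipschitz functions \<open>a n\<close>. The minima of \<open>a n, ..., a (n + k)\<close> are Lipschitz,
  decrease in \<open>k\<close>, and their limits increase in \<open>n\<close> to a version of the drift, so the solutions converge
  as \<open>k\<close> and then \<open>n\<close> tend to infinity. The limits again solve the equation: convergence of the
  drifts is uniform off sets of small Lebesgue measure, and all the solutions spend
  little time there (\<open>solves_limit\<close>). The construction uses at time \<open>t\<close> only the path of \<open>Z\<close> up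
  to \<open>t\<close>, which makes the solution strong.\<close>

section \<open>Densities of stable laws\<close>

lemma integrable_dominated:
  fixes f g :: "'a \<Rightarrow> real"
  assumes "integrable M g" "f \<in> borel_measurable M" "\<And>x. \<bar>f x\<bar> \<le> g x"
  shows "integrable M f"
  by (rule Bochner_Integration.integrable_bound[OF assms(1,2)])
     (use assms(3) in \<open>auto intro!: AE_I2 order_trans[OF assms(3) abs_ge_self]\<close>)

lemma has_real_derivative_lebesgue_integral:
  fixes f f' :: "real \<Rightarrow> 'a \<Rightarrow> real"
  assumes deriv: "\<And>z u. ((\<lambda>z. f z u) has_real_derivative f' z u) (at z)"
    and bound: "\<And>z u. \<bar>f' z u\<bar> \<le> G u" and G: "integrable N G"
    and int: "\<And>z. integrable N (f z)" and meas: "\<And>z. f' z \<in> borel_measurable N"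
  shows "((\<lambda>z. \<integral>u. f z u \<partial>N) has_real_derivative (\<integral>u. f' z u \<partial>N)) (at z)"
  unfolding has_field_derivative_iff tendsto_at_iff_sequentially
proof (intro allI impI)
  fix X :: "nat \<Rightarrow> real" assume X: "\<forall>i. X i \<in> UNIV - {z}" "X \<longlonglongrightarrow> z"
  have ne: "X i \<noteq> z" for i using X(1) by auto
  have "(\<lambda>i. \<integral>u. (f (X i) u - f z u) / (X i - z) \<partial>N) \<longlonglongrightarrow> (\<integral>u. f' z u \<partial>N)"
  proof (rule integral_dominated_convergence[where w=G])
    show "AE u in N. (\<lambda>i. (f (X i) u - f z u) / (X i - z)) \<longlonglongrightarrow> f' z u"
    proof (rule AE_I2)
      fix u
      have "((\<lambda>y. (f y u - f z u) / (y - z)) \<longlongrightarrow> f' z u) (at z)"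
        using deriv[of u z] by (simp add: has_field_derivative_iff)
      then show "(\<lambda>i. (f (X i) u - f z u) / (X i - z)) \<longlonglongrightarrow> f' z u"
        using X unfolding tendsto_at_iff_sequentially by (auto simp: o_def)
    qed
    show "AE u in N. norm ((f (X i) u - f z u) / (X i - z)) \<le> G u" for i
    proof (rule AE_I2)
      fix u
      have "norm (f (X i) u - f z u) \<le> G u * norm (X i - z)"
        by (rule field_differentiable_bound[of UNIV "\<lambda>z. f z u" "\<lambda>z. f' z u"])
           (use deriv bound in auto)
      then show "norm ((f (X i) u - f z u) / (X i - z)) \<le> G u"
        using ne[of i] by (simp add: divide_simps)
    qed
  qed (use G int meas in \<open>auto intro: borel_measurable_integrable\<close>)
  moreover have eq: "(\<integral>u. (f (X i) u - f z u) / (X i - z) \<partial>N) =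
      ((\<integral>u. f (X i) u \<partial>N) - (\<integral>u. f z u \<partial>N)) / (X i - z)" for i
    using int by simp
  ultimately show "((\<lambda>y. ((\<integral>u. f y u \<partial>N) - (\<integral>u. f z u \<partial>N)) / (y - z)) \<circ> X) \<longlonglongrightarrow> (\<integral>u. f' z u \<partial>N)"
    unfolding o_def eq by simp
qed

lemma has_real_derivative_abs_powr:
  assumes "1 < (\<alpha>::real)"
  shows "((\<lambda>u. \<bar>u\<bar> powr \<alpha>) has_real_derivative \<alpha> * sgn u * \<bar>u\<bar> powr (\<alpha> - 1)) (at u)"
proof (cases "u = 0")
  case True
  have *: "((\<lambda>h. \<bar>h\<bar> powr (\<alpha> - 1)) \<longlongrightarrow> \<bar>0::real\<bar> powr (\<alpha> - 1)) (at 0)"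
    by (rule tendsto_powr') (use assms in \<open>auto intro!: tendsto_eq_intros\<close>)
  have "((\<lambda>h. \<bar>h\<bar> powr \<alpha> / h) \<longlongrightarrow> 0) (at (0::real))"
  proof (rule Lim_null_comparison)
    show "\<forall>\<^sub>F h in at (0::real). norm (\<bar>h\<bar> powr \<alpha> / h) \<le> \<bar>h\<bar> powr (\<alpha> - 1)"
    proof (intro always_eventually allI)
      fix h :: real
      show "norm (\<bar>h\<bar> powr \<alpha> / h) \<le> \<bar>h\<bar> powr (\<alpha> - 1)"
        by (cases "h = 0") (auto simp: powr_diff)
    qed
  qed (use * in simp)
  then show ?thesis using True assms by (simp add: has_field_derivative_iff)
next
  case False
  then consider "u > 0" | "u < 0" by linarith
  then show ?thesis
  proof cases
    case 1
    have "((\<lambda>u. u powr \<alpha>) has_real_derivative \<alpha> * sgn u * \<bar>u\<bar> powr (\<alpha> - 1)) (at u)"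
      using has_real_derivative_powr[OF 1, of \<alpha>] 1 by simp
    then show ?thesis
      by (rule has_field_derivative_transform_within_open[where S="{0<..}"]) (use 1 in auto)
  next
    case 2
    have "((\<lambda>u. (- u) powr \<alpha>) has_real_derivative \<alpha> * sgn u * \<bar>u\<bar> powr (\<alpha> - 1)) (at u)"
      by (rule DERIV_cong, rule DERIV_fun_powr[where r=\<alpha>]) (use 2 in \<open>auto intro!: derivative_eq_intros\<close>)
    then show ?thesis
      by (rule has_field_derivative_transform_within_open[where S="{..<0}"]) (use 2 in auto)
  qed
qed

lemma isCont_sgn_abs_powr:
  assumes "0 < (b::real)"
  shows "isCont (\<lambda>u::real. sgn u * \<bar>u\<bar> powr b) u"
proof (cases "u = 0")
  case True
  have "((\<lambda>h. \<bar>h\<bar> powr b) \<longlongrightarrow> \<bar>0::real\<bar> powr b) (at 0)"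
    by (rule tendsto_powr') (use assms in \<open>auto intro!: tendsto_eq_intros\<close>)
  then have "((\<lambda>h. \<bar>h\<bar> powr b) \<longlongrightarrow> 0) (at (0::real))" using assms by simp
  then have "((\<lambda>h. sgn h * \<bar>h\<bar> powr b) \<longlongrightarrow> 0) (at (0::real))"
    by (rule Lim_null_comparison[rotated]) (auto simp: abs_mult sgn_if)
  then show ?thesis using True by (simp add: isCont_def)
next
  case False
  then show ?thesis
    by (intro continuous_intros) (auto simp: sgn_if isCont_def intro!: tendsto_eq_intros split: if_splits)
qed

lemma integrable_inverse_1_plus_square_lborel: "integrable lborel (\<lambda>x::real. 1 / (1 + x\<^sup>2))"
  using integrable_inverse_1_plus_square by (simp add: set_integrable_def inverse_eq_divide)

text \<open>Polynomial weights are absorbed because \<open>\<bar>u\<bar> powr \<alpha> \<ge>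
  \<bar>u\<bar> - 1\<close>, so the characteristic function decays at least exponentially.\<close>
lemma stable_char_decay:
  fixes c \<alpha> :: real
  assumes "0 < c" "1 < \<alpha>"
  obtains A where "0 < A" "\<And>u. (1 + \<bar>u\<bar>) ^ 4 * exp (- (c * \<bar>u\<bar> powr \<alpha>)) \<le> A * (1 / (1 + u\<^sup>2))"
proof -
  define B where "B = max 1 (6 / c)"
  have B: "1 \<le> B" "6 / c \<le> B" by (auto simp: B_def)
  have main: "(1 + \<bar>u\<bar>) ^ 4 * exp (- (c * \<bar>u\<bar> powr \<alpha>)) \<le> (B ^ 6 * exp c) * (1 / (1 + u\<^sup>2))" for u :: real
  proof -
    have "\<bar>u\<bar> - 1 \<le> \<bar>u\<bar> powr \<alpha>"
    proof (cases "1 \<le> \<bar>u\<bar>")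
      case True
      then have "\<bar>u\<bar> powr 1 \<le> \<bar>u\<bar> powr \<alpha>" using assms by (intro powr_mono) auto
      then show ?thesis using True by simp
    qed (smt (verit) powr_ge_zero)
    then have "c * (\<bar>u\<bar> - 1) \<le> c * \<bar>u\<bar> powr \<alpha>" using assms by (intro mult_left_mono) auto
    then have e1: "exp (- (c * \<bar>u\<bar> powr \<alpha>)) \<le> exp c * exp (- (c * \<bar>u\<bar>))"
      by (simp flip: exp_add add: algebra_simps)
    have "(1 + \<bar>u\<bar>) \<le> B * (1 + c * \<bar>u\<bar> / 6)"
    proof -
      have "6 \<le> B * c" using B(2) assms by (simp add: field_simps)
      then have "6 * \<bar>u\<bar> \<le> B * c * \<bar>u\<bar>" by (intro mult_right_mono) auto
      then show ?thesis using B(1) by (simp add: algebra_simps)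
    qed
    then have "(1 + \<bar>u\<bar>) ^ 6 \<le> (B * (1 + c * \<bar>u\<bar> / 6)) ^ 6" by (intro power_mono) auto
    also have "\<dots> = B ^ 6 * (1 + c * \<bar>u\<bar> / 6) ^ 6" by (rule power_mult_distrib)
    also have "\<dots> \<le> B ^ 6 * exp (c * \<bar>u\<bar>)"
    proof (intro mult_left_mono)
      have "- real 6 \<le> c * \<bar>u\<bar>" using assms by (simp add: order_trans[of _ 0])
      then show "(1 + c * \<bar>u\<bar> / 6) ^ 6 \<le> exp (c * \<bar>u\<bar>)"
        using exp_ge_one_plus_x_over_n_power_n[of 6 "c * \<bar>u\<bar>"] by simp
    qed (use B in auto)
    finally have e2: "(1 + \<bar>u\<bar>) ^ 6 \<le> B ^ 6 * exp (c * \<bar>u\<bar>)" .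
    have "(1 + u\<^sup>2) \<le> (1 + \<bar>u\<bar>)\<^sup>2" by (simp add: power2_eq_square algebra_simps)
    then have "(1 + \<bar>u\<bar>) ^ 4 * (1 + u\<^sup>2) \<le> (1 + \<bar>u\<bar>) ^ 4 * (1 + \<bar>u\<bar>)\<^sup>2" by (intro mult_left_mono) auto
    also have "\<dots> = (1 + \<bar>u\<bar>) ^ 6" by (simp flip: power_add)
    also note e2
    finally have "(1 + \<bar>u\<bar>) ^ 4 * (1 + u\<^sup>2) * exp (- (c * \<bar>u\<bar> powr \<alpha>)) \<le>
        (B ^ 6 * exp (c * \<bar>u\<bar>)) * (exp c * exp (- (c * \<bar>u\<bar>)))"
      by (rule mult_mono) (use e1 B in auto)
    also have "\<dots> = B ^ 6 * exp c" by (simp add: exp_minus)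
    finally have "(1 + \<bar>u\<bar>) ^ 4 * exp (- (c * \<bar>u\<bar> powr \<alpha>)) * (1 + u\<^sup>2) \<le> B ^ 6 * exp c"
      by (simp add: algebra_simps)
    then show ?thesis by (simp add: pos_le_divide_eq add_pos_nonneg)
  qed
  then show ?thesis using B by (intro that[of "B ^ 6 * exp c"]) auto
qed

text \<open>Integrating by parts twice turns the factor \<open>z\<^sup>2\<close> into two
  derivatives of \<open>u * \<psi> u\<close>, of which \<open>k2\<close> is the second. The factor
  \<open>u\<close> compensates the singularity of \<open>\<psi>''\<close> at \<open>0\<close>, so
  \<open>k2\<close> is continuous, and the decay of \<open>\<psi>\<close> kills the boundary terms.
  This is what bounds the derivative of the stable density by a multiple of \<open>1 / (1 +
  z\<^sup>2)\<close>.\<close>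
lemma stable_kernel_by_parts:
  fixes c \<alpha> z :: real
  assumes c: "0 < c" and \<alpha>: "1 < \<alpha>" "\<alpha> < 2"
  defines "\<psi> \<equiv> \<lambda>u. exp (- (c * \<bar>u\<bar> powr \<alpha>))"
  defines "q \<equiv> \<lambda>u. \<bar>u\<bar> powr \<alpha>" and "q' \<equiv> \<lambda>u. \<alpha> * sgn u * \<bar>u\<bar> powr (\<alpha> - 1)"
  defines "k2 \<equiv> \<lambda>u. - (c * q' u * \<psi> u * (1 - c * \<alpha> * q u)) - c * \<alpha> * q' u * \<psi> u"
  shows "integrable lborel (\<lambda>u. sin (u * z) * (u * \<psi> u))"
    and "integrable lborel k2"
    and "z\<^sup>2 * (\<integral>u. sin (u * z) * (u * \<psi> u) \<partial>lborel) = - (\<integral>u. sin (u * z) * k2 u \<partial>lborel)"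
proof -
  obtain A where A: "0 < A" "\<And>u. (1 + \<bar>u\<bar>) ^ 4 * \<psi> u \<le> A * (1 / (1 + u\<^sup>2))"
    using stable_char_decay[OF c \<alpha>(1)] unfolding \<psi>_def by blast
  have \<psi>0: "0 \<le> \<psi> u" for u by (simp add: \<psi>_def)
  have dq: "(q has_real_derivative q' u) (at u)" for u
    unfolding q_def q'_def by (rule has_real_derivative_abs_powr) fact
  have d\<psi>: "(\<psi> has_real_derivative - (c * q' u) * \<psi> u) (at u)" for u
    unfolding \<psi>_def
    by (rule DERIV_cong, rule DERIV_fun_exp, rule DERIV_minus, rule DERIV_cmult, rule dq[unfolded q_def])
       (simp add: algebra_simps)
  have uq: "u * q' u = \<alpha> * q u" for u
    by (cases "u = 0") (auto simp: q'_def q_def powr_diff sgn_if)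
  have [measurable]: "\<psi> \<in> borel_measurable borel" "q \<in> borel_measurable borel" "q' \<in> borel_measurable borel"
    by (simp_all add: \<psi>_def q_def q'_def sgn_real_def)
  have cq': "isCont q' u" for u
    using isCont_sgn_abs_powr[of "\<alpha> - 1" u] \<alpha> unfolding q'_def by (simp add: mult.assoc)
  have cq: "isCont q u" and c\<psi>: "isCont \<psi> u" for u using dq d\<psi> DERIV_isCont by blast+
  have ck2: "isCont k2 u" for u unfolding k2_def by (intro continuous_intros cq cq' c\<psi>)
  have pw: "\<bar>u\<bar> powr s \<le> (1 + \<bar>u\<bar>)\<^sup>2" if "0 \<le> s" "s \<le> 2" for s u :: real
  proof -
    have "\<bar>u\<bar> powr s \<le> (1 + \<bar>u\<bar>) powr s" using that by (intro powr_mono2) auto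
    also have "\<dots> \<le> (1 + \<bar>u\<bar>) powr 2" using that by (intro powr_mono) auto
    finally show ?thesis by (simp add: powr_numeral)
  qed
  define B where "B = c * \<alpha> * (1 + c * \<alpha>) + c * \<alpha> * \<alpha>"
  have B0: "0 \<le> B" using c \<alpha> by (simp add: B_def)
  have k2b: "\<bar>k2 u\<bar> \<le> B * A * (1 / (1 + u\<^sup>2))" for u
  proof -
    let ?w = "(1 + \<bar>u\<bar>)\<^sup>2"
    have w1: "1 \<le> ?w" by (simp add: one_le_power)
    have q1: "0 \<le> q u" "q u \<le> ?w" using pw[of \<alpha> u] \<alpha> by (auto simp: q_def)
    have q'1: "\<bar>q' u\<bar> \<le> \<alpha> * ?w" using pw[of "\<alpha> - 1" u] \<alpha>
      by (auto simp: q'_def abs_mult abs_sgn_eq)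
    have t1: "\<bar>1 - c * \<alpha> * q u\<bar> \<le> (1 + c * \<alpha>) * ?w"
    proof -
      have "\<bar>1 - c * \<alpha> * q u\<bar> \<le> 1 + c * \<alpha> * q u" using q1 c \<alpha> by (simp add: abs_le_iff)
      also have "\<dots> \<le> ?w + c * \<alpha> * ?w" using q1 c \<alpha> w1 by (intro add_mono mult_left_mono) auto
      finally show ?thesis by (simp add: algebra_simps)
    qed
    have "\<bar>k2 u\<bar> \<le> c * \<bar>q' u\<bar> * \<psi> u * \<bar>1 - c * \<alpha> * q u\<bar> + c * \<alpha> * \<bar>q' u\<bar> * \<psi> u"
      unfolding k2_def using c \<alpha> \<psi>0[of u] by (intro order_trans[OF abs_triangle_ineq4]) (simp add: abs_mult)
    also have "\<dots> \<le> c * (\<alpha> * ?w) * \<psi> u * ((1 + c * \<alpha>) * ?w) + c * \<alpha> * (\<alpha> * ?w) * (\<psi> u * ?w)"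
      using c \<alpha> \<psi>0[of u] q'1 t1 w1
      by (intro add_mono mult_mono mult_nonneg_nonneg) (auto simp: mult_le_cancel_left1)
    also have "\<dots> = B * ((1 + \<bar>u\<bar>) ^ 4 * \<psi> u)"
    proof -
      have "(1 + \<bar>u\<bar>) ^ 4 = ?w * ?w" by (simp flip: power_add)
      then show ?thesis by (simp add: B_def algebra_simps)
    qed
    also have "\<dots> \<le> B * (A * (1 / (1 + u\<^sup>2)))" using A(2) B0 by (intro mult_left_mono) auto
    finally show ?thesis by (simp add: mult.assoc)
  qed
  have ub: "\<bar>u * \<psi> u\<bar> \<le> A * (1 / (1 + u\<^sup>2))" for u
  proof -
    have "\<bar>u\<bar> \<le> (1 + \<bar>u\<bar>) ^ 1" by simp
    also have "\<dots> \<le> (1 + \<bar>u\<bar>) ^ 4" by (intro power_increasing) auto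
    finally have "\<bar>u * \<psi> u\<bar> \<le> (1 + \<bar>u\<bar>) ^ 4 * \<psi> u"
      using \<psi>0[of u] by (auto simp: abs_mult intro!: mult_right_mono)
    then show ?thesis using A(2)[of u] by linarith
  qed
  have k1b: "\<bar>\<psi> u * (1 - c * \<alpha> * q u)\<bar> \<le> (1 + c * \<alpha>) * A * (1 / (1 + u\<^sup>2))" for u
  proof -
    let ?w = "(1 + \<bar>u\<bar>)\<^sup>2"
    have w1: "1 \<le> ?w" by (simp add: one_le_power)
    have q1: "0 \<le> q u" "q u \<le> ?w" using pw[of \<alpha> u] \<alpha> by (auto simp: q_def)
    have "\<bar>1 - c * \<alpha> * q u\<bar> \<le> 1 + c * \<alpha> * q u" using q1 c \<alpha> by (simp add: abs_le_iff)
    also have "\<dots> \<le> ?w + c * \<alpha> * ?w" using q1 c \<alpha> w1 by (intro add_mono mult_left_mono) auto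
    also have "\<dots> = (1 + c * \<alpha>) * (1 + \<bar>u\<bar>) ^ 2" by (simp add: algebra_simps)
    also have "\<dots> \<le> (1 + c * \<alpha>) * (1 + \<bar>u\<bar>) ^ 4" using c \<alpha>
      by (intro mult_left_mono power_increasing) auto
    finally have "\<bar>1 - c * \<alpha> * q u\<bar> * \<psi> u \<le> (1 + c * \<alpha>) * (1 + \<bar>u\<bar>) ^ 4 * \<psi> u"
      using \<psi>0 by (intro mult_right_mono)
    also have "\<dots> = (1 + c * \<alpha>) * ((1 + \<bar>u\<bar>) ^ 4 * \<psi> u)" by simp
    also have "\<dots> \<le> (1 + c * \<alpha>) * (A * (1 / (1 + u\<^sup>2)))" using A(2) c \<alpha> by (intro mult_left_mono) auto
    finally show ?thesis using \<psi>0[of u] by (simp add: abs_mult mult.commute)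
  qed
  have dom: "integrable lborel (\<lambda>u::real. C * (1 / (1 + u\<^sup>2)))" for C :: real
    using integrable_inverse_1_plus_square_lborel by (rule integrable_mult_right)
  show i1: "integrable lborel (\<lambda>u. sin (u * z) * (u * \<psi> u))"
  proof (rule integrable_dominated[OF dom[of A]])
    show "\<bar>sin (u * z) * (u * \<psi> u)\<bar> \<le> A * (1 / (1 + u\<^sup>2))" for u
    proof -
      have "\<bar>sin (u * z)\<bar> * \<bar>u * \<psi> u\<bar> \<le> 1 * \<bar>u * \<psi> u\<bar>" by (intro mult_right_mono) auto
      then show ?thesis using ub[of u] unfolding abs_mult[of "sin (u * z)"] by linarith
    qed
  qed measurable
  have k2m[measurable]: "k2 \<in> borel_measurable borel" unfolding k2_def by measurable
  show i2: "integrable lborel k2"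
    by (rule integrable_dominated[OF dom[of "B * A"]]) (use k2b in auto)
  have i3: "integrable lborel (\<lambda>u. sin (u * z) * k2 u)"
  proof (rule Bochner_Integration.integrable_bound[OF i2])
    show "AE u in lborel. norm (sin (u * z) * k2 u) \<le> norm (k2 u)"
      by (intro AE_I2) (auto simp: abs_mult intro!: mult_left_le_one_le)
  qed measurable
  show "z\<^sup>2 * (\<integral>u. sin (u * z) * (u * \<psi> u) \<partial>lborel) = - (\<integral>u. sin (u * z) * k2 u \<partial>lborel)"
  proof -
    define k1 where "k1 u = \<psi> u * (1 - c * \<alpha> * q u)" for u
    \<comment> \<open>\<open>V\<close> is a primitive of the sum \<open>v\<close> of the two
      integrands and vanishes at infinity, so \<open>v\<close> has integral
      \<open>0\<close>.\<close>
    define V where "V u = - z * cos (u * z) * (u * \<psi> u) + sin (u * z) * k1 u" for u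
    define v where "v u = z\<^sup>2 * (sin (u * z) * (u * \<psi> u)) + sin (u * z) * k2 u" for u
    have dk: "((\<lambda>u. u * \<psi> u) has_real_derivative k1 u) (at u)" for u
      by (rule DERIV_cong, rule DERIV_mult[OF DERIV_ident d\<psi>])
         (use uq[of u] in \<open>simp add: k1_def algebra_simps\<close>)
    have dk1: "(k1 has_real_derivative k2 u) (at u)" for u
      unfolding k1_def
      by (rule DERIV_cong, rule DERIV_mult[OF d\<psi> DERIV_diff[OF DERIV_const DERIV_cmult[OF dq]]])
         (simp add: k2_def algebra_simps)
    have dV: "(V has_real_derivative v u) (at u)" for u
      unfolding V_def v_def
      by (rule derivative_eq_intros dk dk1 refl)+ (simp add: algebra_simps power2_eq_square)
    have iv: "integrable lborel v" unfolding v_def using i1 i3 by simp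
    have Vb: "norm (V u) \<le> (\<bar>z\<bar> * A + (1 + c * \<alpha>) * A) * (1 / (1 + u\<^sup>2))" for u
    proof -
      have "\<bar>V u\<bar> \<le> \<bar>z\<bar> * \<bar>cos (u * z)\<bar> * \<bar>u * \<psi> u\<bar> + \<bar>sin (u * z)\<bar> * \<bar>k1 u\<bar>"
        unfolding V_def by (intro order_trans[OF abs_triangle_ineq]) (simp add: abs_mult)
      also have "\<dots> \<le> \<bar>z\<bar> * 1 * (A * (1 / (1 + u\<^sup>2))) + 1 * ((1 + c * \<alpha>) * A * (1 / (1 + u\<^sup>2)))"
        using ub[of u] k1b[of u] by (intro add_mono mult_mono) (auto simp: k1_def)
      finally show ?thesis by (simp add: algebra_simps add_divide_distrib)
    qed
    have lim0: "((\<lambda>u::real. C * (1 / (1 + u\<^sup>2))) \<longlongrightarrow> 0) at_top" "((\<lambda>u::real. C * (1 / (1 + u\<^sup>2))) \<longlongrightarrow> 0) at_bot" for C :: real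
      by real_asymp+
    have V1: "(V \<longlongrightarrow> 0) at_top" "(V \<longlongrightarrow> 0) at_bot"
      by (rule Lim_null_comparison[OF always_eventually lim0(1)] Lim_null_comparison[OF always_eventually lim0(2)], use Vb in blast)+
    have "(LBINT u=-\<infinity>..\<infinity>. v u) = 0 - 0"
    proof (rule interval_integral_FTC_integrable[where F=V])
      show "set_integrable lborel (einterval (-\<infinity>) \<infinity>) v" using iv by (simp add: set_integrable_def)
      show "((V \<circ> real_of_ereal) \<longlongrightarrow> 0) (at_right (-\<infinity>))" "((V \<circ> real_of_ereal) \<longlongrightarrow> 0) (at_left \<infinity>)"
        using V1 by (simp_all add: ereal_tendsto_simps)
      show "isCont v x" for x unfolding v_def by (intro continuous_intros c\<psi> ck2)
      show "(V has_vector_derivative v x) (at x)" for x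
        using dV[of x] by (simp add: has_real_derivative_iff_has_vector_derivative)
    qed simp
    then have "(\<integral>u. v u \<partial>lborel) = 0" by (simp add: interval_integral_eq_integral interval_lebesgue_integral_def set_lebesgue_integral_def)
    then show ?thesis unfolding v_def using i1 i3 by simp
  qed
qed

text \<open>Fourier inversion. Rather than inverting the measure at once, the primitive
  \<open>P\<close> of the candidate density \<open>p\<close> is compared with the distribution
  function: Levy's inversion formula gives \<open>cdf b - cdf a = P b - P a\<close> for
  \<open>a\<close>, \<open>b\<close> that are not atoms, and since non-atoms are dense, right
  continuity extends this to all \<open>a\<close>, \<open>b\<close>. Monotonicity of the
  distribution function then yields \<open>p \<ge> 0\<close>.\<close>
lemma (in real_distribution) stable_density:
  fixes c \<alpha> :: real
  assumes c: "0 < c" and \<alpha>: "1 < \<alpha>" "\<alpha> < 2"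
    and char: "\<And>u. char M u = complex_of_real (exp (- (c * \<bar>u\<bar> powr \<alpha>)))"
  obtains p p' :: "real \<Rightarrow> real" and C where "0 < C" "\<And>z. (p has_real_derivative p' z) (at z)" "\<And>z. 0 \<le> p z"
    "\<And>z. p z \<le> C" "\<And>z. \<bar>p' z\<bar> \<le> C * (1 / (1 + z\<^sup>2))" "p' \<in> borel_measurable borel"
    "M = density lborel p"
proof -
  define \<psi> where "\<psi> u = exp (- (c * \<bar>u\<bar> powr \<alpha>))" for u
  obtain A where A: "0 < A" "\<And>u. (1 + \<bar>u\<bar>) ^ 4 * \<psi> u \<le> A * (1 / (1 + u\<^sup>2))"
    using stable_char_decay[OF c \<alpha>(1)] unfolding \<psi>_def by blast
  have \<psi>0: "0 \<le> \<psi> u" for u by (simp add: \<psi>_def)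
  have [measurable]: "\<psi> \<in> borel_measurable borel" unfolding \<psi>_def by measurable
  have dom: "integrable lborel (\<lambda>u::real. A * (1 / (1 + u\<^sup>2)))"
    using integrable_inverse_1_plus_square_lborel by (rule integrable_mult_right)
  have \<psi>b: "\<psi> u \<le> A * (1 / (1 + u\<^sup>2))" "\<bar>u\<bar> * \<psi> u \<le> A * (1 / (1 + u\<^sup>2))" for u
  proof -
    have *: "1 \<le> (1 + \<bar>u\<bar>) ^ 4" by (simp add: one_le_power)
    have "(1 + \<bar>u\<bar>) ^ 1 \<le> (1 + \<bar>u\<bar>) ^ 4" by (intro power_increasing) auto
    then have "\<bar>u\<bar> \<le> (1 + \<bar>u\<bar>) ^ 4" by simp
    with * show "\<psi> u \<le> A * (1 / (1 + u\<^sup>2))" "\<bar>u\<bar> * \<psi> u \<le> A * (1 / (1 + u\<^sup>2))"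
      using A(2)[of u] \<psi>0[of u] mult_right_mono[of 1 "(1 + \<bar>u\<bar>) ^ 4" "\<psi> u"]
        mult_right_mono[of "\<bar>u\<bar>" "(1 + \<bar>u\<bar>) ^ 4" "\<psi> u"] by auto
  qed
  have \<psi>i: "integrable lborel \<psi>" and u\<psi>i: "integrable lborel (\<lambda>u. \<bar>u\<bar> * \<psi> u)"
    by (rule integrable_dominated[OF dom]; use \<psi>b \<psi>0 in \<open>simp add: abs_mult\<close>)+
  define p where "p z = (1 / (2 * pi)) * (\<integral>u. cos (u * z) * \<psi> u \<partial>lborel)" for z
  define p' where "p' z = (1 / (2 * pi)) * (\<integral>u. - (sin (u * z) * (u * \<psi> u)) \<partial>lborel)" for z
  define s where "s z u = (if u = 0 then z else sin (u * z) / u)" for z u :: real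
  define P where "P z = (1 / (2 * pi)) * (\<integral>u. s z u * \<psi> u \<partial>lborel)" for z
  have cosb: "\<bar>cos (u * z) * \<psi> u\<bar> \<le> \<psi> u" for u z
    using \<psi>0[of u] by (auto simp: abs_mult intro!: mult_left_le_one_le)
  have cosi: "integrable lborel (\<lambda>u. cos (u * z) * \<psi> u)" for z
    by (rule integrable_dominated[OF \<psi>i]) (use cosb in auto)
  have dp: "(p has_real_derivative p' z) (at z)" for z
    unfolding p_def p'_def
  proof (intro DERIV_cmult has_real_derivative_lebesgue_integral[where G="\<lambda>u. \<bar>u\<bar> * \<psi> u"])
    show "((\<lambda>z. cos (u * z) * \<psi> u) has_real_derivative - (sin (u * z) * (u * \<psi> u))) (at z)" for z u
      by (auto intro!: derivative_eq_intros)
    show "\<bar>- (sin (u * z) * (u * \<psi> u))\<bar> \<le> \<bar>u\<bar> * \<psi> u" for z u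
      using \<psi>0[of u] by (auto simp: abs_mult intro!: mult_left_le_one_le)
  qed (use cosi u\<psi>i in auto)
  have sm[measurable]: "s z \<in> borel_measurable borel" for z unfolding s_def by measurable
  have sb: "\<bar>s z u\<bar> \<le> \<bar>z\<bar>" for z u
    unfolding s_def using abs_sin_x_le_abs_x[of "u * z"] by (auto simp: abs_mult divide_simps mult.commute)
  have si: "integrable lborel (\<lambda>u. s z u * \<psi> u)" for z
    by (rule integrable_dominated[OF integrable_mult_right[OF \<psi>i, of "\<bar>z\<bar>"]])
       (use sb[of z] \<psi>0 in \<open>auto intro!: mult_right_mono simp: abs_mult\<close>)
  have dP: "(P has_real_derivative p z) (at z)" for z
    unfolding P_def p_def
  proof (intro DERIV_cmult has_real_derivative_lebesgue_integral[where G=\<psi>])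
    show "((\<lambda>z. s z u * \<psi> u) has_real_derivative cos (u * z) * \<psi> u) (at z)" for z u
      by (cases "u = 0") (auto simp: s_def intro!: derivative_eq_intros)
  qed (use cosi \<psi>i cosb si in auto)
  have pc: "continuous_on UNIV p" using dp by (intro continuous_at_imp_continuous_on ballI DERIV_isCont) auto
  have pm[measurable]: "p \<in> borel_measurable borel" by (rule borel_measurable_continuous_onI[OF pc])
  have inv: "prob {a<..b} = P b - P a" if ab: "a \<le> b" and at: "prob {a} = 0" "prob {b} = 0" for a b
  proof -
    define G where "G t = (iexp (-(t * a)) - iexp (-(t * b))) / (\<i> * t) * char M t" for t :: real
    define H where "H t = (if t = 0 then 0 else G t)" for t
    have Gn: "norm (G t) \<le> (b - a) * \<psi> t" for t
    proof (cases "t = 0")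
      case True then show ?thesis using ab \<psi>0[of 0] by (simp add: G_def)
    next
      case False
      have "norm ((iexp (-(t * a)) - iexp (-(t * b))) / (\<i> * t)) \<le> b - a"
        using Levy_Inversion_aux2[of "-b" "-a" t] ab False by simp
      then show ?thesis unfolding G_def norm_mult using \<psi>0[of t] char[of t]
        by (auto simp: \<psi>_def intro!: mult_right_mono)
    qed
    have Gm[measurable]: "G \<in> borel_measurable borel"
      unfolding G_def char by measurable
    have Gi: "integrable lborel G"
      by (rule Bochner_Integration.integrable_bound[OF integrable_mult_right[OF \<psi>i, of "b - a"]])
         (use Gn in \<open>auto intro!: AE_I2 order_trans[OF Gn abs_ge_self]\<close>)
    have "(\<lambda>n. CLBINT t=-real n..real n. G t) \<longlonglongrightarrow> (CLBINT t. G t)"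
    proof -
      have eq: "(CLBINT t=-real n..real n. G t) = (CLBINT t. indicator {-real n..real n} t *\<^sub>R G t)" for n
        using interval_integral_Icc[of "-real n" "real n" G]
        by (simp add: set_lebesgue_integral_def)
      show ?thesis unfolding eq
      proof (rule integral_dominated_convergence[where w="\<lambda>t. norm (G t)"])
        show "AE t in lborel. (\<lambda>i. indicat_real {- real i..real i} t *\<^sub>R G t) \<longlonglongrightarrow> G t"
        proof (rule AE_I2)
          fix t :: real
          obtain N where N: "\<bar>t\<bar> \<le> real N" using real_arch_simple by blast
          have "\<forall>\<^sub>F i in sequentially. indicat_real {- real i..real i} t *\<^sub>R G t = G t"
            using eventually_ge_at_top[of N] by eventually_elim (use N in \<open>auto simp: indicator_def abs_le_iff\<close>)
          then show "(\<lambda>i. indicat_real {- real i..real i} t *\<^sub>R G t) \<longlonglongrightarrow> G t" by (rule tendsto_eventually)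
        qed
      qed (use Gi in \<open>auto intro!: AE_I2 simp: indicator_def\<close>)
    qed
    then have l1: "(\<lambda>n. 1 / (2 * pi) * (CLBINT t=-real n..real n. G t)) \<longlonglongrightarrow> 1 / (2 * pi) * (CLBINT t. G t)"
      by (intro tendsto_intros)
    have "(\<lambda>n. 1 / (2 * pi) * (CLBINT t=-real n..real n. G t)) \<longlonglongrightarrow> prob {a<..b}"
      using Levy_Inversion[OF ab at] unfolding G_def by simp
    from LIMSEQ_unique[OF this l1] have "prob {a<..b} = Re (complex_of_real (1 / (2 * pi)) * (CLBINT t. G t))"
      by (metis Re_complex_of_real of_real_1 of_real_divide of_real_mult of_real_numeral)
    also have "\<dots> = 1 / (2 * pi) * Re (CLBINT t. G t)" by (simp only: times_complex.sel Re_complex_of_real Im_complex_of_real mult_zero_left diff_zero)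
    also have "Re (CLBINT t. G t) = (\<integral>t. Re (G t) \<partial>lborel)" using Gi by simp
    also have "\<dots> = (\<integral>t. s b t * \<psi> t - s a t * \<psi> t \<partial>lborel)"
    proof (rule integral_cong_AE)
      show "AE t in lborel. Re (G t) = s b t * \<psi> t - s a t * \<psi> t"
      proof (rule AE_mp[OF AE_lborel_singleton[of 0]], rule AE_I2, rule impI)
        fix t :: real assume t: "t \<noteq> 0"
        have "Re ((iexp (-(t * a)) - iexp (-(t * b))) / (\<i> * t)) = (sin (t * b) - sin (t * a)) / t"
          using t by (simp add: Re_divide Re_exp Im_exp power2_eq_square field_simps)
        then show "Re (G t) = s b t * \<psi> t - s a t * \<psi> t"
          unfolding G_def char s_def \<psi>_def[symmetric] times_complex.sel
            Re_complex_of_real Im_complex_of_real using t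
          by (simp add: left_diff_distrib diff_divide_distrib)
      qed
    qed measurable
    also have "\<dots> = (\<integral>t. s b t * \<psi> t \<partial>lborel) - (\<integral>t. s a t * \<psi> t \<partial>lborel)" using si by simp
    finally show ?thesis by (simp add: P_def right_diff_distrib)
  qed
  have cdfP: "cdf M b - cdf M a = P b - P a" if "a \<le> b" "prob {a} = 0" "prob {b} = 0" for a b
    using inv[OF that] cdf_diff_eq[of a b] that by (cases "a = b") auto
  have dense: "\<exists>y. x < y \<and> y < x + e \<and> prob {y} = 0" if "0 < e" for x e :: real
  proof -
    have "uncountable {x<..<x+e}" using that by (simp add: uncountable_open_interval)
    then have "\<not> {x<..<x+e} \<subseteq> {y. prob {y} > 0}" using countable_atoms countable_subset by blast
    then show ?thesis by (force simp: zero_less_measure_iff)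
  qed
  have diff: "cdf M b - cdf M a = P b - P a" if "a \<le> b" for a b
  proof -
    have "\<exists>y. \<forall>n. x < y n \<and> y n < x + 1 / real (Suc n) \<and> prob {y n} = 0" for x :: real
      by (intro choice allI dense) simp
    then obtain y where y: "\<And>x n. x < y x n \<and> y x n < x + 1 / real (Suc n) \<and> prob {y x n} = 0" by metis
    have yl: "(\<lambda>n. y x n) \<longlonglongrightarrow> x" for x
    proof (rule real_tendsto_sandwich[of "\<lambda>_. x" _ _ "\<lambda>n. x + 1 / real (Suc n)"])
      show "(\<lambda>n. x + 1 / real (Suc n)) \<longlonglongrightarrow> x"
        using tendsto_add[OF tendsto_const LIMSEQ_inverse_real_of_nat, of x] by (simp add: inverse_eq_divide)
    qed (use y in \<open>auto intro!: always_eventually less_imp_le\<close>)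
    have yr: "filterlim (\<lambda>n. y x n) (at_right x) sequentially" for x
    proof -
      have "y x n \<in> {x<..} \<and> y x n \<noteq> x" for n using y[of x n] by auto
      then show ?thesis using yl[of x] unfolding filterlim_at by (auto intro!: always_eventually)
    qed
    have lim: "(\<lambda>n. cdf M (y x n) - P (y x n)) \<longlonglongrightarrow> cdf M x - P x" for x
      using cdf_is_right_cont[of x] DERIV_isCont[OF dP, of x]
      by (intro tendsto_diff) (auto simp: continuous_within intro: filterlim_compose[OF _ yr] isCont_tendsto_compose[OF _ yl])
    have const: "cdf M (y x n) - P (y x n) = cdf M (y x' m) - P (y x' m)" for x x' n m
      using cdfP[of "y x n" "y x' m"] cdfP[of "y x' m" "y x n"] y by (cases "y x n \<le> y x' m") (auto simp: algebra_simps)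
    have "(\<lambda>n. cdf M (y b n) - P (y b n)) = (\<lambda>n. cdf M (y a n) - P (y a n))" using const by blast
    with lim[of a] lim[of b] have "cdf M a - P a = cdf M b - P b" using LIMSEQ_unique by metis
    then show ?thesis by simp
  qed
  have p0: "0 \<le> p z" for z
  proof (rule ccontr)
    assume "\<not> 0 \<le> p z"
    then obtain d where "0 < d" "\<forall>h>0. h < d \<longrightarrow> P (z + h) < P z"
      using DERIV_neg_dec_right[OF dP, of z] by auto
    then have "P (z + d / 2) < P z" by auto
    with diff[of z "z + d / 2"] cdf_nondecreasing[of z "z + d / 2"] \<open>0 < d\<close> show False by simp
  qed
  have Meq: "M = density lborel p"
  proof (rule measure_eqI_generator_eq[where E="range (\<lambda>(a, b). {a <.. b::real})" and \<Omega>=UNIV and A="\<lambda>n. {- real n<..real n}"])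
    show "Int_stable (range (\<lambda>(a, b). {a <.. b::real}))"
      by (auto simp: Int_stable_def)
    have *: "sets borel = sigma_sets UNIV (range (\<lambda>(a, b). {a <.. b::real}))"
      by (subst borel_sigma_sets_Ioc) (rule sets_measure_of, simp)
    show "sets M = sigma_sets UNIV (range (\<lambda>(a, b). {a <.. b::real}))"
         "sets (density lborel p) = sigma_sets UNIV (range (\<lambda>(a, b). {a <.. b::real}))"
      using * by (simp_all add: M_is_borel)
    fix X assume "X \<in> range (\<lambda>(a, b). {a <.. b::real})"
    then obtain a b where X: "X = {a<..b}" by auto
    show "emeasure M X = emeasure (density lborel p) X"
    proof (cases "a \<le> b")
      case True
      have "emeasure (density lborel p) X = (\<integral>\<^sup>+x. ennreal (p x) * indicator {a<..b} x \<partial>lborel)"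
        unfolding X by (rule emeasure_density) auto
      also have "\<dots> = (\<integral>\<^sup>+x. ennreal (p x) * indicator {a..b} x \<partial>lborel)"
        by (rule nn_integral_cong_AE, rule AE_mp[OF AE_lborel_singleton[of a]]) (auto simp: indicator_def)
      also have "\<dots> = ennreal (P b - P a)"
        by (rule nn_integral_FTC_Icc) (use dP p0 True in auto)
      also have "\<dots> = ennreal (prob X)" using diff[OF True] cdf_diff_eq[of a b] True X by (cases "a = b") auto
      finally show ?thesis by (simp add: emeasure_eq_measure)
    qed (simp add: X)
  next
    show "emeasure M {- real n<..real n} \<noteq> \<infinity>" for n by (simp add: emeasure_eq_measure)
  qed (use UN_Ioc_eq_UNIV in auto)
  define I where "I = (\<integral>u. \<psi> u \<partial>lborel)"
  have pb: "p z \<le> I" for z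
  proof -
    have "(\<integral>u. cos (u * z) * \<psi> u \<partial>lborel) \<le> I"
      unfolding I_def by (rule integral_mono[OF cosi \<psi>i]) (use cosb in \<open>force simp: abs_le_iff\<close>)
    moreover have I0: "0 \<le> I" unfolding I_def using \<psi>0 by simp
    ultimately show ?thesis
    proof -
      have "p z \<le> (1 / (2 * pi)) * I" unfolding p_def by (rule mult_left_mono) (fact, simp)
      also have "\<dots> \<le> 1 * I" using I0 pi_gt3 by (intro mult_right_mono) (auto simp: field_simps)
      finally show ?thesis by simp
    qed
  qed
  define k2 where "k2 u = - (c * (\<alpha> * sgn u * \<bar>u\<bar> powr (\<alpha> - 1)) * \<psi> u * (1 - c * \<alpha> * \<bar>u\<bar> powr \<alpha>))
      - c * \<alpha> * (\<alpha> * sgn u * \<bar>u\<bar> powr (\<alpha> - 1)) * \<psi> u" for u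
  define J where "J = (\<integral>u. \<bar>u\<bar> * \<psi> u \<partial>lborel) + (\<integral>u. \<bar>k2 u\<bar> \<partial>lborel)"
  note parts = stable_kernel_by_parts[OF c \<alpha>, folded \<psi>_def, folded k2_def]
  have pi2: "\<bar>1 / (2 * pi) * x\<bar> \<le> \<bar>x\<bar>" for x
    using pi_gt3 mult_left_mono[of 1 "2 * pi" "\<bar>x\<bar>"] by (simp add: abs_mult divide_simps)
  have p'b: "(1 + z\<^sup>2) * \<bar>p' z\<bar> \<le> J" for z
  proof -
    have "\<bar>p' z\<bar> \<le> \<bar>\<integral>u. sin (u * z) * (u * \<psi> u) \<partial>lborel\<bar>"
      using pi2[of "\<integral>u. - (sin (u * z) * (u * \<psi> u)) \<partial>lborel"] by (simp add: p'_def)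
    then have 1: "(1 + z\<^sup>2) * \<bar>p' z\<bar> \<le> \<bar>\<integral>u. sin (u * z) * (u * \<psi> u) \<partial>lborel\<bar> + \<bar>z\<^sup>2 * (\<integral>u. sin (u * z) * (u * \<psi> u) \<partial>lborel)\<bar>"
      by (simp add: abs_mult distrib_right add_mono mult_left_mono)
    have 2: "\<bar>\<integral>u. sin (u * z) * (u * \<psi> u) \<partial>lborel\<bar> \<le> (\<integral>u. \<bar>u\<bar> * \<psi> u \<partial>lborel)"
      by (rule integral_abs_bound_integral[OF parts(1) u\<psi>i]) (use \<psi>0 in \<open>auto simp: abs_mult intro!: mult_left_le_one_le\<close>)
    have i3: "integrable lborel (\<lambda>u. sin (u * z) * k2 u)"
    proof (rule Bochner_Integration.integrable_bound[OF parts(2)])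
      show "AE u in lborel. norm (sin (u * z) * k2 u) \<le> norm (k2 u)"
        by (intro AE_I2) (auto simp: abs_mult intro!: mult_left_le_one_le)
    qed (use parts(2) in auto)
    have 3: "\<bar>\<integral>u. sin (u * z) * k2 u \<partial>lborel\<bar> \<le> (\<integral>u. \<bar>k2 u\<bar> \<partial>lborel)"
      by (rule integral_abs_bound_integral[OF i3]) (use parts(2) in \<open>auto simp: abs_mult intro!: mult_left_le_one_le\<close>)
    show ?thesis using 1 2 3 parts(3)[of z] by (simp add: J_def)
  qed
  have J0: "0 \<le> J" unfolding J_def using \<psi>0 by (intro add_nonneg_nonneg) auto
  define C where "C = I + J + 1"
  have I0: "0 \<le> I" unfolding I_def using \<psi>0 by simp
  show ?thesis
  proof (rule that[of C p p'])
    show "0 < C" using I0 J0 by (simp add: C_def)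
    show "p z \<le> C" for z using pb[of z] J0 by (simp add: C_def)
    show "\<bar>p' z\<bar> \<le> C * (1 / (1 + z\<^sup>2))" for z
      using p'b[of z] I0 by (simp add: C_def pos_le_divide_eq add_pos_nonneg mult.commute)
    show "p' \<in> borel_measurable borel"
    proof -
      have "(\<lambda>n. (p (z + 1 / real (Suc n)) - p z) / (1 / real (Suc n))) \<longlonglongrightarrow> p' z" for z
      proof -
        have "((\<lambda>h. (p (z + h) - p z) / h) \<longlongrightarrow> p' z) (at 0)" using dp[of z] by (simp add: DERIV_def)
        moreover have "filterlim (\<lambda>n. 1 / real (Suc n)) (at 0) sequentially"
          using LIMSEQ_inverse_real_of_nat by (auto simp: filterlim_at inverse_eq_divide intro!: always_eventually)
        ultimately show ?thesis by (rule filterlim_compose)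
      qed
      then show ?thesis by (rule borel_measurable_LIMSEQ_real) measurable
    qed
  qed (use dp p0 Meq in auto)
qed

section \<open>Averages against a scaled density\<close>

locale smooth_density =
  fixes p p' :: "real \<Rightarrow> real" and C :: real
  assumes C_pos: "0 < C"
    and deriv_p: "\<And>z. (p has_real_derivative p' z) (at z)"
    and p_nonneg: "\<And>z. 0 \<le> p z" and p_le: "\<And>z. p z \<le> C"
    and p'_le: "\<And>z. \<bar>p' z\<bar> \<le> C * (1 / (1 + z\<^sup>2))"
    and p'_measurable[measurable]: "p' \<in> borel_measurable borel"
    and prob_p: "prob_space (density lborel p)"
begin

lemma p_measurable[measurable]: "p \<in> borel_measurable borel"
  using deriv_p by (intro borel_measurable_continuous_onI continuous_at_imp_continuous_on ballI DERIV_isCont) auto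

lemma p_integrable: "integrable lborel p" and integral_p: "(\<integral>z. p z \<partial>lborel) = 1"
proof -
  interpret prob_space "density lborel p" by (rule prob_p)
  have "(\<integral>\<^sup>+z. ennreal (p z) \<partial>lborel) = ennreal 1"
    using emeasure_space_1 by (simp add: emeasure_density)
  then have "has_bochner_integral lborel p 1"
    by (intro has_bochner_integral_nn_integral) (auto simp: p_nonneg)
  then show "integrable lborel p" "(\<integral>z. p z \<partial>lborel) = 1"
    by (auto simp: has_bochner_integral_iff)
qed

text \<open>The summands bound the \<open>L\<^sup>1\<close> norm of the difference quotients
  \<open>\<kappa> _ e\<close> for \<open>\<bar>e\<bar> \<le> 1\<close>, the same norm for
  \<open>\<bar>e\<bar> > 1\<close>, and the density itself.\<close>
definition K :: real where
  "K = (\<integral>z. 3 * C * (1 / (1 + z\<^sup>2)) \<partial>lborel) + 2 + C"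

lemma K_ge: "2 \<le> K" "C \<le> K" "0 < K"
  using C_pos by (auto simp: K_def intro!: add_pos_nonneg add_nonneg_pos add_nonneg_nonneg integral_nonneg_AE AE_I2)

text \<open>The difference quotient of the density, with its sign reversed. Keeping the step
  \<open>e\<close> as an argument allows exact increments, instead of first-order expansions,
  in the estimates along time grids.\<close>
definition \<kappa> :: "real \<Rightarrow> real \<Rightarrow> real" where
  "\<kappa> z e = (if e = 0 then - p' z else (p z - p (z + e)) / e)"

lemma \<kappa>_measurable[measurable]: "(\<lambda>(z, e). \<kappa> z e) \<in> borel_measurable (borel \<Otimes>\<^sub>M borel)"
  unfolding \<kappa>_def by measurable

lemma \<kappa>_le_C: "\<bar>\<kappa> z e\<bar> \<le> C"
proof (cases "e = 0")
  case True
  have "C * (1 / (1 + z\<^sup>2)) \<le> C * 1" using C_pos by (intro mult_left_mono) (auto simp: divide_simps add_pos_nonneg)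
  then show ?thesis using p'_le[of z] True by (simp add: \<kappa>_def)
next
  case False
  have *: "\<bar>p' w\<bar> \<le> C" for w
  proof -
    have "C * (1 / (1 + w\<^sup>2)) \<le> C * 1" using C_pos by (intro mult_left_mono) (auto simp: divide_simps add_pos_nonneg)
    then show ?thesis using p'_le[of w] by simp
  qed
  have "norm (p z - p (z + e)) \<le> C * norm (z - (z + e))"
    by (rule field_differentiable_bound[of UNIV p p']) (use deriv_p * in auto)
  then show ?thesis using False by (simp add: \<kappa>_def divide_simps abs_minus_commute)
qed

lemma \<kappa>_bound: "\<bar>e\<bar> \<le> 1 \<Longrightarrow> \<bar>\<kappa> z e\<bar> \<le> 3 * C * (1 / (1 + z\<^sup>2))"
proof (cases "e = 0")
  case True
  have "0 \<le> C * (1 / (1 + z\<^sup>2))" using C_pos by simp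
  then show ?thesis using p'_le[of z] True by (simp add: \<kappa>_def)
next
  case False
  assume e: "\<bar>e\<bar> \<le> 1"
  have *: "\<bar>p' w\<bar> \<le> 3 * C * (1 / (1 + z\<^sup>2))" if w: "w \<in> closed_segment z (z + e)" for w
  proof -
    have "\<bar>z - w\<bar> \<le> 1" using w e by (auto simp: closed_segment_eq_real_ivl split: if_splits)
    then have sq: "(z - w)\<^sup>2 \<le> 1" by (simp add: abs_square_le_1)
    have "z\<^sup>2 \<le> 2 * w\<^sup>2 + 2 * (z - w)\<^sup>2"
      using sum_squares_bound[of "w" "z - w"] by (simp add: power2_eq_square algebra_simps)
    then have "1 + z\<^sup>2 \<le> 3 * (1 + w\<^sup>2)" using sq zero_le_power2[of w] unfolding distrib_left by linarith
    then have "C * (1 / (1 + w\<^sup>2)) \<le> C * (3 / (1 + z\<^sup>2))"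
      using C_pos by (intro mult_left_mono) (auto simp: divide_simps add_pos_nonneg)
    then show ?thesis using p'_le[of w] by (simp add: mult.commute)
  qed
  have "norm (p z - p (z + e)) \<le> 3 * C * (1 / (1 + z\<^sup>2)) * norm (z - (z + e))"
    by (rule field_differentiable_bound[of "closed_segment z (z + e)" p p'])
       (use deriv_p * in \<open>auto intro: has_field_derivative_at_within\<close>)
  then show ?thesis using False by (simp add: \<kappa>_def abs_divide pos_divide_le_eq)
qed

lemma \<kappa>_integrable: "integrable lborel (\<lambda>z. \<kappa> z e)" and integral_\<kappa>: "(\<integral>z. \<bar>\<kappa> z e\<bar> \<partial>lborel) \<le> K"
proof -
  have dom: "integrable lborel (\<lambda>z::real. 3 * C * (1 / (1 + z\<^sup>2)))"
    using integrable_inverse_1_plus_square_lborel by (rule integrable_mult_right)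
  have ps: "integrable lborel (\<lambda>z. p (z + e))" "(\<integral>z. p (z + e) \<partial>lborel) = 1"
    using p_integrable integral_p lborel_integrable_real_affine[of p 1 e] lborel_integral_real_affine[of 1 p e]
    by (auto simp: add.commute)
  consider "\<bar>e\<bar> \<le> 1" | "1 < \<bar>e\<bar>" by linarith
  then have "integrable lborel (\<lambda>z. \<kappa> z e) \<and> (\<integral>z. \<bar>\<kappa> z e\<bar> \<partial>lborel) \<le> K"
  proof cases
    case 1
    have i: "integrable lborel (\<lambda>z. \<kappa> z e)"
      by (rule integrable_dominated[OF dom]) (use \<kappa>_bound[OF 1] in auto)
    have "(\<integral>z. \<bar>\<kappa> z e\<bar> \<partial>lborel) \<le> (\<integral>z. 3 * C * (1 / (1 + z\<^sup>2)) \<partial>lborel)"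
      by (rule integral_mono) (use i dom \<kappa>_bound[OF 1] in auto)
    then show ?thesis using i C_pos by (simp add: K_def)
  next
    case 2
    then have e0: "e \<noteq> 0" by auto
    have i: "integrable lborel (\<lambda>z. \<kappa> z e)" using e0 ps(1) p_integrable by (simp add: \<kappa>_def)
    have "(\<integral>z. \<bar>\<kappa> z e\<bar> \<partial>lborel) \<le> (\<integral>z. p z + p (z + e) \<partial>lborel)"
    proof (rule integral_mono)
      fix z
      have "\<bar>p z - p (z + e)\<bar> \<le> p z + p (z + e)" using p_nonneg[of z] p_nonneg[of "z + e"] by linarith
      also have "\<dots> * 1 \<le> \<dots> * \<bar>e\<bar>" using 2 p_nonneg by (intro mult_left_mono) auto
      finally show "\<bar>\<kappa> z e\<bar> \<le> p z + p (z + e)" using e0 by (simp add: \<kappa>_def abs_divide divide_simps)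
    qed (use i p_integrable ps in auto)
    also have "\<dots> = 2" using p_integrable ps integral_p by simp
    finally show ?thesis using i K_ge by simp
  qed
  then show "integrable lborel (\<lambda>z. \<kappa> z e)" "(\<integral>z. \<bar>\<kappa> z e\<bar> \<partial>lborel) \<le> K" by auto
qed

definition scaled_mean :: "real \<Rightarrow> (real \<Rightarrow> real) \<Rightarrow> real \<Rightarrow> real" where
  "scaled_mean \<sigma> g y = (\<integral>z. g (y + \<sigma> * z) * p z \<partial>lborel)"

text \<open>The difference quotient of \<open>scaled_mean \<sigma> g\<close> between \<open>y -
  d\<close> and \<open>y\<close>, with the difference moved from \<open>g\<close> to the density, so
  that it makes sense for merely measurable \<open>g\<close>. At \<open>d = 0\<close> it is the
  derivative.\<close>
definition slope :: "real \<Rightarrow> (real \<Rightarrow> real) \<Rightarrow> real \<Rightarrow> real \<Rightarrow> real" where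
  "slope \<sigma> g y d = (1 / \<sigma>) * (\<integral>z. g (y + \<sigma> * z) * \<kappa> z (d / \<sigma>) \<partial>lborel)"

lemma scaled_mean_integrable:
  assumes [measurable]: "g \<in> borel_measurable borel" and g: "\<And>y. \<bar>g y\<bar> \<le> B"
  shows "integrable lborel (\<lambda>z. g (y + \<sigma> * z) * p z)"
proof (rule integrable_dominated[OF integrable_mult_right[OF p_integrable, of B]])
  show "\<bar>g (y + \<sigma> * z) * p z\<bar> \<le> B * p z" for z
    using g[of "y + \<sigma> * z"] p_nonneg[of z] by (simp add: abs_mult mult_right_mono)
qed measurable

lemma slope_integrable:
  assumes [measurable]: "g \<in> borel_measurable borel" and g: "\<And>y. \<bar>g y\<bar> \<le> 1"
  shows "integrable lborel (\<lambda>z. g (y + \<sigma> * z) * \<kappa> z e)"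
proof (rule integrable_dominated[OF integrable_abs[OF \<kappa>_integrable, of e]])
  show "\<bar>g (y + \<sigma> * z) * \<kappa> z e\<bar> \<le> \<bar>\<kappa> z e\<bar>" for z
    using g[of "y + \<sigma> * z"] by (simp add: abs_mult mult_left_le_one_le)
qed measurable

lemma scaled_mean_measurable[measurable]:
  assumes [measurable]: "g \<in> borel_measurable borel"
  shows "scaled_mean \<sigma> g \<in> borel_measurable borel"
  unfolding scaled_mean_def by measurable

lemma scaled_mean_abs_le:
  assumes [measurable]: "g \<in> borel_measurable borel" and g: "\<And>y. \<bar>g y\<bar> \<le> 1"
  shows "\<bar>scaled_mean \<sigma> g y\<bar> \<le> 1"
proof -
  have "\<bar>scaled_mean \<sigma> g y\<bar> \<le> (\<integral>z. p z \<partial>lborel)"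
    unfolding scaled_mean_def
  proof (rule integral_abs_bound_integral)
    show "\<bar>g (y + \<sigma> * z) * p z\<bar> \<le> p z" for z
      using g[of "y + \<sigma> * z"] p_nonneg[of z] by (simp add: abs_mult mult_left_le_one_le)
  qed (use scaled_mean_integrable[OF assms] p_integrable in auto)
  then show ?thesis by (simp add: integral_p)
qed

text \<open>The gain of regularity: a function bounded by \<open>1\<close> becomes Lipschitz with
  constant \<open>K / \<sigma>\<close>.\<close>
lemma slope_abs_le:
  assumes [measurable]: "g \<in> borel_measurable borel" and g: "\<And>y. \<bar>g y\<bar> \<le> 1" and "0 < \<sigma>"
  shows "\<bar>slope \<sigma> g y d\<bar> \<le> K / \<sigma>"
proof -
  have "\<bar>\<integral>z. g (y + \<sigma> * z) * \<kappa> z (d / \<sigma>) \<partial>lborel\<bar> \<le> (\<integral>z. \<bar>\<kappa> z (d / \<sigma>)\<bar> \<partial>lborel)"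
  proof (rule integral_abs_bound_integral)
    show "\<bar>g (y + \<sigma> * z) * \<kappa> z (d / \<sigma>)\<bar> \<le> \<bar>\<kappa> z (d / \<sigma>)\<bar>" for z
      using g[of "y + \<sigma> * z"] by (simp add: abs_mult mult_left_le_one_le)
  qed (use slope_integrable[OF assms(1,2)] \<kappa>_integrable in auto)
  also have "\<dots> \<le> K" by (rule integral_\<kappa>)
  finally show ?thesis using \<open>0 < \<sigma>\<close> by (simp add: slope_def abs_mult divide_simps)
qed

text \<open>A shift of \<open>y\<close> by \<open>d\<close> is a shift of the density by \<open>d /
  \<sigma>\<close>.\<close>
lemma scaled_mean_diff:
  assumes [measurable]: "g \<in> borel_measurable borel" and g: "\<And>y. \<bar>g y\<bar> \<le> 1" and \<sigma>: "0 < \<sigma>"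
  shows "scaled_mean \<sigma> g y - scaled_mean \<sigma> g (y - d) = d * slope \<sigma> g y d"
proof -
  have arg: "y - d + \<sigma> * (z + d / \<sigma>) = y + \<sigma> * z" "d / \<sigma> + 1 * z = z + d / \<sigma>" for z
    using \<sigma> by (auto simp: distrib_left)
  have "scaled_mean \<sigma> g (y - d) = (\<integral>z. g (y + \<sigma> * z) * p (z + d / \<sigma>) \<partial>lborel)"
    unfolding scaled_mean_def
    using lborel_integral_real_affine[of 1 "\<lambda>z. g (y - d + \<sigma> * z) * p z" "d / \<sigma>"] unfolding arg by simp
  moreover have "integrable lborel (\<lambda>z. g (y + \<sigma> * z) * p (z + d / \<sigma>))"
    using lborel_integrable_real_affine[OF scaled_mean_integrable[OF assms(1,2), of "y - d" \<sigma>], of 1 "d / \<sigma>"]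
    unfolding arg by simp
  moreover have \<kappa>_eq: "d * (1 / \<sigma>) * \<kappa> z (d / \<sigma>) = p z - p (z + d / \<sigma>)" for z
    using \<sigma> by (cases "d = 0") (auto simp: \<kappa>_def)
  have "d * slope \<sigma> g y d = (\<integral>z. g (y + \<sigma> * z) * (p z - p (z + d / \<sigma>)) \<partial>lborel)"
    unfolding slope_def mult.assoc[symmetric] integral_mult_right_zero[symmetric] \<kappa>_eq[symmetric]
    by (intro Bochner_Integration.integral_cong) (auto simp only: mult_ac)
  ultimately show ?thesis
    using scaled_mean_integrable[OF assms(1,2), of y \<sigma>] by (simp add: scaled_mean_def right_diff_distrib)
qed

lemma indicator_shift_integral:
  fixes U :: "real set"
  assumes U[measurable]: "U \<in> sets borel" and m: "emeasure lborel U = ennreal m" "0 \<le> m" and \<sigma>: "0 < \<sigma>"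
  shows "integrable lborel (\<lambda>z. indicator U (y + \<sigma> * z) :: real)"
    and "(\<integral>z. indicator U (y + \<sigma> * z) \<partial>lborel) = m / \<sigma>"
proof -
  have i: "integrable lborel (indicator U :: real \<Rightarrow> real)" using m by (simp add: integrable_indicator_iff)
  show "integrable lborel (\<lambda>z. indicator U (y + \<sigma> * z) :: real)"
    using lborel_integrable_real_affine[OF i, of \<sigma> y] \<sigma> by simp
  have "(\<integral>z. indicator U z \<partial>lborel) = \<sigma> * (\<integral>z. indicator U (y + \<sigma> * z) \<partial>lborel :: real)"
    using lborel_integral_real_affine[of \<sigma> "indicator U :: real \<Rightarrow> real" y] \<sigma> by simp
  moreover have "(\<integral>z. indicator U z \<partial>lborel) = m" using m by (simp add: measure_def)
  ultimately show "(\<integral>z. indicator U (y + \<sigma> * z) \<partial>lborel) = m / \<sigma>" using \<sigma> by (simp add: field_simps)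
qed

lemma min_one_le_powr: "min 1 x \<le> x powr \<theta>" if "0 \<le> x" "0 < \<theta>" "\<theta> \<le> 1" for x \<theta> :: real
proof (cases "x \<le> 1")
  case True
  then have "x powr 1 \<le> x powr \<theta>" using powr_mono'[of \<theta> 1 x] that by auto
  then show ?thesis using True that by simp
next
  case False
  then show ?thesis using that by (simp add: ge_one_powr_ge_zero)
qed

text \<open>For the indicator of a set of measure \<open>m\<close> the mean and
  \<open>\<sigma>\<close> times the slope have the trivial bound \<open>K\<close> and, as
  \<open>p\<close> and \<open>\<kappa>\<close> are bounded, the bound \<open>K * (m /
  \<sigma>)\<close>. Interpolating between the two with exponent \<open>\<theta>\<close> trades a
  small power of \<open>m\<close> for an equally small worsening of the singularity in
  \<open>\<sigma>\<close>.\<close>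
lemma scaled_mean_indicator_bounds:
  fixes U :: "real set"
  assumes U[measurable]: "U \<in> sets borel" and m: "emeasure lborel U = ennreal m" "0 \<le> m" and \<sigma>: "0 < \<sigma>"
    and \<theta>: "0 < \<theta>" "\<theta> \<le> 1"
  shows "scaled_mean \<sigma> (indicator U) y \<le> K * (m / \<sigma>) powr \<theta>"
    and "\<bar>scaled_mean \<sigma> (indicator U) y - scaled_mean \<sigma> (indicator U) (y - d)\<bar> \<le> \<bar>d\<bar> * (K * (m / \<sigma>) powr \<theta> / \<sigma>)"
proof -
  note ii = indicator_shift_integral[OF U m \<sigma>]
  have g: "\<bar>indicator U y :: real\<bar> \<le> 1" for y by (simp add: indicator_def)
  have min: "b \<le> K * (m / \<sigma>) powr \<theta>" if "b \<le> K" "b \<le> K * (m / \<sigma>)" for b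
  proof -
    have "b \<le> K * min 1 (m / \<sigma>)" using that by (simp add: min_def)
    also have "\<dots> \<le> K * (m / \<sigma>) powr \<theta>"
      using min_one_le_powr[of "m / \<sigma>" \<theta>] m \<sigma> \<theta> K_ge by (intro mult_left_mono) auto
    finally show ?thesis .
  qed
  show "scaled_mean \<sigma> (indicator U) y \<le> K * (m / \<sigma>) powr \<theta>"
  proof (rule min)
    show "scaled_mean \<sigma> (indicator U) y \<le> K" using scaled_mean_abs_le[of "indicator U" \<sigma> y] g K_ge by auto
    have "scaled_mean \<sigma> (indicator U) y \<le> (\<integral>z. C * indicator U (y + \<sigma> * z) \<partial>lborel)"
      unfolding scaled_mean_def
      by (rule integral_mono) (use scaled_mean_integrable[of "indicator U" 1] g ii(1) p_le in \<open>auto simp: indicator_def\<close>)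
    also have "\<dots> = C * (m / \<sigma>)" using ii(2) by simp
    also have "\<dots> \<le> K * (m / \<sigma>)" using K_ge m \<sigma> by (intro mult_right_mono) auto
    finally show "scaled_mean \<sigma> (indicator U) y \<le> K * (m / \<sigma>)" .
  qed
  have *: "\<sigma> * \<bar>slope \<sigma> (indicator U) y d\<bar> \<le> K * (m / \<sigma>) powr \<theta>"
  proof (rule min)
    show "\<sigma> * \<bar>slope \<sigma> (indicator U) y d\<bar> \<le> K"
      using slope_abs_le[of "indicator U" \<sigma> y d] g \<sigma> by (simp add: field_simps)
    have "\<sigma> * \<bar>slope \<sigma> (indicator U) y d\<bar> = \<bar>\<integral>z. indicator U (y + \<sigma> * z) * \<kappa> z (d / \<sigma>) \<partial>lborel\<bar>"
      unfolding slope_def using \<sigma> by (simp add: abs_mult)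
    also have "\<dots> \<le> (\<integral>z. C * indicator U (y + \<sigma> * z) \<partial>lborel)"
      by (rule integral_abs_bound_integral)
         (use slope_integrable[of "indicator U"] g ii(1) \<kappa>_le_C in \<open>auto simp: indicator_def\<close>)
    also have "\<dots> = C * (m / \<sigma>)" using ii(2) by simp
    also have "\<dots> \<le> K * (m / \<sigma>)" using K_ge m \<sigma> by (intro mult_right_mono) auto
    finally show "\<sigma> * \<bar>slope \<sigma> (indicator U) y d\<bar> \<le> K * (m / \<sigma>)" .
  qed
  then have "\<bar>slope \<sigma> (indicator U) y d\<bar> \<le> K * (m / \<sigma>) powr \<theta> / \<sigma>" using \<sigma> by (simp add: field_simps)
  then show "\<bar>scaled_mean \<sigma> (indicator U) y - scaled_mean \<sigma> (indicator U) (y - d)\<bar> \<le> \<bar>d\<bar> * (K * (m / \<sigma>) powr \<theta> / \<sigma>)"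
    using scaled_mean_diff[of "indicator U" \<sigma> y d] g \<sigma> mult_left_mono[of _ _ "\<bar>d\<bar>"] by (simp only: abs_mult abs_ge_zero borel_measurable_indicator U)
qed

lemma slope_tendsto:
  assumes g: "continuous_on UNIV g" "\<And>y. \<bar>g y\<bar> \<le> 1" and \<sigma>: "0 < \<sigma>"
    and lim: "\<sigma>n \<longlonglongrightarrow> \<sigma>" "yn \<longlonglongrightarrow> y" "dn \<longlonglongrightarrow> 0"
  shows "(\<lambda>n. slope (\<sigma>n n) g (yn n) (dn n)) \<longlonglongrightarrow> slope \<sigma> g y 0"
proof -
  have [measurable]: "g \<in> borel_measurable borel" using g(1) by (rule borel_measurable_continuous_onI)
  have gc: "isCont g x" for x using g(1) by (simp add: continuous_on_eq_continuous_at)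
  have e: "(\<lambda>n. dn n / \<sigma>n n) \<longlonglongrightarrow> 0" using tendsto_divide[OF lim(3,1)] \<sigma> by simp
  have \<kappa>c: "(\<lambda>n. \<kappa> z (dn n / \<sigma>n n)) \<longlonglongrightarrow> \<kappa> z 0" for z
  proof -
    have "((\<lambda>h. (p (z + h) - p z) / h) \<longlongrightarrow> p' z) (at 0)" using deriv_p[of z] by (simp add: DERIV_def)
    then have lim: "((\<lambda>h. - ((p (z + h) - p z) / h)) \<longlongrightarrow> - p' z) (at 0)" by (rule tendsto_minus)
    have \<kappa>0: "\<kappa> z 0 = - p' z" by (simp add: \<kappa>_def)
    have "((\<kappa> z) \<longlongrightarrow> \<kappa> z 0) (at 0)"
      unfolding \<kappa>0 using lim by (rule Lim_transform_within[of _ _ _ _ 1]) (auto simp: \<kappa>_def divide_simps)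
    then have "isCont (\<kappa> z) 0" by (simp add: isCont_def)
    from isCont_tendsto_compose[OF this e] show ?thesis .
  qed
  have ev: "\<forall>\<^sub>F n in sequentially. \<bar>dn n / \<sigma>n n\<bar> < 1"
    using tendsto_rabs[OF e] by (auto dest: order_tendstoD(2)[where a=1])
  have "(\<lambda>n. \<integral>z. g (yn n + \<sigma>n n * z) * \<kappa> z (dn n / \<sigma>n n) \<partial>lborel) \<longlonglongrightarrow> (\<integral>z. g (y + \<sigma> * z) * \<kappa> z 0 \<partial>lborel)"
  proof -
    obtain N where N: "\<And>n. n \<ge> N \<Longrightarrow> \<bar>dn n / \<sigma>n n\<bar> < 1" using ev unfolding eventually_sequentially by blast
    have "(\<lambda>n. \<integral>z. g (yn (n + N) + \<sigma>n (n + N) * z) * \<kappa> z (dn (n + N) / \<sigma>n (n + N)) \<partial>lborel) \<longlonglongrightarrow> (\<integral>z. g (y + \<sigma> * z) * \<kappa> z 0 \<partial>lborel)"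
    proof (rule integral_dominated_convergence[where w="\<lambda>z. 3 * C * (1 / (1 + z\<^sup>2))"])
      show "integrable lborel (\<lambda>z. 3 * C * (1 / (1 + z\<^sup>2)))"
        using integrable_inverse_1_plus_square_lborel by (rule integrable_mult_right)
      show "AE z in lborel. (\<lambda>n. g (yn (n + N) + \<sigma>n (n + N) * z) * \<kappa> z (dn (n + N) / \<sigma>n (n + N))) \<longlonglongrightarrow> g (y + \<sigma> * z) * \<kappa> z 0"
      proof (rule AE_I2)
        fix z
        have "(\<lambda>n. g (yn n + \<sigma>n n * z) * \<kappa> z (dn n / \<sigma>n n)) \<longlonglongrightarrow> g (y + \<sigma> * z) * \<kappa> z 0"
          by (intro tendsto_mult \<kappa>c isCont_tendsto_compose[OF gc] tendsto_add lim tendsto_const)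
        then show "(\<lambda>n. g (yn (n + N) + \<sigma>n (n + N) * z) * \<kappa> z (dn (n + N) / \<sigma>n (n + N))) \<longlonglongrightarrow> g (y + \<sigma> * z) * \<kappa> z 0"
          by (rule LIMSEQ_ignore_initial_segment)
      qed
      show "AE z in lborel. norm (g (yn (n + N) + \<sigma>n (n + N) * z) * \<kappa> z (dn (n + N) / \<sigma>n (n + N))) \<le> 3 * C * (1 / (1 + z\<^sup>2))" for n
      proof (rule AE_I2)
        fix z
        let ?e = "dn (n + N) / \<sigma>n (n + N)"
        have "\<bar>g (yn (n + N) + \<sigma>n (n + N) * z)\<bar> * \<bar>\<kappa> z ?e\<bar> \<le> 1 * \<bar>\<kappa> z ?e\<bar>" using g(2) by (intro mult_right_mono) auto
        also have "\<dots> \<le> 3 * C * (1 / (1 + z\<^sup>2))" using \<kappa>_bound[of ?e z] N[of "n + N"] by simp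
        finally show "norm (g (yn (n + N) + \<sigma>n (n + N) * z) * \<kappa> z ?e) \<le> 3 * C * (1 / (1 + z\<^sup>2))"
          by (simp add: abs_mult)
      qed
    qed measurable
    then show ?thesis by (rule LIMSEQ_offset)
  qed
  then show ?thesis unfolding slope_def using \<sigma> lim by (auto intro!: tendsto_intros)
qed

lemma scaled_mean_tendsto_small:
  assumes g: "continuous_on UNIV g" "\<And>y. \<bar>g y\<bar> \<le> 1" and lim: "\<sigma>n \<longlonglongrightarrow> 0"
  shows "(\<lambda>n. scaled_mean (\<sigma>n n) g y) \<longlonglongrightarrow> g y"
proof -
  have [measurable]: "g \<in> borel_measurable borel" using g(1) by (rule borel_measurable_continuous_onI)
  have gc: "isCont g x" for x using g(1) by (simp add: continuous_on_eq_continuous_at)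
  have "(\<lambda>n. \<integral>z. g (y + \<sigma>n n * z) * p z \<partial>lborel) \<longlonglongrightarrow> (\<integral>z. g (y + 0 * z) * p z \<partial>lborel)"
  proof (rule integral_dominated_convergence[where w=p])
    show "AE z in lborel. (\<lambda>n. g (y + \<sigma>n n * z) * p z) \<longlonglongrightarrow> g (y + 0 * z) * p z"
      by (intro AE_I2 tendsto_mult isCont_tendsto_compose[OF gc] tendsto_add lim tendsto_const)
    show "AE z in lborel. norm (g (y + \<sigma>n n * z) * p z) \<le> p z" for n
      using g(2) p_nonneg by (intro AE_I2) (auto simp: abs_mult intro!: mult_left_le_one_le)
  qed (use p_integrable in auto)
  then show ?thesis by (simp add: scaled_mean_def integral_p)
qed

end

section \<open>The noise and its semigroup\<close>

text \<open>The properties of a stable process on which the argument relies: independence of the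
  past, self-similar increments with a smooth density, and right-continuous paths.\<close>
locale stable_noise = filtered_prob_space M F + smooth_density p p' C
  for M :: "'w measure" and F and p p' :: "real \<Rightarrow> real" and C :: real +
  fixes Z :: "real \<Rightarrow> 'w \<Rightarrow> real" and \<alpha> :: real
  assumes \<alpha>: "1 < \<alpha>" "\<alpha> < 2"
    and adapted_Z: "0 \<le> t \<Longrightarrow> Z t \<in> borel_measurable (F t)"
    and indep_Z: "0 \<le> t \<Longrightarrow> 0 \<le> s \<Longrightarrow> indep_set (sets (F t))
        (sets (vimage_algebra (space M) (\<lambda>\<omega>. Z (t + s) \<omega> - Z t \<omega>) borel))"
    and law_Z: "0 \<le> t \<Longrightarrow> 0 < s \<Longrightarrow> distr M borel (\<lambda>\<omega>. Z (t + s) \<omega> - Z t \<omega>) =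
        distr (density lborel p) borel (\<lambda>z. s powr (1 / \<alpha>) * z)"
    and Z_0: "AE \<omega> in M. Z 0 \<omega> = 0"
    and Z_right: "AE \<omega> in M. \<forall>t\<ge>0. continuous (at_right t) (\<lambda>t. Z t \<omega>)"
begin

lemma space_F: "0 \<le> t \<Longrightarrow> space (F t) = space M"
  using subalgebra_F by (auto simp: subalgebra_def)

lemma F_mono_measurable: "f \<in> borel_measurable (F s) \<Longrightarrow> 0 \<le> s \<Longrightarrow> s \<le> t \<Longrightarrow> f \<in> borel_measurable (F t)"
  using sets_F_mono[of s t] space_F[of s] space_F[of t]
  by (auto simp: measurable_def)

lemma F_M_measurable: "f \<in> borel_measurable (F t) \<Longrightarrow> 0 \<le> t \<Longrightarrow> f \<in> borel_measurable M"
  using subalgebra_F measurable_from_subalg by blast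

lemma Z_measurable[measurable]: "0 \<le> t \<Longrightarrow> Z t \<in> borel_measurable M"
  using adapted_Z F_M_measurable by blast

definition scale :: "real \<Rightarrow> real" where "scale r = r powr (1 / \<alpha>)"

lemma scale_pos: "0 < r \<Longrightarrow> 0 < scale r" by (simp add: scale_def)

text \<open>The transition semigroup of the noise: \<open>P r g y\<close> is the mean of \<open>g (y
  + Z r)\<close>.\<close>
definition P :: "real \<Rightarrow> (real \<Rightarrow> real) \<Rightarrow> real \<Rightarrow> real" where "P r = scaled_mean (scale r)"

lemma P_measurable[measurable]: "g \<in> borel_measurable borel \<Longrightarrow> P r g \<in> borel_measurable borel"
  unfolding P_def by measurable

lemma P_abs_le: "g \<in> borel_measurable borel \<Longrightarrow> (\<And>y. \<bar>g y\<bar> \<le> 1) \<Longrightarrow> \<bar>P r g y\<bar> \<le> 1"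
  unfolding P_def by (rule scaled_mean_abs_le)

lemma integrable_bounded:
  "f \<in> borel_measurable M \<Longrightarrow> (\<And>\<omega>. \<bar>f \<omega>\<bar> \<le> B) \<Longrightarrow> integrable M (f :: 'w \<Rightarrow> real)"
  by (rule integrable_const_bound[where B=B]) auto

lemma expectation_increment:
  assumes t: "0 \<le> t" and s: "0 < s" and X: "X \<in> borel_measurable (F t)"
    and g[measurable]: "g \<in> borel_measurable borel" and gb: "\<And>y. \<bar>g y\<bar> \<le> 1"
  shows "expectation (\<lambda>\<omega>. g (X \<omega> + (Z (t + s) \<omega> - Z t \<omega>))) = expectation (\<lambda>\<omega>. P s g (X \<omega>))"
proof -
  let ?D = "\<lambda>\<omega>. Z (t + s) \<omega> - Z t \<omega>"
  have Xm[measurable]: "X \<in> borel_measurable M" using X t F_M_measurable by blast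
  have "Z (t + s) \<in> borel_measurable M" "Z t \<in> borel_measurable M" using t s by auto
  then have Dm[measurable]: "?D \<in> borel_measurable M" by measurable
  have ind: "indep_var borel X borel ?D"
    unfolding indep_var_eq
  proof (intro conjI)
    have "indep_set (sets (F t)) (sets (vimage_algebra (space M) ?D borel))" using indep_Z t s by simp
    moreover have "sigma_sets (space M) {X -` A \<inter> space M |A. A \<in> sets borel} \<subseteq> sets (F t)"
    proof -
      have "{X -` A \<inter> space M |A. A \<in> sets borel} \<subseteq> sets (F t)"
        using measurable_sets[OF X] space_F[OF t] by auto
      then show ?thesis using sets.sigma_sets_subset[of _ "F t"] space_F[OF t] by simp
    qed
    moreover have "sigma_sets (space M) {?D -` A \<inter> space M |A. A \<in> sets borel} \<subseteq> sets (vimage_algebra (space M) ?D borel)"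
      by (simp add: sets_vimage_algebra)
    ultimately show "indep_set (sigma_sets (space M) {X -` A \<inter> space M |A. A \<in> sets borel})
       (sigma_sets (space M) {?D -` A \<inter> space M |A. A \<in> sets borel})"
      unfolding indep_sets2_eq by blast
  qed measurable
  then have eq: "distr M borel X \<Otimes>\<^sub>M distr M borel ?D = distr M (borel \<Otimes>\<^sub>M borel) (\<lambda>\<omega>. (X \<omega>, ?D \<omega>))"
    by (simp add: indep_var_distribution_eq)
  \<comment> \<open>Independence makes the joint law of \<open>X\<close> and the increment a
    product, so the mean can be computed by Fubini.\<close>
  interpret X: prob_space "distr M borel X" by (rule prob_space_distr) simp
  interpret D: prob_space "distr M borel ?D" by (rule prob_space_distr) simp
  interpret XD: pair_prob_space "distr M borel X" "distr M borel ?D" ..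
  have inner: "(\<integral>d. g (x + d) \<partial>distr M borel ?D) = P s g x" for x
  proof -
    have "(\<integral>d. g (x + d) \<partial>distr M borel ?D) = (\<integral>z. g (x + scale s * z) \<partial>density lborel p)"
      unfolding law_Z[OF t s] scale_def by (subst integral_distr) auto
    also have "\<dots> = (\<integral>z. p z * g (x + scale s * z) \<partial>lborel)"
      by (subst integral_density) (auto simp: p_nonneg)
    finally show ?thesis by (simp add: P_def scaled_mean_def mult.commute)
  qed
  have "expectation (\<lambda>\<omega>. g (X \<omega> + ?D \<omega>)) =
      (\<integral>y. g (fst y + snd y) \<partial>distr M (borel \<Otimes>\<^sub>M borel) (\<lambda>\<omega>. (X \<omega>, ?D \<omega>)))"
    by (subst integral_distr) auto
  also have "\<dots> = (\<integral>y. g (fst y + snd y) \<partial>(distr M borel X \<Otimes>\<^sub>M distr M borel ?D))" unfolding eq ..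
  also have "\<dots> = (\<integral>x. (\<integral>d. g (x + d) \<partial>distr M borel ?D) \<partial>distr M borel X)"
  proof -
    have "integrable (distr M borel X \<Otimes>\<^sub>M distr M borel ?D) (\<lambda>(x, d). g (x + d))"
      by (rule XD.integrable_const_bound[where B=1]) (use gb in auto)
    from XD.integral_fst'[OF this] show ?thesis by (simp add: case_prod_beta')
  qed
  also have "\<dots> = (\<integral>x. P s g x \<partial>distr M borel X)" by (simp only: inner)
  also have "\<dots> = expectation (\<lambda>\<omega>. P s g (X \<omega>))" by (subst integral_distr) auto
  finally show ?thesis .
qed

text \<open>The semigroup property follows from the independence of consecutive increments, by
  computing the mean of \<open>g (y + Z (r + h))\<close> in one step and in two.\<close>
lemma P_semigroup:
  assumes r: "0 < r" and h: "0 < h" and g[measurable]: "g \<in> borel_measurable borel" and gb: "\<And>y. \<bar>g y\<bar> \<le> 1"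
  shows "P (r + h) g y = P h (P r g) y"
proof -
  have Zh: "(\<lambda>\<omega>. y + (Z (0 + h) \<omega> - Z 0 \<omega>)) \<in> borel_measurable (F h)"
    using adapted_Z[of h] F_mono_measurable[OF adapted_Z[of 0], of h] h by auto
  have "P (r + h) g y = expectation (\<lambda>\<omega>. g (y + (Z (0 + (r + h)) \<omega> - Z 0 \<omega>)))"
    using expectation_increment[of 0 "r + h" "\<lambda>_. y" g] r h gb by (simp add: prob_space)
  also have "\<dots> = expectation (\<lambda>\<omega>. g ((y + (Z (0 + h) \<omega> - Z 0 \<omega>)) + (Z (h + r) \<omega> - Z h \<omega>)))"
    by (simp add: algebra_simps)
  also have "\<dots> = expectation (\<lambda>\<omega>. P r g (y + (Z (0 + h) \<omega> - Z 0 \<omega>)))"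
    using expectation_increment[OF _ r Zh, of g] h gb by simp
  also have "\<dots> = P h (P r g) y"
    using expectation_increment[of 0 h "\<lambda>_. y" "P r g"] h P_abs_le[OF g gb] by (simp add: prob_space)
  finally show ?thesis .
qed

lemma expectation_P_increment:
  assumes "0 \<le> t" "0 < h" "X \<in> borel_measurable (F t)" "0 < r"
    and g: "g \<in> borel_measurable borel" and gb: "\<And>y. \<bar>g y\<bar> \<le> 1"
  shows "expectation (\<lambda>\<omega>. P r g (X \<omega> + (Z (t + h) \<omega> - Z t \<omega>))) = expectation (\<lambda>\<omega>. P (r + h) g (X \<omega>))"
  using expectation_increment[OF assms(1-3) P_measurable[OF g] P_abs_le[OF g gb]] P_semigroup[OF assms(4,2) g gb]
  by simp

text \<open>A discrete Duhamel formula for a process \<open>\<zeta>\<close> that moves by the noise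
  increment plus a displacement \<open>d i\<close> in step \<open>i\<close>. Without the
  displacement, a step is undone exactly by letting the semigroup run for \<open>h\<close> longer;
  each displacement costs one difference of a smoothed function.\<close>
lemma grid_telescope:
  fixes \<zeta> :: "nat \<Rightarrow> 'w \<Rightarrow> real"
  assumes h: "0 < h" and \<zeta>: "\<And>i. \<zeta> i \<in> borel_measurable (F (real i * h))"
    and g[measurable]: "g \<in> borel_measurable borel" and gb: "\<And>y. \<bar>g y\<bar> \<le> 1"
  defines "d \<equiv> \<lambda>i \<omega>. \<zeta> (Suc i) \<omega> - \<zeta> i \<omega> - (Z (real (Suc i) * h) \<omega> - Z (real i * h) \<omega>)"
  assumes r: "0 < r"
  shows "expectation (\<lambda>\<omega>. P r g (\<zeta> k \<omega>)) = expectation (\<lambda>\<omega>. P (r + real k * h) g (\<zeta> 0 \<omega>)) +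
    (\<Sum>i<k. expectation (\<lambda>\<omega>. P (r + real (k - Suc i) * h) g (\<zeta> (Suc i) \<omega>)
        - P (r + real (k - Suc i) * h) g (\<zeta> (Suc i) \<omega> - d i \<omega>)))"
  using r
proof (induction k arbitrary: r)
  case 0
  then show ?case by simp
next
  case (Suc k)
  have \<zeta>m[measurable]: "\<zeta> i \<in> borel_measurable M" for i using F_M_measurable[OF \<zeta>] h by simp
  have Zm[measurable]: "Z (real i * h) \<in> borel_measurable M" for i using h by simp
  have dm[measurable]: "d i \<in> borel_measurable M" for i unfolding d_def by measurable
  have int: "integrable M (\<lambda>\<omega>. P r g (f \<omega>))" if "f \<in> borel_measurable M" for f r
    by (rule integrable_bounded[where B=1]) (use that P_abs_le[OF g gb] in auto)
  have "expectation (\<lambda>\<omega>. P r g (\<zeta> (Suc k) \<omega> - d k \<omega>)) =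
      expectation (\<lambda>\<omega>. P r g (\<zeta> k \<omega> + (Z (real k * h + h) \<omega> - Z (real k * h) \<omega>)))"
    by (simp add: d_def algebra_simps)
  also have "\<dots> = expectation (\<lambda>\<omega>. P (r + h) g (\<zeta> k \<omega>))"
    by (rule expectation_P_increment) (use h \<zeta> g gb Suc.prems in auto)
  finally have step: "expectation (\<lambda>\<omega>. P r g (\<zeta> (Suc k) \<omega> - d k \<omega>)) = expectation (\<lambda>\<omega>. P (r + h) g (\<zeta> k \<omega>))" .
  have IH: "expectation (\<lambda>\<omega>. P (r + h) g (\<zeta> k \<omega>)) = expectation (\<lambda>\<omega>. P ((r + h) + real k * h) g (\<zeta> 0 \<omega>)) +
    (\<Sum>i<k. expectation (\<lambda>\<omega>. P ((r + h) + real (k - Suc i) * h) g (\<zeta> (Suc i) \<omega>)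
        - P ((r + h) + real (k - Suc i) * h) g (\<zeta> (Suc i) \<omega> - d i \<omega>)))"
    by (rule Suc.IH) (use Suc.prems h in auto)
  have idx: "(r + h) + real (k - Suc i) * h = r + real (Suc k - Suc i) * h" if "i < k" for i
    using that by (simp add: of_nat_diff algebra_simps)
  have "expectation (\<lambda>\<omega>. P r g (\<zeta> (Suc k) \<omega>)) =
     expectation (\<lambda>\<omega>. P r g (\<zeta> (Suc k) \<omega>) - P r g (\<zeta> (Suc k) \<omega> - d k \<omega>)) + expectation (\<lambda>\<omega>. P (r + h) g (\<zeta> k \<omega>))"
    unfolding step[symmetric] by (subst Bochner_Integration.integral_diff) (auto intro!: int)
  also have "\<dots> = expectation (\<lambda>\<omega>. P (r + real (Suc k) * h) g (\<zeta> 0 \<omega>)) +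
    (\<Sum>i<Suc k. expectation (\<lambda>\<omega>. P (r + real (Suc k - Suc i) * h) g (\<zeta> (Suc i) \<omega>)
        - P (r + real (Suc k - Suc i) * h) g (\<zeta> (Suc i) \<omega> - d i \<omega>)))"
    unfolding IH sum.lessThan_Suc using idx by (simp add: algebra_simps)
  finally show ?case .
qed

section \<open>Occupation times\<close>

text \<open>With \<open>\<sigma> = r powr (1 / \<alpha>)\<close>, the interpolated bound on
  differences behaves like \<open>m powr \<theta> * r powr - \<gamma>\<close>. Any
  \<open>\<theta>\<close> between \<open>0\<close> and \<open>\<alpha> - 1\<close> gives
  \<open>\<gamma> < 1\<close>, which makes it integrable in time.\<close>
definition \<theta> :: real where "\<theta> = (\<alpha> - 1) / 2"
definition \<gamma> :: real where "\<gamma> = (1 + \<theta>) / \<alpha>"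

lemma \<theta>_bounds: "0 < \<theta>" "\<theta> \<le> 1" using \<alpha> by (auto simp: \<theta>_def)
lemma \<gamma>_bounds: "0 < \<gamma>" "\<gamma> < 1" using \<alpha> by (auto simp: \<theta>_def \<gamma>_def field_simps)

text \<open>The sum is a lower Riemann sum of the decreasing function \<open>s powr -
  \<gamma>\<close> on \<open>[0, N h]\<close>.\<close>
lemma powr_grid_sum:
  fixes h \<gamma> :: real
  assumes h: "0 < h" and g: "0 < \<gamma>" "\<gamma> < 1"
  shows "(\<Sum>k<N. h * (real (Suc k) * h) powr - \<gamma>) \<le> (real N * h) powr (1 - \<gamma>) / (1 - \<gamma>)"
proof (induction N)
  case 0
  then show ?case by simp
next
  case (Suc N)
  let ?a = "real N * h" and ?b = "real (Suc N) * h"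
  have ab: "0 \<le> ?a" "?a < ?b" using h by (auto simp: algebra_simps)
  have b0: "0 < ?b" by (intro mult_pos_pos) (use h in auto)
  have "\<exists>l \<xi>. ?a < \<xi> \<and> \<xi> < ?b \<and> ((\<lambda>x. x powr (1 - \<gamma>)) has_real_derivative l) (at \<xi>) \<and>
      ?b powr (1 - \<gamma>) - ?a powr (1 - \<gamma>) = (?b - ?a) * l"
  proof (rule MVT[OF ab(2)])
    show "continuous_on {?a..?b} (\<lambda>x. x powr (1 - \<gamma>))"
      using g ab by (intro continuous_on_powr') (auto intro!: continuous_intros)
    show "(\<lambda>x. x powr (1 - \<gamma>)) differentiable (at x)" if "?a < x" "x < ?b" for x
      using has_real_derivative_powr[of x "1 - \<gamma>"] that ab by (auto simp: real_differentiable_def)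
  qed
  then obtain l \<xi> where \<xi>: "?a < \<xi>" "\<xi> < ?b" "((\<lambda>x. x powr (1 - \<gamma>)) has_real_derivative l) (at \<xi>)"
      and e: "?b powr (1 - \<gamma>) - ?a powr (1 - \<gamma>) = (?b - ?a) * l" by blast
  have "l = (1 - \<gamma>) * \<xi> powr - \<gamma>"
    using DERIV_unique[OF \<xi>(3) has_real_derivative_powr[of \<xi> "1 - \<gamma>"]] \<xi> ab by simp
  then have e': "?b powr (1 - \<gamma>) - ?a powr (1 - \<gamma>) = ((1 - \<gamma>) * \<xi> powr - \<gamma>) * h"
  proof -
    have "?b - ?a = h" by (simp add: algebra_simps)
    then show ?thesis unfolding e by (simp add: \<open>l = _\<close>)
  qed
  have "?b powr - \<gamma> \<le> \<xi> powr - \<gamma>" using \<xi> ab b0 g by (intro powr_mono2') auto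
  then have "(1 - \<gamma>) * (h * ?b powr - \<gamma>) \<le> ?b powr (1 - \<gamma>) - ?a powr (1 - \<gamma>)"
    unfolding e' using g h by (simp add: mult.commute mult.left_commute)
  then have "h * ?b powr - \<gamma> \<le> ?b powr (1 - \<gamma>) / (1 - \<gamma>) - ?a powr (1 - \<gamma>) / (1 - \<gamma>)"
    using g unfolding diff_divide_distrib[symmetric] by (subst pos_le_divide_eq) (auto simp: mult.commute)
  then show ?case using Suc.IH by simp
qed

text \<open>The factor in the occupation estimate on \<open>[0, T]\<close>: the middle term is the
  integral of \<open>s powr - \<gamma>\<close> over \<open>[0, T]\<close>.\<close>
definition occ_const :: "real \<Rightarrow> real" where
  "occ_const T = K * (T powr (1 - \<gamma>) / (1 - \<gamma>)) * (1 + T powr (1 / \<alpha>))"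

lemma occ_const_nonneg: "0 \<le> occ_const T"
  unfolding occ_const_def using K_ge \<gamma>_bounds by (intro mult_nonneg_nonneg add_nonneg_nonneg divide_nonneg_nonneg) auto

lemma P_indicator_bounds:
  fixes U :: "real set"
  assumes U: "U \<in> sets borel" and m: "emeasure lborel U = ennreal m" "0 \<le> m" and r: "0 < r"
  shows "P r (indicator U) y \<le> K * m powr \<theta> * r powr (1 / \<alpha>) * r powr - \<gamma>"
    and "\<bar>P r (indicator U) y - P r (indicator U) (y - d)\<bar> \<le> \<bar>d\<bar> * (K * m powr \<theta> * r powr - \<gamma>)"
proof -
  have e: "(m / scale r) powr \<theta> = m powr \<theta> * r powr (- (\<theta> / \<alpha>))"
    using m r by (simp add: scale_def powr_divide powr_powr powr_minus_divide)
  have e1: "r powr (- (\<theta> / \<alpha>)) = r powr (1 / \<alpha>) * r powr - \<gamma>"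
    unfolding powr_add[symmetric] by (simp add: \<gamma>_def add_divide_distrib)
  have e2: "r powr (- (\<theta> / \<alpha>)) / scale r = r powr - \<gamma>"
  proof -
    have "- (\<theta> / \<alpha>) - 1 / \<alpha> = - \<gamma>" by (simp add: \<gamma>_def add_divide_distrib)
    then show ?thesis unfolding scale_def powr_diff[symmetric] by simp
  qed
  show "P r (indicator U) y \<le> K * m powr \<theta> * r powr (1 / \<alpha>) * r powr - \<gamma>"
    using scaled_mean_indicator_bounds(1)[OF U m scale_pos[OF r] \<theta>_bounds, of y] by (simp add: P_def e e1)
  show "\<bar>P r (indicator U) y - P r (indicator U) (y - d)\<bar> \<le> \<bar>d\<bar> * (K * m powr \<theta> * r powr - \<gamma>)"
    using scaled_mean_indicator_bounds(2)[OF U m scale_pos[OF r] \<theta>_bounds, of y d]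
    unfolding P_def e e2[symmetric] by simp
qed

text \<open>The occupation estimate on a grid. The quantity \<open>\<zeta> (Suc k) - d k\<close> is
  \<open>\<zeta> k\<close> plus a fresh noise increment, so its probability of lying in
  \<open>U\<close> is a mean of \<open>P h (indicator U)\<close>, to which
  \<open>grid_telescope\<close> applies. The displacement made in step \<open>i\<close> contributes
  to all later \<open>k\<close>, with weights whose sum over \<open>k\<close> is bounded uniformly
  in the mesh \<open>h\<close>.\<close>
lemma grid_occupation:
  fixes \<zeta> :: "nat \<Rightarrow> 'w \<Rightarrow> real" and U :: "real set"
  assumes h: "0 < h" and \<zeta>: "\<And>i. \<zeta> i \<in> borel_measurable (F (real i * h))"
    and U[measurable]: "U \<in> sets borel" and m: "emeasure lborel U = ennreal m" "0 \<le> m"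
  defines "d \<equiv> \<lambda>i \<omega>. \<zeta> (Suc i) \<omega> - \<zeta> i \<omega> - (Z (real (Suc i) * h) \<omega> - Z (real i * h) \<omega>)"
  assumes v: "\<And>\<omega>. \<omega> \<in> space M \<Longrightarrow> (\<Sum>i<N. \<bar>d i \<omega>\<bar>) \<le> v" "0 \<le> v"
  shows "(\<Sum>k<N. h * prob {\<omega>\<in>space M. \<zeta> (Suc k) \<omega> - d k \<omega> \<in> U}) \<le> occ_const (real N * h) * m powr \<theta> * (1 + v)"
proof -
  define T where "T = real N * h"
  define I where "I = (indicator U :: real \<Rightarrow> real)"
  define c where "c = K * m powr \<theta>"
  have c0: "0 \<le> c" using K_ge by (simp add: c_def)
  have I[measurable]: "I \<in> borel_measurable borel" and Ib: "\<bar>I y\<bar> \<le> 1" for y by (auto simp: I_def indicator_def)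
  have \<zeta>m[measurable]: "\<zeta> i \<in> borel_measurable M" for i using F_M_measurable[OF \<zeta>] h by simp
  have Zm[measurable]: "Z (real i * h) \<in> borel_measurable M" for i using h by simp
  have dm[measurable]: "d i \<in> borel_measurable M" for i unfolding d_def by measurable
  have dv: "\<bar>d i \<omega>\<bar> \<le> v" if "\<omega> \<in> space M" "i < N" for i \<omega>
    using member_le_sum[of i "{..<N}" "\<lambda>i. \<bar>d i \<omega>\<bar>"] v(1)[OF that(1)] that(2) by auto
  have di: "integrable M (\<lambda>\<omega>. \<bar>d i \<omega>\<bar>)" if "i < N" for i
    by (rule integrable_const_bound[where B=v]) (use dv that in \<open>auto intro!: AE_I2\<close>)
  define e where "e i = expectation (\<lambda>\<omega>. \<bar>d i \<omega>\<bar>)" for i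
  have e0: "0 \<le> e i" for i by (simp add: e_def)
  have esum: "(\<Sum>i<N. e i) \<le> v"
  proof -
    have "(\<Sum>i<N. e i) = expectation (\<lambda>\<omega>. \<Sum>i<N. \<bar>d i \<omega>\<bar>)"
      unfolding e_def using di by simp
    also have "\<dots> \<le> expectation (\<lambda>_. v)"
      by (rule integral_mono) (use di v in auto)
    finally show ?thesis by (simp add: prob_space)
  qed
  have Pint: "integrable M (\<lambda>\<omega>. P r I (f \<omega>))" if "f \<in> borel_measurable M" for f r
    by (rule integrable_bounded[where B=1]) (use that P_abs_le[OF I Ib] in auto)
  note Pb = P_indicator_bounds[OF U m, folded I_def c_def]
  have step: "h * prob {\<omega>\<in>space M. \<zeta> (Suc k) \<omega> - d k \<omega> \<in> U} \<le>
      c * (T powr (1 / \<alpha>) * (h * (real (Suc k) * h) powr - \<gamma>) + (\<Sum>i<k. h * (real (k - i) * h) powr - \<gamma> * e i))" if k: "k < N" for k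
  proof -
    have "prob {\<omega>\<in>space M. \<zeta> (Suc k) \<omega> - d k \<omega> \<in> U} = expectation (\<lambda>\<omega>. I (\<zeta> (Suc k) \<omega> - d k \<omega>))"
    proof -
      define A where "A = {\<omega>\<in>space M. \<zeta> (Suc k) \<omega> - d k \<omega> \<in> U}"
      have "expectation (\<lambda>\<omega>. I (\<zeta> (Suc k) \<omega> - d k \<omega>)) = expectation (indicator A)"
        by (rule Bochner_Integration.integral_cong) (auto simp: I_def A_def indicator_def)
      moreover have "A \<subseteq> space M" by (auto simp: A_def)
      ultimately show ?thesis unfolding A_def[symmetric] by (simp add: Int_absorb2)
    qed
    also have "\<dots> = expectation (\<lambda>\<omega>. I (\<zeta> k \<omega> + (Z (real k * h + h) \<omega> - Z (real k * h) \<omega>)))"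
      by (simp add: d_def algebra_simps)
    also have "\<dots> = expectation (\<lambda>\<omega>. P h I (\<zeta> k \<omega>))"
      by (rule expectation_increment) (use h \<zeta> Ib in auto)
    also have "\<dots> = expectation (\<lambda>\<omega>. P (h + real k * h) I (\<zeta> 0 \<omega>)) +
      (\<Sum>i<k. expectation (\<lambda>\<omega>. P (h + real (k - Suc i) * h) I (\<zeta> (Suc i) \<omega>)
        - P (h + real (k - Suc i) * h) I (\<zeta> (Suc i) \<omega> - d i \<omega>)))"
      unfolding d_def by (rule grid_telescope[OF h \<zeta> I Ib h])
    also have "\<dots> \<le> c * T powr (1 / \<alpha>) * (real (Suc k) * h) powr - \<gamma> + (\<Sum>i<k. c * (real (k - i) * h) powr - \<gamma> * e i)"
    proof (rule add_mono[OF _ sum_mono])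
      have "expectation (\<lambda>\<omega>. P (h + real k * h) I (\<zeta> 0 \<omega>)) \<le> expectation (\<lambda>_. c * T powr (1 / \<alpha>) * (real (Suc k) * h) powr - \<gamma>)"
      proof (rule integral_mono)
        fix \<omega>
        have "(real (Suc k) * h) powr (1 / \<alpha>) \<le> T powr (1 / \<alpha>)"
          using k h \<alpha> by (intro powr_mono2) (auto simp: T_def)
        then have *: "c * (real (Suc k) * h) powr (1 / \<alpha>) * (real (Suc k) * h) powr - \<gamma> \<le> c * T powr (1 / \<alpha>) * (real (Suc k) * h) powr - \<gamma>"
          using c0 by (intro mult_right_mono mult_left_mono) auto
        show "P (h + real k * h) I (\<zeta> 0 \<omega>) \<le> c * T powr (1 / \<alpha>) * (real (Suc k) * h) powr - \<gamma>"
        proof -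
          have "h + real k * h = real (Suc k) * h" by (simp add: algebra_simps)
          moreover have "0 < real (Suc k) * h" by (intro mult_pos_pos) (use h in auto)
          ultimately show ?thesis using order_trans[OF Pb(1) *] by simp
        qed
      qed (auto intro: Pint)
      then show "expectation (\<lambda>\<omega>. P (h + real k * h) I (\<zeta> 0 \<omega>)) \<le> c * T powr (1 / \<alpha>) * (real (Suc k) * h) powr - \<gamma>"
        by (simp add: prob_space)
    next
      fix i assume i: "i \<in> {..<k}"
      have rr: "h + real (k - Suc i) * h = real (k - i) * h" using i by (simp add: of_nat_diff algebra_simps)
      have "expectation (\<lambda>\<omega>. P (h + real (k - Suc i) * h) I (\<zeta> (Suc i) \<omega>) - P (h + real (k - Suc i) * h) I (\<zeta> (Suc i) \<omega> - d i \<omega>))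
         \<le> expectation (\<lambda>\<omega>. \<bar>d i \<omega>\<bar> * (c * (real (k - i) * h) powr - \<gamma>))"
        unfolding rr
      proof (rule integral_mono)
        show "P (real (k - i) * h) I (\<zeta> (Suc i) \<omega>) - P (real (k - i) * h) I (\<zeta> (Suc i) \<omega> - d i \<omega>) \<le> \<bar>d i \<omega>\<bar> * (c * (real (k - i) * h) powr - \<gamma>)" for \<omega>
          using Pb(2)[of "real (k - i) * h" "\<zeta> (Suc i) \<omega>" "d i \<omega>"] i h by auto
      qed (use i k di in \<open>auto intro!: Pint\<close>)
      then show "expectation (\<lambda>\<omega>. P (h + real (k - Suc i) * h) I (\<zeta> (Suc i) \<omega>) - P (h + real (k - Suc i) * h) I (\<zeta> (Suc i) \<omega> - d i \<omega>))
         \<le> c * (real (k - i) * h) powr - \<gamma> * e i"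
        by (simp add: e_def mult.commute)
    qed
    finally have "h * prob {\<omega>\<in>space M. \<zeta> (Suc k) \<omega> - d k \<omega> \<in> U} \<le>
      h * (c * T powr (1 / \<alpha>) * (real (Suc k) * h) powr - \<gamma> + (\<Sum>i<k. c * (real (k - i) * h) powr - \<gamma> * e i))"
      using h by (intro mult_left_mono) auto
    then show ?thesis by (simp only: distrib_left sum_distrib_left mult_ac)
  qed
  define S where "S = T powr (1 - \<gamma>) / (1 - \<gamma>)"
  have S0: "0 \<le> S" using \<gamma>_bounds by (simp add: S_def)
  have grid: "(\<Sum>k<n. h * (real (Suc k) * h) powr - \<gamma>) \<le> S" if "n \<le> N" for n
  proof -
    have "(\<Sum>k<n. h * (real (Suc k) * h) powr - \<gamma>) \<le> (real n * h) powr (1 - \<gamma>) / (1 - \<gamma>)"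
      by (rule powr_grid_sum[OF h \<gamma>_bounds])
    also have "\<dots> \<le> S" unfolding S_def T_def using that h \<gamma>_bounds
      by (intro divide_right_mono powr_mono2) auto
    finally show ?thesis .
  qed
  have "(\<Sum>k<N. h * prob {\<omega>\<in>space M. \<zeta> (Suc k) \<omega> - d k \<omega> \<in> U}) \<le>
    (\<Sum>k<N. c * (T powr (1 / \<alpha>) * (h * (real (Suc k) * h) powr - \<gamma>) + (\<Sum>i<k. h * (real (k - i) * h) powr - \<gamma> * e i)))"
    by (rule sum_mono) (use step in auto)
  also have "\<dots> = c * (T powr (1 / \<alpha>) * (\<Sum>k<N. h * (real (Suc k) * h) powr - \<gamma>) + (\<Sum>k<N. \<Sum>i<k. h * (real (k - i) * h) powr - \<gamma> * e i))"
    by (simp add: sum_distrib_left sum.distrib distrib_left)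
  also have "(\<Sum>k<N. \<Sum>i<k. h * (real (k - i) * h) powr - \<gamma> * e i) \<le> S * v"
  proof -
    have "(\<Sum>k<N. \<Sum>i<k. h * (real (k - i) * h) powr - \<gamma> * e i) = (\<Sum>i<N. \<Sum>k\<in>{Suc i..<N}. h * (real (k - i) * h) powr - \<gamma> * e i)"
      unfolding sum.Sigma[OF finite_lessThan ballI[OF finite_lessThan]] sum.Sigma[OF finite_lessThan ballI[OF finite_atLeastLessThan]]
      by (rule sum.reindex_bij_witness[where i="\<lambda>(i, k). (k, i)" and j="\<lambda>(k, i). (i, k)"]) auto
    also have "\<dots> = (\<Sum>i<N. e i * (\<Sum>k<N - Suc i. h * (real (Suc k) * h) powr - \<gamma>))"
    proof (rule sum.cong[OF refl])
      fix i assume "i \<in> {..<N}"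
      have "(\<Sum>k\<in>{Suc i..<N}. h * (real (k - i) * h) powr - \<gamma> * e i) = (\<Sum>k<N - Suc i. h * (real (Suc k) * h) powr - \<gamma> * e i)"
        by (rule sum.reindex_bij_witness[where i="\<lambda>k. k + Suc i" and j="\<lambda>k. k - Suc i"]) (auto simp: of_nat_diff)
      then show "(\<Sum>k\<in>{Suc i..<N}. h * (real (k - i) * h) powr - \<gamma> * e i) = e i * (\<Sum>k<N - Suc i. h * (real (Suc k) * h) powr - \<gamma>)"
        by (simp add: sum_distrib_left mult.commute)
    qed
    also have "\<dots> \<le> (\<Sum>i<N. e i * S)"
      by (intro sum_mono mult_left_mono grid e0) auto
    also have "\<dots> = S * (\<Sum>i<N. e i)" by (simp add: sum_distrib_left mult.commute)
    also have "\<dots> \<le> S * v" using esum S0 by (rule mult_left_mono)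
    finally show ?thesis .
  qed
  also have "(\<Sum>k<N. h * (real (Suc k) * h) powr - \<gamma>) \<le> S" by (rule grid) simp
  also have "c * (T powr (1 / \<alpha>) * S + S * v) \<le> occ_const T * m powr \<theta> * (1 + v)"
  proof -
    have "T powr (1 / \<alpha>) + v \<le> (1 + T powr (1 / \<alpha>)) * (1 + v)" using v(2) by (simp add: algebra_simps)
    then have "(c * S) * (T powr (1 / \<alpha>) + v) \<le> (c * S) * ((1 + T powr (1 / \<alpha>)) * (1 + v))"
      using c0 S0 by (intro mult_left_mono) auto
    moreover have "(c * S) * ((1 + T powr (1 / \<alpha>)) * (1 + v)) = occ_const T * m powr \<theta> * (1 + v)"
      by (simp add: occ_const_def c_def S_def mult_ac)
    moreover have "(c * S) * (T powr (1 / \<alpha>) + v) = c * (T powr (1 / \<alpha>) * S + S * v)"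
      by (simp add: algebra_simps)
    ultimately show ?thesis by simp
  qed
  finally show ?thesis using c0 by (simp add: T_def mult_left_mono)
qed

text \<open>The bound \<open>v\<close> on the total displacement need only hold on an event. The
  displacements are set to \<open>0\<close> as soon as their accumulated size exceeds
  \<open>v\<close>; the modified process is still adapted, is covered by
  \<open>grid_occupation\<close>, and agrees with \<open>X\<close> on the event.\<close>
lemma truncated_occupation:
  fixes X :: "real \<Rightarrow> 'w \<Rightarrow> real" and U :: "real set"
  assumes h: "0 < h" and X: "\<And>t. 0 \<le> t \<Longrightarrow> X t \<in> borel_measurable (F t)"
    and U[measurable]: "U \<in> sets borel" and m: "emeasure lborel U = ennreal m" "0 \<le> m" and v: "0 \<le> v"
  defines "d \<equiv> \<lambda>i \<omega>. X (real (Suc i) * h) \<omega> - X (real i * h) \<omega> - (Z (real (Suc i) * h) \<omega> - Z (real i * h) \<omega>)"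
  shows "(\<Sum>k<N. h * prob {\<omega>\<in>space M. (\<Sum>i<N. \<bar>d i \<omega>\<bar>) \<le> v \<and> X (real (Suc k) * h) \<omega> - d k \<omega> \<in> U})
    \<le> occ_const (real N * h) * m powr \<theta> * (1 + v)"
proof -
  have le: "0 \<le> real i * h" "real i * h \<le> real (Suc i) * h" for i using h by (auto simp: algebra_simps)
  have XF: "X (real i * h) \<in> borel_measurable (F (real i * h))" and ZF: "Z (real i * h) \<in> borel_measurable (F (real i * h))" for i
    using X adapted_Z le by auto
  have up: "f \<in> borel_measurable (F (real i * h)) \<Longrightarrow> i \<le> j \<Longrightarrow> f \<in> borel_measurable (F (real j * h))" for f :: "'w \<Rightarrow> real" and i j
    by (rule F_mono_measurable) (use h in \<open>auto intro!: mult_right_mono\<close>)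
  have dF: "d i \<in> borel_measurable (F (real (Suc i) * h))" for i
    unfolding d_def by (intro borel_measurable_diff XF ZF up[OF XF] up[OF ZF]) auto
  define e where "e i \<omega> = (if (\<Sum>l<Suc i. \<bar>d l \<omega>\<bar>) \<le> v then d i \<omega> else 0)" for i \<omega>
  have eF: "e i \<in> borel_measurable (F (real (Suc i) * h))" for i
  proof -
    have "(\<lambda>\<omega>. \<Sum>l<Suc i. \<bar>d l \<omega>\<bar>) \<in> borel_measurable (F (real (Suc i) * h))"
      by (intro borel_measurable_sum borel_measurable_abs up[OF dF]) auto
    with dF[of i] show ?thesis unfolding e_def by measurable
  qed
  define \<zeta> where "\<zeta> j \<omega> = X 0 \<omega> + (\<Sum>i<j. Z (real (Suc i) * h) \<omega> - Z (real i * h) \<omega> + e i \<omega>)" for j \<omega>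
  have \<zeta>F: "\<zeta> j \<in> borel_measurable (F (real j * h))" for j
    unfolding \<zeta>_def
    by (intro borel_measurable_add borel_measurable_sum borel_measurable_diff up[OF ZF] up[OF eF])
       (use up[OF XF[of 0], of j] in auto)
  have \<zeta>d: "\<zeta> (Suc i) \<omega> - \<zeta> i \<omega> - (Z (real (Suc i) * h) \<omega> - Z (real i * h) \<omega>) = e i \<omega>" for i \<omega>
    by (simp add: \<zeta>_def)
  have esum: "(\<Sum>i<n. \<bar>e i \<omega>\<bar>) \<le> v \<and> (\<Sum>i<n. \<bar>e i \<omega>\<bar>) \<le> (\<Sum>i<n. \<bar>d i \<omega>\<bar>)" for n \<omega>
    using v by (induction n) (auto simp: e_def)
  have main: "(\<Sum>k<N. h * prob {\<omega>\<in>space M. \<zeta> (Suc k) \<omega> - e k \<omega> \<in> U}) \<le> occ_const (real N * h) * m powr \<theta> * (1 + v)"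
    using grid_occupation[of h \<zeta> U m N v] h \<zeta>F m v esum unfolding \<zeta>d by simp
  have same: "\<zeta> j \<omega> = X (real j * h) \<omega> \<and> (j < N \<longrightarrow> e j \<omega> = d j \<omega>)"
    if dle: "(\<Sum>i<N. \<bar>d i \<omega>\<bar>) \<le> v" and "j \<le> N" for j \<omega>
  proof -
    have ed: "e j \<omega> = d j \<omega>" if "j < N" for j
    proof -
      have "(\<Sum>l<Suc j. \<bar>d l \<omega>\<bar>) \<le> (\<Sum>l<N. \<bar>d l \<omega>\<bar>)" using that by (intro sum_mono2) auto
      then show ?thesis using dle by (simp add: e_def)
    qed
    have "\<zeta> j \<omega> = X (real j * h) \<omega>" using \<open>j \<le> N\<close>
    proof (induction j)
      case 0 then show ?case by (simp add: \<zeta>_def)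
    next
      case (Suc j)
      then show ?case using \<zeta>d[of j \<omega>] ed[of j] by (simp add: d_def)
    qed
    then show ?thesis using ed by simp
  qed
  have Xm[measurable]: "X (real i * h) \<in> borel_measurable M" "Z (real i * h) \<in> borel_measurable M" for i
    using F_M_measurable[OF XF le(1)] F_M_measurable[OF ZF le(1)] by auto
  have \<zeta>m[measurable]: "\<zeta> i \<in> borel_measurable M" "e i \<in> borel_measurable M" for i
    using F_M_measurable[OF \<zeta>F le(1)] F_M_measurable[OF eF le(1)] by auto
  have "(\<Sum>k<N. h * prob {\<omega>\<in>space M. (\<Sum>i<N. \<bar>d i \<omega>\<bar>) \<le> v \<and> X (real (Suc k) * h) \<omega> - d k \<omega> \<in> U}) \<le>
    (\<Sum>k<N. h * prob {\<omega>\<in>space M. \<zeta> (Suc k) \<omega> - e k \<omega> \<in> U})"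
  proof (intro sum_mono mult_left_mono finite_measure_mono)
    fix k assume k: "k \<in> {..<N}"
    show "{\<omega>\<in>space M. (\<Sum>i<N. \<bar>d i \<omega>\<bar>) \<le> v \<and> X (real (Suc k) * h) \<omega> - d k \<omega> \<in> U} \<subseteq> {\<omega>\<in>space M. \<zeta> (Suc k) \<omega> - e k \<omega> \<in> U}"
    proof safe
      fix \<omega> assume *: "(\<Sum>i<N. \<bar>d i \<omega>\<bar>) \<le> v" "X (real (Suc k) * h) \<omega> - d k \<omega> \<in> U"
      then show "\<zeta> (Suc k) \<omega> - e k \<omega> \<in> U" using same[OF *(1), of k] same[OF *(1), of "Suc k"] k by simp
    qed
  qed (use h in auto)
  with main show ?thesis by simp
qed

text \<open>Passage from the grid to continuous time by Fatou's lemma. For a time \<open>t\<close>,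
  the right end of the grid interval around \<open>t\<close> decreases to \<open>t\<close>, so
  \<open>X\<close> there tends to \<open>X t\<close> by right continuity while the displacement over
  the interval tends to \<open>0\<close>. As \<open>U\<close> is open, the grid process is
  eventually in \<open>U\<close> whenever \<open>X t\<close> is.\<close>
lemma occupation_bound:
  fixes X :: "real \<Rightarrow> 'w \<Rightarrow> real" and U :: "real set"
  assumes T: "0 < T" and X: "\<And>t. 0 \<le> t \<Longrightarrow> X t \<in> borel_measurable (F t)"
    and U: "open U" and m: "emeasure lborel U = ennreal m" "0 \<le> m" and v: "0 \<le> v"
    and A[measurable]: "A \<in> sets M"
    and right: "\<And>\<omega> t. \<omega> \<in> A \<Longrightarrow> 0 \<le> t \<Longrightarrow> continuous (at_right t) (\<lambda>t. X t \<omega>)"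
    and cont: "\<And>\<omega>. \<omega> \<in> A \<Longrightarrow> continuous_on {0..T} (\<lambda>t. X t \<omega> - Z t \<omega>)"
    and var: "\<And>\<omega> N. \<omega> \<in> A \<Longrightarrow> 0 < N \<Longrightarrow> (\<Sum>i<N. \<bar>(X (real (Suc i) * (T / real N)) \<omega> - Z (real (Suc i) * (T / real N)) \<omega>)
        - (X (real i * (T / real N)) \<omega> - Z (real i * (T / real N)) \<omega>)\<bar>) \<le> v"
  shows "(\<integral>\<^sup>+\<omega>. indicator A \<omega> * (\<integral>\<^sup>+t. indicator {0<..<T} t * indicator U (X t \<omega>) \<partial>lborel) \<partial>M) \<le> ennreal (occ_const T * m powr \<theta> * (1 + v))"
proof -
  define h where "h n = T / real (Suc n)" for n
  have h: "0 < h n" for n using T by (simp add: h_def)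
  define d where "d n i \<omega> = X (real (Suc i) * h n) \<omega> - X (real i * h n) \<omega> - (Z (real (Suc i) * h n) \<omega> - Z (real i * h n) \<omega>)" for n i \<omega>
  define E where "E n k = {\<omega>\<in>space M. (\<Sum>i<Suc n. \<bar>d n i \<omega>\<bar>) \<le> v \<and> X (real (Suc k) * h n) \<omega> - d n k \<omega> \<in> U}" for n k
  have Ub[measurable]: "U \<in> sets borel" using U by simp
  have "0 \<le> real i * h n" for i n using h[of n] by simp
  then have [measurable]: "X (real i * h n) \<in> borel_measurable M" "Z (real i * h n) \<in> borel_measurable M" for i n
    using F_M_measurable[OF X] by auto
  have [measurable]: "d n i \<in> borel_measurable M" for n i unfolding d_def by measurable
  have E[measurable]: "E n k \<in> sets M" for n k unfolding E_def by measurable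
  have Asp: "A \<subseteq> space M" using A by (rule sets.sets_into_space)
  have inner: "(\<integral>\<^sup>+t. indicator {0<..<T} t * indicator U (X t \<omega>) \<partial>lborel) \<le>
      liminf (\<lambda>n. \<Sum>k<Suc n. ennreal (h n) * indicator (E n k) \<omega>)" if \<omega>: "\<omega> \<in> A" for \<omega>
  proof -
    define g where "g n t = (\<Sum>k<Suc n. indicator (E n k) \<omega> * indicator {real k * h n..<real (Suc k) * h n} t :: ennreal)" for n t
    have gm[measurable]: "g n \<in> borel_measurable lborel" for n unfolding g_def by measurable
    have "(\<integral>\<^sup>+t. indicator {0<..<T} t * indicator U (X t \<omega>) \<partial>lborel) \<le> (\<integral>\<^sup>+t. liminf (\<lambda>n. g n t) \<partial>lborel)"
    proof (rule nn_integral_mono)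
      fix t :: real
      show "indicator {0<..<T} t * indicator U (X t \<omega>) \<le> liminf (\<lambda>n. g n t)"
      proof (cases "0 < t \<and> t < T \<and> X t \<omega> \<in> U")
        case False then show ?thesis by (auto simp: indicator_def)
      next
        case True
        define k where "k n = nat \<lfloor>t / h n\<rfloor>" for n
        have kb: "real (k n) * h n \<le> t" "t < real (Suc (k n)) * h n" for n
        proof -
          have "0 \<le> t / h n" using True h[of n] by simp
          then have "real (k n) \<le> t / h n" "t / h n < real (k n) + 1" unfolding k_def by linarith+
          then show "real (k n) * h n \<le> t" "t < real (Suc (k n)) * h n" using h[of n] by (auto simp: field_simps)
        qed
        have kn: "k n < Suc n" for n
        proof (rule ccontr)
          assume "\<not> k n < Suc n"
          then have "real (Suc n) * h n \<le> real (k n) * h n" using h[of n] by (intro mult_right_mono) auto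
          then have "T \<le> t" using kb(1)[of n] by (simp add: h_def)
          then show False using True by simp
        qed
        have h0: "h \<longlonglongrightarrow> 0" unfolding h_def using LIMSEQ_Suc[OF lim_const_over_n[of T]] by simp
        have s1: "(\<lambda>n. real (Suc (k n)) * h n) \<longlonglongrightarrow> t"
        proof (rule real_tendsto_sandwich[of "\<lambda>_. t" _ _ "\<lambda>n. t + h n"])
          show "(\<lambda>n. t + h n) \<longlonglongrightarrow> t" using tendsto_add[OF tendsto_const h0, of t] by simp
          show "\<forall>\<^sub>F n in sequentially. real (Suc (k n)) * h n \<le> t + h n"
            using kb(1) by (intro always_eventually allI) (simp add: algebra_simps)
        qed (use kb(2) in \<open>auto intro!: always_eventually less_imp_le\<close>)
        have s0: "(\<lambda>n. real (k n) * h n) \<longlonglongrightarrow> t"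
          using tendsto_diff[OF s1 h0] by (simp add: algebra_simps)
        have sr: "filterlim (\<lambda>n. real (Suc (k n)) * h n) (at_right t) sequentially"
        proof -
          have "real (Suc (k n)) * h n \<in> {t<..} \<and> real (Suc (k n)) * h n \<noteq> t" for n using kb(2)[of n] by (simp del: of_nat_Suc)
          then show ?thesis using s1 unfolding filterlim_at by (auto intro!: always_eventually)
        qed
        have lX: "(\<lambda>n. X (real (Suc (k n)) * h n) \<omega>) \<longlonglongrightarrow> X t \<omega>"
          using right[OF \<omega>, of t] True unfolding continuous_within by (intro filterlim_compose[OF _ sr]) auto
        have in1: "real (Suc (k n)) * h n \<in> {0..T}" "real (k n) * h n \<in> {0..T}" for n
        proof -
          have "real (Suc (k n)) * h n \<le> real (Suc n) * h n" using kn[of n] h[of n] by (intro mult_right_mono) auto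
          then have 1: "real (Suc (k n)) * h n \<le> T" by (simp add: h_def)
          have "real (k n) * h n \<le> real (Suc (k n)) * h n" using h[of n] by (intro mult_right_mono) auto
          then have 2: "real (k n) * h n \<le> T" using 1 by (rule order_trans)
          have 3: "0 \<le> real (k n) * h n" "0 \<le> real (Suc (k n)) * h n" using h[of n] by auto
          from 1 2 3 show "real (Suc (k n)) * h n \<in> {0..T}" "real (k n) * h n \<in> {0..T}"
            by simp_all
        qed
        have "(\<lambda>n. X (s n) \<omega> - Z (s n) \<omega>) \<longlonglongrightarrow> X t \<omega> - Z t \<omega>" if "s \<longlonglongrightarrow> t" "\<And>n. s n \<in> {0..T}" for s :: "nat \<Rightarrow> real"
          using cont[OF \<omega>] that True unfolding continuous_on_sequentially by (auto simp: o_def)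
        from tendsto_diff[OF this[OF s1 in1(1)] this[OF s0 in1(2)]]
        have "(\<lambda>n. d n (k n) \<omega>) \<longlonglongrightarrow> 0" unfolding d_def by (simp add: algebra_simps)
        from tendsto_diff[OF lX this]
        have "(\<lambda>n. X (real (Suc (k n)) * h n) \<omega> - d n (k n) \<omega>) \<longlonglongrightarrow> X t \<omega>" by simp
        then have ev: "\<forall>\<^sub>F n in sequentially. X (real (Suc (k n)) * h n) \<omega> - d n (k n) \<omega> \<in> U"
          using True U by (auto dest: topological_tendstoD)
        have vE: "(\<Sum>i<Suc n. \<bar>d n i \<omega>\<bar>) \<le> v" for n
          using var[OF \<omega>, of "Suc n"] unfolding h_def[symmetric] d_def by (simp add: algebra_simps)
        have "\<forall>\<^sub>F n in sequentially. 1 \<le> g n t"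
          using ev
        proof eventually_elim
          case (elim n)
          have "\<omega> \<in> E n (k n)" using elim vE[of n] \<omega> Asp unfolding E_def by auto
          then have "1 = indicator (E n (k n)) \<omega> * (indicator {real (k n) * h n..<real (Suc (k n)) * h n} t :: ennreal)"
            using kb[of n] by (simp add: indicator_def)
          also have "\<dots> \<le> g n t" unfolding g_def using kn[of n]
            by (intro member_le_sum[of "k n" _ "\<lambda>k. indicator (E n k) \<omega> * indicator {real k * h n..<real (Suc k) * h n} t"]) auto
          finally show ?case .
        qed
        then have "1 \<le> liminf (\<lambda>n. g n t)" by (rule Liminf_bounded)
        then show ?thesis using True by simp
      qed
    qed
    also have "\<dots> \<le> liminf (\<lambda>n. \<integral>\<^sup>+t. g n t \<partial>lborel)" by (rule nn_integral_liminf) measurable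
    finally have "(\<integral>\<^sup>+t. indicator {0<..<T} t * indicator U (X t \<omega>) \<partial>lborel) \<le> liminf (\<lambda>n. \<integral>\<^sup>+t. g n t \<partial>lborel)" .
    moreover have "(\<integral>\<^sup>+t. g n t \<partial>lborel) = (\<Sum>k<Suc n. ennreal (h n) * indicator (E n k) \<omega>)" for n
    proof -
      have "(\<integral>\<^sup>+t. g n t \<partial>lborel) = (\<Sum>k<Suc n. \<integral>\<^sup>+t. indicator (E n k) \<omega> * indicator {real k * h n..<real (Suc k) * h n} t \<partial>lborel)"
        unfolding g_def by (rule nn_integral_sum) measurable
      also have "\<dots> = (\<Sum>k<Suc n. ennreal (h n) * indicator (E n k) \<omega>)"
      proof (rule sum.cong[OF refl])
        fix k
        have "real k * h n \<le> real (Suc k) * h n" using h[of n] by (intro mult_right_mono) auto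
        moreover have "real (Suc k) * h n - real k * h n = h n" by (simp add: algebra_simps)
        ultimately show "(\<integral>\<^sup>+t. indicator (E n k) \<omega> * indicator {real k * h n..<real (Suc k) * h n} t \<partial>lborel) = ennreal (h n) * indicator (E n k) \<omega>"
          by (simp add: nn_integral_cmult_indicator mult.commute del: of_nat_Suc)
      qed
      finally show ?thesis .
    qed
    ultimately show ?thesis by simp
  qed
  have "(\<integral>\<^sup>+\<omega>. indicator A \<omega> * (\<integral>\<^sup>+t. indicator {0<..<T} t * indicator U (X t \<omega>) \<partial>lborel) \<partial>M) \<le>
      (\<integral>\<^sup>+\<omega>. liminf (\<lambda>n. \<Sum>k<Suc n. ennreal (h n) * indicator (E n k) \<omega>) \<partial>M)"
    by (rule nn_integral_mono) (use inner in \<open>auto simp: indicator_def\<close>)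
  also have "\<dots> \<le> liminf (\<lambda>n. \<integral>\<^sup>+\<omega>. (\<Sum>k<Suc n. ennreal (h n) * indicator (E n k) \<omega>) \<partial>M)"
    by (rule nn_integral_liminf) measurable
  also have "\<dots> \<le> ennreal (occ_const T * m powr \<theta> * (1 + v))"
  proof -
    have "(\<integral>\<^sup>+\<omega>. (\<Sum>k<Suc n. ennreal (h n) * indicator (E n k) \<omega>) \<partial>M) \<le> ennreal (occ_const T * m powr \<theta> * (1 + v))" for n
    proof -
      have "(\<integral>\<^sup>+\<omega>. (\<Sum>k<Suc n. ennreal (h n) * indicator (E n k) \<omega>) \<partial>M) = (\<Sum>k<Suc n. \<integral>\<^sup>+\<omega>. ennreal (h n) * indicator (E n k) \<omega> \<partial>M)"
        by (rule nn_integral_sum) measurable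
      also have "\<dots> = (\<Sum>k<Suc n. ennreal (h n * prob (E n k)))"
        using h[of n] by (intro sum.cong refl) (simp add: nn_integral_cmult_indicator emeasure_eq_measure ennreal_mult)
      also have "\<dots> = ennreal (\<Sum>k<Suc n. h n * prob (E n k))" using h[of n] by (intro sum_ennreal) (simp add: less_imp_le)
      also have "(\<Sum>k<Suc n. h n * prob (E n k)) \<le> occ_const (real (Suc n) * h n) * m powr \<theta> * (1 + v)"
        unfolding E_def d_def by (rule truncated_occupation[OF h X Ub m v]) auto
      also have "real (Suc n) * h n = T" by (simp add: h_def)
      finally show ?thesis by (simp add: ennreal_leI)
    qed
    then show ?thesis
      by (metis (no_types, lifting) Liminf_const Liminf_mono always_eventually trivial_limit_sequentially)
  qed
  finally show ?thesis .
qed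

end

text \<open>Right-continuous processes are limits of processes that are constant on grid intervals.
  Forcing the value \<open>0\<close> off the good event \<open>A\<close> and at negative times is
  what permits Fubini's theorem for processes whose paths are regular only almost surely.\<close>
lemma joint_measurable:
  fixes X :: "real \<Rightarrow> 'w \<Rightarrow> real" and M :: "'w measure"
  assumes X: "\<And>t. 0 \<le> t \<Longrightarrow> X t \<in> borel_measurable M" and A[measurable]: "A \<in> sets M"
    and right: "\<And>\<omega> t. \<omega> \<in> A \<Longrightarrow> 0 \<le> t \<Longrightarrow> continuous (at_right t) (\<lambda>t. X t \<omega>)"
  shows "(\<lambda>(t, \<omega>). if \<omega> \<in> A \<and> 0 \<le> t then X t \<omega> else 0) \<in> borel_measurable (lborel \<Otimes>\<^sub>M M)"
proof -
  define k where "k n t = nat \<lfloor>t * real (Suc n)\<rfloor>" for n and t :: real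
  define Y where "Y n = (\<lambda>(t, \<omega>). if \<omega> \<in> A \<and> 0 \<le> t then X (real (Suc (k n t)) / real (Suc n)) \<omega> else 0)" for n
  have [measurable]: "(fst :: real \<times> 'w \<Rightarrow> real) \<in> borel_measurable (lborel \<Otimes>\<^sub>M M)"
    using measurable_fst[of lborel M] by simp
  have Ym: "Y n \<in> borel_measurable (lborel \<Otimes>\<^sub>M M)" for n
  proof -
    have "(\<lambda>x. (\<lambda>i x. if snd x \<in> A \<and> 0 \<le> (fst x :: real) then X (real (Suc i) / real (Suc n)) (snd x) else 0) (k n (fst x)) x) \<in> borel_measurable (lborel \<Otimes>\<^sub>M M)"
    proof (rule measurable_compose_countable[where g="\<lambda>x. k n (fst x)" and f="\<lambda>i x. if snd x \<in> A \<and> 0 \<le> (fst x :: real) then X (real (Suc i) / real (Suc n)) (snd x) else 0"])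
      fix i
      have [measurable]: "X (real (Suc i) / real (Suc n)) \<in> borel_measurable M" by (rule X) simp
      show "(\<lambda>x. if snd x \<in> A \<and> 0 \<le> (fst x :: real) then X (real (Suc i) / real (Suc n)) (snd x) else 0) \<in> borel_measurable (lborel \<Otimes>\<^sub>M M)"
        by measurable
    next
      show "(\<lambda>x. k n (fst x)) \<in> lborel \<Otimes>\<^sub>M M \<rightarrow>\<^sub>M count_space UNIV" unfolding k_def by measurable
    qed
    then show ?thesis by (simp add: Y_def case_prod_beta')
  qed
  have lim: "(\<lambda>n. Y n x) \<longlonglongrightarrow> (case x of (t, \<omega>) \<Rightarrow> if \<omega> \<in> A \<and> 0 \<le> t then X t \<omega> else 0)" for x
  proof -
  obtain t \<omega> where x: "x = (t, \<omega>)" by (cases x)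
  show ?thesis
  proof (cases "\<omega> \<in> A \<and> 0 \<le> t")
    case True
    define s where "s n = real (Suc (k n t)) / real (Suc n)" for n
    have kb: "real (k n t) \<le> t * real (Suc n)" "t * real (Suc n) < real (Suc (k n t))" for n
    proof -
      have "0 \<le> t * real (Suc n)" using True by simp
      then show "real (k n t) \<le> t * real (Suc n)" "t * real (Suc n) < real (Suc (k n t))" unfolding k_def by linarith+
    qed
    have sb: "t < s n" "s n \<le> t + 1 / real (Suc n)" for n
    proof -
      show "t < s n" unfolding s_def using kb(2)[of n] by (subst pos_less_divide_eq) auto
      have "real (k n t) / real (Suc n) \<le> t" using kb(1)[of n] by (subst pos_divide_le_eq) auto
      then show "s n \<le> t + 1 / real (Suc n)" by (simp add: s_def add_divide_distrib)
    qed
    have s1: "s \<longlonglongrightarrow> t"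
    proof (rule real_tendsto_sandwich[of "\<lambda>_. t" _ _ "\<lambda>n. t + 1 / real (Suc n)"])
      show "(\<lambda>n. t + 1 / real (Suc n)) \<longlonglongrightarrow> t"
        using tendsto_add[OF tendsto_const LIMSEQ_inverse_real_of_nat, of t] by (simp add: inverse_eq_divide)
    qed (use sb in \<open>auto intro!: always_eventually less_imp_le\<close>)
    have "s n \<in> {t<..} \<and> s n \<noteq> t" for n using sb(1)[of n] by simp
    then have sr: "filterlim s (at_right t) sequentially" using s1 unfolding filterlim_at by (auto intro!: always_eventually)
    have "((\<lambda>t. X t \<omega>) \<longlongrightarrow> X t \<omega>) (at_right t)" using right[of \<omega> t] True by (simp add: continuous_within)
    from filterlim_compose[OF this sr] have "(\<lambda>n. X (s n) \<omega>) \<longlonglongrightarrow> X t \<omega>" .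
    then show ?thesis using True by (simp add: Y_def x s_def)
  qed (auto simp: Y_def x)
  qed
  show ?thesis by (rule borel_measurable_LIMSEQ_real[OF lim Ym])
qed

lemma null_set_open_cover:
  assumes "N \<in> null_sets lebesgue" "0 < e"
  obtains U :: "real set" and m where "open U" "N \<subseteq> U" "emeasure lborel U = ennreal m" "0 \<le> m" "m < e"
proof -
  obtain N' where N': "N' \<in> null_sets lborel" "N \<subseteq> N'"
    using assms(1) by (auto simp: null_sets_completion_iff2)
  then have "N' \<in> sets borel" "emeasure lborel N' = 0" by (auto simp: null_sets_def)
  from outer_regular_lborel[OF this(1) assms(2)] obtain U where U: "open U" "N' \<subseteq> U" "emeasure lborel (U - N') < ennreal e" by blast
  have "emeasure lborel U \<le> emeasure lborel (U - N') + emeasure lborel N'"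
    using U N' by (intro order_trans[OF _ emeasure_subadditive] emeasure_mono) (auto simp: null_sets_def)
  then have lt: "emeasure lborel U < ennreal e" using U \<open>emeasure lborel N' = 0\<close> by simp
  then have "emeasure lborel U \<noteq> \<top>" by (metis ennreal_less_top less_top_ennreal order_less_asym top.not_eq_extremum)
  then obtain m where m: "emeasure lborel U = ennreal m" "0 \<le> m" by (cases "emeasure lborel U") auto
  then have "m < e" using lt assms(2) by (simp add: ennreal_less_iff)
  then show ?thesis using that[of U m] U N' m by auto
qed

context stable_noise begin

text \<open>A null set is contained in a \<open>G\<^sub>\<delta>\<close> set \<open>G\<close>, the
  intersection of open sets of arbitrarily small measure, and the expected time spent in
  \<open>G\<close> is bounded by the occupation estimate for each of them.\<close>
lemma occupation_null:
  fixes X :: "real \<Rightarrow> 'w \<Rightarrow> real" and N :: "real set"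
  assumes T: "0 < T" and X: "\<And>t. 0 \<le> t \<Longrightarrow> X t \<in> borel_measurable (F t)"
    and N: "N \<in> null_sets lebesgue" and v: "0 \<le> v"
    and A[measurable]: "A \<in> sets M"
    and right: "\<And>\<omega> t. \<omega> \<in> A \<Longrightarrow> 0 \<le> t \<Longrightarrow> continuous (at_right t) (\<lambda>t. X t \<omega>)"
    and cont: "\<And>\<omega>. \<omega> \<in> A \<Longrightarrow> continuous_on {0..T} (\<lambda>t. X t \<omega> - Z t \<omega>)"
    and var: "\<And>\<omega> N. \<omega> \<in> A \<Longrightarrow> 0 < N \<Longrightarrow> (\<Sum>i<N. \<bar>(X (real (Suc i) * (T / real N)) \<omega> - Z (real (Suc i) * (T / real N)) \<omega>)
        - (X (real i * (T / real N)) \<omega> - Z (real i * (T / real N)) \<omega>)\<bar>) \<le> v"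
  shows "AE \<omega> in M. \<omega> \<in> A \<longrightarrow> (AE t in lborel. 0 < t \<and> t < T \<longrightarrow> X t \<omega> \<notin> N)"
proof -
  have "\<exists>U m. open U \<and> N \<subseteq> U \<and> emeasure lborel U = ennreal m \<and> 0 \<le> m \<and> m < 1 / real (Suc j)" for j
    by (rule null_set_open_cover[OF N, of "1 / real (Suc j)"]) auto
  then obtain U m where U: "\<And>j. open (U j)" "\<And>j. N \<subseteq> U j" "\<And>j. emeasure lborel (U j) = ennreal (m j)"
      "\<And>j. 0 \<le> m j" "\<And>j. m j < 1 / real (Suc j)" by metis
  define G where "G = (\<Inter>j. U j)"
  have Ub: "U j \<in> sets borel" for j using U(1) by simp
  then have G[measurable]: "G \<in> sets borel" by (auto simp: G_def)
  define Y where "Y t \<omega> = (if \<omega> \<in> A \<and> 0 \<le> t then X t \<omega> else 0)" for t \<omega>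
  have [measurable]: "(\<lambda>(t, \<omega>). Y t \<omega>) \<in> borel_measurable (lborel \<Otimes>\<^sub>M M)"
    unfolding Y_def using F_M_measurable[OF X] right by (intro joint_measurable A) auto
  have [measurable]: "(\<lambda>(\<omega>, t). Y t \<omega>) \<in> borel_measurable (M \<Otimes>\<^sub>M lborel)"
    using measurable_compose[OF measurable_pair_swap' \<open>(\<lambda>(t, \<omega>). Y t \<omega>) \<in> borel_measurable (lborel \<Otimes>\<^sub>M M)\<close>]
    by (simp add: case_prod_beta')
  define \<Psi> where "\<Psi> \<omega> = (\<integral>\<^sup>+t. indicator A \<omega> * (indicator {0<..<T} t * indicator G (Y t \<omega>)) \<partial>lborel)" for \<omega>
  have \<Psi>m[measurable]: "\<Psi> \<in> borel_measurable M" unfolding \<Psi>_def by measurable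
  have "(\<integral>\<^sup>+\<omega>. \<Psi> \<omega> \<partial>M) \<le> ennreal (occ_const T * (1 / real (Suc j)) powr \<theta> * (1 + v))" for j
  proof -
    have "(\<integral>\<^sup>+\<omega>. \<Psi> \<omega> \<partial>M) \<le> (\<integral>\<^sup>+\<omega>. indicator A \<omega> * (\<integral>\<^sup>+t. indicator {0<..<T} t * indicator (U j) (X t \<omega>) \<partial>lborel) \<partial>M)"
    proof (rule nn_integral_mono)
      fix \<omega>
      show "\<Psi> \<omega> \<le> indicator A \<omega> * (\<integral>\<^sup>+t. indicator {0<..<T} t * indicator (U j) (X t \<omega>) \<partial>lborel)"
      proof (cases "\<omega> \<in> A")
        case True
        then show ?thesis unfolding \<Psi>_def
          by (auto intro!: nn_integral_mono simp: Y_def G_def indicator_def)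
      qed (simp add: \<Psi>_def)
    qed
    also have "\<dots> \<le> ennreal (occ_const T * m j powr \<theta> * (1 + v))"
      by (rule occupation_bound[OF T X U(1,3,4) v A right cont var])
    also have "\<dots> \<le> ennreal (occ_const T * (1 / real (Suc j)) powr \<theta> * (1 + v))"
      using U(4,5)[of j] \<theta>_bounds v occ_const_nonneg[of T]
      by (intro ennreal_leI mult_right_mono mult_left_mono powr_mono2) auto
    finally show ?thesis .
  qed
  moreover have "(\<lambda>j. ennreal (occ_const T * (1 / real (Suc j)) powr \<theta> * (1 + v))) \<longlonglongrightarrow> ennreal (occ_const T * 0 * (1 + v))"
  proof (intro tendsto_ennrealI tendsto_mult tendsto_const)
    have "(\<lambda>j. (1 / real (Suc j)) powr \<theta>) \<longlonglongrightarrow> 0 powr \<theta>"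
      using LIMSEQ_inverse_real_of_nat \<theta>_bounds
      by (intro tendsto_powr') (auto simp: inverse_eq_divide intro!: always_eventually)
    then show "(\<lambda>j. (1 / real (Suc j)) powr \<theta>) \<longlonglongrightarrow> 0" by simp
  qed
  ultimately have "(\<integral>\<^sup>+\<omega>. \<Psi> \<omega> \<partial>M) \<le> 0"
    using LIMSEQ_le_const[of _ "ennreal (occ_const T * 0 * (1 + v))"] by fastforce
  then have "AE \<omega> in M. \<Psi> \<omega> = 0" by (subst nn_integral_0_iff_AE[symmetric]) auto
  then show ?thesis
  proof eventually_elim
    fix \<omega> assume "\<Psi> \<omega> = 0"
    show "\<omega> \<in> A \<longrightarrow> (AE t in lborel. 0 < t \<and> t < T \<longrightarrow> X t \<omega> \<notin> N)"
    proof
    assume "\<omega> \<in> A"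
    then have \<omega>: "\<omega> \<in> space M" "\<Psi> \<omega> = 0" "\<omega> \<in> A" using sets.sets_into_space[OF A] \<open>\<Psi> \<omega> = 0\<close> by auto
    have [measurable]: "(\<lambda>t. Y t \<omega>) \<in> borel_measurable lborel"
      using measurable_Pair2[OF \<open>(\<lambda>(\<omega>, t). Y t \<omega>) \<in> borel_measurable (M \<Otimes>\<^sub>M lborel)\<close> \<omega>(1)] by simp
    have "AE t in lborel. indicator A \<omega> * (indicator {0<..<T} t * indicator G (Y t \<omega>)) = (0::ennreal)"
      using \<omega>(2) unfolding \<Psi>_def by (subst (asm) nn_integral_0_iff_AE) auto
    then show "AE t in lborel. 0 < t \<and> t < T \<longrightarrow> X t \<omega> \<notin> N"
    proof eventually_elim
      fix t assume "indicator A \<omega> * (indicator {0<..<T} t * indicator G (Y t \<omega>)) = (0::ennreal)"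
      then show "0 < t \<and> t < T \<longrightarrow> X t \<omega> \<notin> N" using \<omega>(3) U(2) by (auto simp: Y_def G_def indicator_def split: if_splits)
    qed
    qed
  qed
qed

end

section \<open>A Duhamel formula\<close>

lemma right_continuous_seq:
  fixes y :: "real \<Rightarrow> real"
  assumes "continuous (at_right s) y" "\<And>n. s \<le> u n" "u \<longlonglongrightarrow> s"
  shows "(\<lambda>n. y (u n)) \<longlonglongrightarrow> y s"
proof -
  have "continuous (at s within {s..}) y"
  proof -
    have "{s..} - {s} = {s<..} - {s}" by auto
    then show ?thesis using assms(1) by (simp add: continuous_within at_within_def)
  qed
  then show ?thesis using assms(2,3) unfolding continuous_within_sequentially by (auto simp: o_def)
qed

lemma right_continuous_measurable:
  fixes y :: "real \<Rightarrow> real"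
  assumes "\<And>t. 0 \<le> t \<Longrightarrow> continuous (at_right t) y"
  shows "(\<lambda>t. if 0 \<le> t then y t else 0) \<in> borel_measurable borel"
proof -
  have "(\<lambda>(t, u). if u \<in> UNIV \<and> 0 \<le> t then y t else 0) \<in> borel_measurable (lborel \<Otimes>\<^sub>M count_space (UNIV :: unit set))"
    by (rule joint_measurable[of "\<lambda>t u. y t"]) (use assms in auto)
  then have "(\<lambda>t. (\<lambda>(t, u). if u \<in> UNIV \<and> 0 \<le> t then y t else 0) (t, ())) \<in> borel_measurable lborel"
    by (rule measurable_compose[rotated]) auto
  then show ?thesis by simp
qed

lemma drift_absolutely_integrable:
  fixes y b :: "real \<Rightarrow> real"
  assumes y: "\<And>t. 0 \<le> t \<Longrightarrow> continuous (at_right t) y" and [measurable]: "b \<in> borel_measurable borel"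
    and b: "\<And>z. \<bar>b z\<bar> \<le> B" and s: "0 \<le> s"
  shows "(\<lambda>u. b (y u)) absolutely_integrable_on {s..t}"
proof -
  define y' where "y' t = (if 0 \<le> t then y t else 0)" for t
  have [measurable]: "y' \<in> borel_measurable borel" unfolding y'_def by (rule right_continuous_measurable) fact
  have "set_integrable lborel {s..t} (\<lambda>u. b (y' u))"
    unfolding set_integrable_def
  proof (rule integrable_dominated)
    show "integrable lborel (\<lambda>u. B * indicator {s..t} u)" by (intro integrable_mult_right integrable_real_indicator) (auto simp: emeasure_lborel_Icc_eq)
    show "\<bar>indicator {s..t} u *\<^sub>R b (y' u)\<bar> \<le> B * indicator {s..t} u" for u
      using b[of "y' u"] by (auto simp: indicator_def)
  qed measurable
  moreover have "(\<lambda>u. indicator {s..t} u *\<^sub>R b (y' u)) = (\<lambda>u. indicator {s..t} u *\<^sub>R b (y u))"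
    using s by (auto simp: indicator_def y'_def)
  ultimately have "integrable lborel (\<lambda>u. indicator {s..t} u *\<^sub>R b (y u))" by (simp only: set_integrable_def)
  then show ?thesis
    unfolding set_integrable_def by (simp add: integrable_completion borel_measurable_integrable)
qed

lemma drift_integrable:
  fixes y b :: "real \<Rightarrow> real"
  assumes "\<And>t. 0 \<le> t \<Longrightarrow> continuous (at_right t) y" "b \<in> borel_measurable borel"
    "\<And>z. \<bar>b z\<bar> \<le> B" "0 \<le> s"
  shows "(\<lambda>u. b (y u)) integrable_on {s..t}"
  using drift_absolutely_integrable[OF assms] set_lebesgue_integral_eq_integral(1) by blast

lemma integral_increment:
  fixes f :: "real \<Rightarrow> real"
  assumes "0 \<le> s" "s \<le> t" "f integrable_on {0..t}"
  shows "integral {0..t} f - integral {0..s} f = integral {s..t} f"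
  using Henstock_Kurzweil_Integration.integral_combine[OF assms] by simp

lemma integral_increment_bound:
  fixes f :: "real \<Rightarrow> real"
  assumes "s \<le> t" "f integrable_on {s..t}" "\<And>u. \<bar>f u\<bar> \<le> B"
  shows "\<bar>integral {s..t} f\<bar> \<le> B * (t - s)"
proof -
  have "0 \<le> B" using assms(3)[of 0] by linarith
  then show ?thesis using has_integral_bound_real[of B "{}" f "integral {s..t} f" s t] assms by (auto simp: integrable_integral)
qed

lemma right_continuous_plus_integral:
  fixes f z y :: "real \<Rightarrow> real"
  assumes f: "\<And>t. f integrable_on {0..t}" and z: "\<And>t. 0 \<le> t \<Longrightarrow> continuous (at_right t) z"
    and y: "\<And>t. 0 \<le> t \<Longrightarrow> y t = x + integral {0..t} f + z t" and t: "0 \<le> t"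
  shows "continuous (at_right t) y"
proof -
  have "continuous_on {0..t + 1} (\<lambda>t. integral {0..t} f)" by (intro indefinite_integral_continuous_1 f)
  then have "continuous (at t within {0..t + 1}) (\<lambda>t. integral {0..t} f)"
    using t by (simp add: continuous_on_eq_continuous_within)
  then have "continuous (at t within {t..t + 1}) (\<lambda>t. integral {0..t} f)"
    by (rule continuous_within_subset) (use t in auto)
  then have "continuous (at_right t) (\<lambda>t. integral {0..t} f)"
    using at_within_Icc_at_right[of t "t + 1"] by simp
  then have c: "continuous (at_right t) (\<lambda>t. x + integral {0..t} f + z t)"
    by (intro continuous_intros z t)
  have "(y \<longlongrightarrow> y t) (at_right t)"
  proof (rule Lim_transform_eventually)
    show "((\<lambda>t. x + integral {0..t} f + z t) \<longlongrightarrow> y t) (at_right t)"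
      using c y[OF t] by (simp add: continuous_within)
    show "\<forall>\<^sub>F s in at_right t. x + integral {0..s} f + z s = y s"
      using eventually_at_right_less[of t] by eventually_elim (use t y in simp)
  qed
  then show ?thesis by (simp add: continuous_within)
qed

text \<open>The grid interval of length \<open>T / (n + 1)\<close> that contains \<open>s\<close>.
  The cap \<open>min _ n\<close> takes care of \<open>s = T\<close>, where the floor would point to
  an interval beyond \<open>T\<close>.\<close>
lemma grid_bracket:
  fixes T s :: real and h :: "nat \<Rightarrow> real" and k :: "nat \<Rightarrow> nat"
  assumes T: "0 < T" and s: "s \<in> {0..T}" and h_def: "\<And>n. h n = T / real (Suc n)"
    and k_def: "\<And>n. k n = min (nat \<lfloor>s / h n\<rfloor>) n"
  shows "k n \<le> n" "real (k n) * h n \<le> s" "s \<le> real (Suc (k n)) * h n" "real (Suc (k n)) * h n \<le> T"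
    and "(\<lambda>n. real (Suc (k n)) * h n) \<longlonglongrightarrow> s"
proof -
  have h: "0 < h n" and hT: "real (Suc n) * h n = T" for n using T by (auto simp: h_def)
  have kb: "k n \<le> n \<and> real (k n) * h n \<le> s \<and> s \<le> real (Suc (k n)) * h n \<and> real (Suc (k n)) * h n \<le> T" for n
  proof (intro conjI)
    have s0: "0 \<le> s / h n" using s h[of n] by simp
    show kn: "k n \<le> n" by (simp add: k_def)
    have "real (k n) \<le> s / h n" using s0 unfolding k_def by linarith
    then show "real (k n) * h n \<le> s" using h[of n] by (simp add: pos_le_divide_eq)
    have "s / h n \<le> real (Suc n)" using s h[of n] hT[of n] by (simp add: pos_divide_le_eq)
    moreover have "s / h n \<le> real (Suc (nat \<lfloor>s / h n\<rfloor>))" using s0 by linarith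
    ultimately have "s / h n \<le> real (Suc (k n))" unfolding k_def by (auto simp: min_def)
    then show "s \<le> real (Suc (k n)) * h n" using h[of n] by (simp add: pos_divide_le_eq)
    have "real (Suc (k n)) * h n \<le> real (Suc n) * h n" using h[of n] kn by (intro mult_right_mono) auto
    then show "real (Suc (k n)) * h n \<le> T" using hT[of n] by simp
  qed
  then show "k n \<le> n" "real (k n) * h n \<le> s" "s \<le> real (Suc (k n)) * h n" "real (Suc (k n)) * h n \<le> T" by auto
  have h0: "h \<longlonglongrightarrow> 0" unfolding h_def using LIMSEQ_Suc[OF lim_const_over_n[of T]] by simp
  show "(\<lambda>n. real (Suc (k n)) * h n) \<longlonglongrightarrow> s"
  proof (rule real_tendsto_sandwich[of "\<lambda>_. s" _ _ "\<lambda>n. s + h n"])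
    show "(\<lambda>n. s + h n) \<longlonglongrightarrow> s" using tendsto_add[OF tendsto_const h0, of s] by simp
    show "\<forall>\<^sub>F n in sequentially. real (Suc (k n)) * h n \<le> s + h n"
      using kb by (intro always_eventually allI) (simp add: algebra_simps)
  qed (use kb in \<open>auto intro!: always_eventually\<close>)
qed

lemma step_has_integral:
  fixes f :: "real \<Rightarrow> real" and c :: "nat \<Rightarrow> real"
  assumes h: "0 < h" and f: "f integrable_on {0..real (Suc m) * h}"
  shows "((\<lambda>s. f s * c (min (nat \<lfloor>s / h\<rfloor>) m)) has_integral
     (\<Sum>i<Suc m. integral {real i * h..real (Suc i) * h} f * c i)) {0..real (Suc m) * h}"
proof -
  have "((\<lambda>s. f s * c (min (nat \<lfloor>s / h\<rfloor>) m)) has_integral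
     (\<Sum>i<j. integral {real i * h..real (Suc i) * h} f * c i)) {0..real j * h}" if "j \<le> Suc m" for j
    using that
  proof (induction j)
    case 0
    then show ?case by (simp add: has_integral_refl)
  next
    case (Suc j)
    have le: "0 \<le> real j * h" "real j * h \<le> real (Suc j) * h" "real (Suc j) * h \<le> real (Suc m) * h"
      using h Suc.prems by (auto intro!: mult_right_mono)
    have "f integrable_on {real j * h..real (Suc j) * h}"
      by (rule integrable_on_subinterval[OF f]) (use le in auto)
    then have "((\<lambda>s. f s * c j) has_integral integral {real j * h..real (Suc j) * h} f * c j) {real j * h..real (Suc j) * h}"
      by (intro has_integral_mult_left integrable_integral)
    then have piece: "((\<lambda>s. f s * c (min (nat \<lfloor>s / h\<rfloor>) m)) has_integral integral {real j * h..real (Suc j) * h} f * c j) {real j * h..real (Suc j) * h}"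
    proof (rule has_integral_spike_finite[of "{real (Suc j) * h}", rotated 2])
      fix s assume s: "s \<in> {real j * h..real (Suc j) * h} - {real (Suc j) * h}"
      then have "real j \<le> s / h" "s / h < real j + 1" using h by (auto simp: field_simps)
      then have "\<lfloor>s / h\<rfloor> = int j" by linarith
      then show "f s * c (min (nat \<lfloor>s / h\<rfloor>) m) = f s * c j" using Suc.prems by simp
    qed simp
    have "((\<lambda>s. f s * c (min (nat \<lfloor>s / h\<rfloor>) m)) has_integral
      (\<Sum>i<j. integral {real i * h..real (Suc i) * h} f * c i) + integral {real j * h..real (Suc j) * h} f * c j) {0..real (Suc j) * h}"
      by (rule has_integral_combine[OF le(1,2) Suc.IH piece]) (use Suc.prems in simp)
    then show ?case by simp
  qed
  from this[of "Suc m"] show ?thesis by simp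
qed

context stable_noise begin

text \<open>The error terms of the discrete Duhamel formula along a fixed path, where the
  displacements are integrals of the drift \<open>f\<close>. By \<open>scaled_mean_diff\<close> each
  term is such an integral times a slope, so the sum is an integral of \<open>f\<close> against a
  step function, and dominated convergence applies. The smoothing \<open>\<epsilon>\<close> keeps
  the slopes bounded.\<close>
lemma drift_sum_tendsto:
  fixes y f :: "real \<Rightarrow> real"
  assumes T: "0 < T" and e: "0 < \<epsilon>" and y: "\<And>t. 0 \<le> t \<Longrightarrow> continuous (at_right t) y"
    and f: "f integrable_on {0..T}" "\<And>s. \<bar>f s\<bar> \<le> B"
    and g: "continuous_on UNIV g" "\<And>y. \<bar>g y\<bar> \<le> 1"
  defines "h \<equiv> \<lambda>n. T / real (Suc n)"
  defines "d \<equiv> \<lambda>n i. integral {real i * h n..real (Suc i) * h n} f"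
  defines "G \<equiv> \<lambda>s. f s * slope (scale (\<epsilon> + T - s)) g (y s) 0"
  defines "S \<equiv> \<lambda>n. \<Sum>i<Suc n. P (\<epsilon> + real (n - i) * h n) g (y (real (Suc i) * h n))
      - P (\<epsilon> + real (n - i) * h n) g (y (real (Suc i) * h n) - d n i)"
  shows "G integrable_on {0..T}" "S \<longlonglongrightarrow> integral {0..T} G"
    and "\<bar>S n\<bar> \<le> B * (K / scale \<epsilon>) * T"
proof -
  have gm: "g \<in> borel_measurable borel" using g(1) by (rule borel_measurable_continuous_onI)
  have h: "0 < h n" and hT: "real (Suc n) * h n = T" for n using T by (auto simp: h_def)
  have B0: "0 \<le> B" using f(2)[of 0] by linarith
  have sc: "0 < scale r" if "0 < r" for r using that by (rule scale_pos)
  have scmono: "scale \<epsilon> \<le> scale r" if "\<epsilon> \<le> r" for r unfolding scale_def using that e \<alpha> by (intro powr_mono2) auto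
  have Rb: "\<bar>slope (scale r) g z w\<bar> \<le> K / scale \<epsilon>" if "\<epsilon> \<le> r" for r z w
  proof -
    have "\<bar>slope (scale r) g z w\<bar> \<le> K / scale r" using slope_abs_le[OF gm g(2) sc, of r z w] that e by simp
    also have "\<dots> \<le> K / scale \<epsilon>" using scmono[OF that] sc[OF e] K_ge by (intro divide_left_mono mult_pos_pos) auto
    finally show ?thesis .
  qed
  define c where "c n i = slope (scale (\<epsilon> + real (n - i) * h n)) g (y (real (Suc i) * h n)) (d n i)" for n i
  define \<Phi> where "\<Phi> n s = f s * c n (min (nat \<lfloor>s / h n\<rfloor>) n)" for n s
  have cb: "\<bar>c n i\<bar> \<le> K / scale \<epsilon>" for n i
    unfolding c_def by (rule Rb) (use h[of n] in simp)
  have Seq: "S n = (\<Sum>i<Suc n. d n i * c n i)" for n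
    unfolding S_def c_def P_def
    by (intro sum.cong refl scaled_mean_diff[OF gm g(2)] sc) (use e h[of n] in \<open>simp add: add_pos_nonneg\<close>)
  have \<Phi>i: "(\<Phi> n has_integral S n) {0..T}" for n
    unfolding Seq \<Phi>_def d_def using step_has_integral[OF h, of f n n "c n"] f(1) hT[of n] by simp
  have \<Phi>b: "norm (\<Phi> n s) \<le> B * (K / scale \<epsilon>)" for n s
    unfolding \<Phi>_def real_norm_def abs_mult using f(2) cb B0 by (intro mult_mono) auto
  have lim: "(\<lambda>n. \<Phi> n s) \<longlonglongrightarrow> G s" if s: "s \<in> {0..T}" for s
  proof -
    define k where "k n = min (nat \<lfloor>s / h n\<rfloor>) n" for n
    have hn: "h n = T / real (Suc n)" for n by (simp add: h_def)
    note gb = grid_bracket[OF T s hn k_def]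
    note kb = gb(2,3,1) and s1 = gb(5)
    have h0: "h \<longlonglongrightarrow> 0" unfolding h_def using LIMSEQ_Suc[OF lim_const_over_n[of T]] by simp
    have yl: "(\<lambda>n. y (real (Suc (k n)) * h n)) \<longlonglongrightarrow> y s"
      by (rule right_continuous_seq[OF y]) (use s kb(2) s1 in auto)
    have rl: "(\<lambda>n. scale (\<epsilon> + real (n - k n) * h n)) \<longlonglongrightarrow> scale (\<epsilon> + T - s)"
    proof -
      have eq: "\<epsilon> + real (n - k n) * h n = \<epsilon> + T - real (Suc (k n)) * h n" for n
        using kb(3)[of n] hT[of n] by (simp add: of_nat_diff algebra_simps)
      have "(\<lambda>n. \<epsilon> + T - real (Suc (k n)) * h n) \<longlonglongrightarrow> \<epsilon> + T - s" by (intro tendsto_intros s1)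
      then show ?thesis unfolding eq scale_def using s e by (intro tendsto_powr tendsto_const) auto
    qed
    have dl: "(\<lambda>n. d n (k n)) \<longlonglongrightarrow> 0"
    proof (rule Lim_null_comparison)
      show "\<forall>\<^sub>F n in sequentially. norm (d n (k n)) \<le> B * h n"
      proof (intro always_eventually allI)
        fix n
        have le: "0 \<le> real (k n) * h n" "real (k n) * h n \<le> real (Suc (k n)) * h n" "real (Suc (k n)) * h n \<le> real (Suc n) * h n"
          using h[of n] kb(3)[of n] by (auto intro!: mult_right_mono)
        have "f integrable_on {real (k n) * h n..real (Suc (k n)) * h n}"
          by (rule integrable_on_subinterval[OF f(1)]) (use le hT[of n] in auto)
        from integral_increment_bound[OF le(2) this f(2)]
        show "norm (d n (k n)) \<le> B * h n" unfolding d_def by (simp add: algebra_simps)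
      qed
      show "(\<lambda>n. B * h n) \<longlonglongrightarrow> 0" using tendsto_mult[OF tendsto_const h0, of B] by simp
    qed
    have "(\<lambda>n. c n (k n)) \<longlonglongrightarrow> slope (scale (\<epsilon> + T - s)) g (y s) 0"
      unfolding c_def by (rule slope_tendsto[OF g sc rl yl dl]) (use s e in auto)
    then show ?thesis unfolding \<Phi>_def G_def k_def by (intro tendsto_mult tendsto_const)
  qed
  have dc: "G integrable_on {0..T} \<and> (\<lambda>n. integral {0..T} (\<Phi> n)) \<longlonglongrightarrow> integral {0..T} G"
    using dominated_convergence[of \<Phi> "{0..T}" "\<lambda>_. B * (K / scale \<epsilon>)" G] \<Phi>i \<Phi>b lim
    by (auto simp: has_integral_integrable)
  have eqS: "integral {0..T} (\<Phi> n) = S n" for n using \<Phi>i by (rule integral_unique)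
  show "G integrable_on {0..T}" "S \<longlonglongrightarrow> integral {0..T} G" using dc unfolding eqS by auto
  show "\<bar>S n\<bar> \<le> B * (K / scale \<epsilon>) * T"
    using has_integral_bound_real[OF _ _ \<Phi>i[of n], of "B * (K / scale \<epsilon>)" "{}"] \<Phi>b B0 K_ge sc[OF e] T
    by auto
qed

text \<open>The equation with a bounded Borel drift in mind. For such a drift, right-continuous
  paths make the integrand bounded and measurable, so the Henstock-Kurzweil integral agrees with the
  Lebesgue integral and exists on every interval.\<close>
definition solves :: "(real \<Rightarrow> real) \<Rightarrow> real \<Rightarrow> (real \<Rightarrow> 'w \<Rightarrow> real) \<Rightarrow> bool" where
  "solves b x X \<longleftrightarrow> (\<forall>t\<ge>0. X t \<in> borel_measurable (F t)) \<and>
     (AE \<omega> in M. \<forall>t\<ge>0. X t \<omega> = x + integral {0..t} (\<lambda>s. b (X s \<omega>)) + Z t \<omega>) \<and>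
     (AE \<omega> in M. \<forall>t\<ge>0. continuous (at_right t) (\<lambda>t. X t \<omega>))"

text \<open>The event on which a path solves the equation may fail to be measurable; it contains a
  measurable event of probability \<open>1\<close>.\<close>
lemma solves_good_set:
  assumes "solves b x X"
  obtains A where "A \<in> sets M" "prob A = 1" "\<And>\<omega> t. \<omega> \<in> A \<Longrightarrow> 0 \<le> t \<Longrightarrow> continuous (at_right t) (\<lambda>t. X t \<omega>)"
    "\<And>\<omega> t. \<omega> \<in> A \<Longrightarrow> 0 \<le> t \<Longrightarrow> X t \<omega> = x + integral {0..t} (\<lambda>s. b (X s \<omega>)) + Z t \<omega>"
proof -
  have "AE \<omega> in M. (\<forall>t\<ge>0. X t \<omega> = x + integral {0..t} (\<lambda>s. b (X s \<omega>)) + Z t \<omega>) \<and> (\<forall>t\<ge>0. continuous (at_right t) (\<lambda>t. X t \<omega>))"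
    using assms unfolding solves_def by auto
  then obtain N where N: "{\<omega>\<in>space M. \<not> ((\<forall>t\<ge>0. X t \<omega> = x + integral {0..t} (\<lambda>s. b (X s \<omega>)) + Z t \<omega>) \<and> (\<forall>t\<ge>0. continuous (at_right t) (\<lambda>t. X t \<omega>)))} \<subseteq> N"
      "emeasure M N = 0" "N \<in> sets M" by (rule AE_E)
  have "prob (space M - N) = 1" using N prob_compl[of N] by (simp add: emeasure_eq_measure)
  then show ?thesis using N by (intro that[of "space M - N"]) blast+
qed

lemma AE_good: "A \<in> sets M \<Longrightarrow> prob A = 1 \<Longrightarrow> AE \<omega> in M. \<omega> \<in> A"
  using prob_eq_1 by blast

text \<open>The limit of the discrete formula as the grid is refined. It takes the place of Ito's
  formula, with the advantage that no generator and no second derivative appear: the noise is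
  handled exactly by the semigroup on each grid interval, and only the drift is expanded.\<close>
lemma duhamel:
  assumes X: "solves b x X" and b[measurable]: "b \<in> borel_measurable borel" and bB: "\<And>z. \<bar>b z\<bar> \<le> B"
    and T: "0 < T" and e: "0 < \<epsilon>" and g: "continuous_on UNIV g" "\<And>y. \<bar>g y\<bar> \<le> 1"
  defines "\<phi> \<equiv> \<lambda>s. expectation (\<lambda>\<omega>. b (X s \<omega>) * slope (scale (\<epsilon> + T - s)) g (X s \<omega>) 0)"
  shows "\<phi> integrable_on {0..T}"
    and "expectation (\<lambda>\<omega>. P \<epsilon> g (X T \<omega>)) = expectation (\<lambda>\<omega>. P (\<epsilon> + T) g (x + Z 0 \<omega>)) + integral {0..T} \<phi>"
proof -
  have gm[measurable]: "g \<in> borel_measurable borel" using g(1) by (rule borel_measurable_continuous_onI)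
  obtain A where A[measurable]: "A \<in> sets M" and A1: "prob A = 1"
    and right: "\<And>\<omega> t. \<omega> \<in> A \<Longrightarrow> 0 \<le> t \<Longrightarrow> continuous (at_right t) (\<lambda>t. X t \<omega>)"
    and eq: "\<And>\<omega> t. \<omega> \<in> A \<Longrightarrow> 0 \<le> t \<Longrightarrow> X t \<omega> = x + integral {0..t} (\<lambda>s. b (X s \<omega>)) + Z t \<omega>"
    using solves_good_set[OF X] by blast
  note AEA = AE_good[OF A A1]
  have XF: "X t \<in> borel_measurable (F t)" if "0 \<le> t" for t using X that by (simp add: solves_def)
  have Xm[measurable]: "X t \<in> borel_measurable M" if "0 \<le> t" for t using F_M_measurable[OF XF[OF that] that] .
  define Y where "Y t \<omega> = (if \<omega> \<in> A \<and> 0 \<le> t then X t \<omega> else 0)" for t \<omega>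
  have [measurable]: "(\<lambda>(t, \<omega>). Y t \<omega>) \<in> borel_measurable (lborel \<Otimes>\<^sub>M M)"
    unfolding Y_def using Xm right by (intro joint_measurable A) auto
  have fi: "(\<lambda>s. b (X s \<omega>)) integrable_on {0..t}" if "\<omega> \<in> A" for t \<omega>
    by (rule drift_integrable[of "\<lambda>t. X t \<omega>" b B]) (use right that bB in auto)
  have B0: "0 \<le> B" using bB[of 0] by linarith
  define h where "h n = T / real (Suc n)" for n
  have h: "0 < h n" and hT: "real (Suc n) * h n = T" for n using T by (auto simp: h_def)
  define d where "d n i \<omega> = X (real (Suc i) * h n) \<omega> - X (real i * h n) \<omega> - (Z (real (Suc i) * h n) \<omega> - Z (real i * h n) \<omega>)" for n i \<omega>
  define S where "S n \<omega> = (\<Sum>i<Suc n. P (\<epsilon> + real (n - i) * h n) g (X (real (Suc i) * h n) \<omega>)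
      - P (\<epsilon> + real (n - i) * h n) g (X (real (Suc i) * h n) \<omega> - d n i \<omega>))" for n \<omega>
  have pos: "0 \<le> real i * h n" for i n using h[of n] by simp
  have [measurable]: "X (real i * h n) \<in> borel_measurable M" "Z (real i * h n) \<in> borel_measurable M" for i n using pos by auto
  have [measurable]: "d n i \<in> borel_measurable M" for n i unfolding d_def by measurable
  have [measurable]: "S n \<in> borel_measurable M" for n unfolding S_def by measurable
  have dA: "d n i \<omega> = integral {real i * h n..real (Suc i) * h n} (\<lambda>s. b (X s \<omega>))" if "\<omega> \<in> A" for n i \<omega>
  proof -
    have le: "real i * h n \<le> real (Suc i) * h n" using h[of n] by (intro mult_right_mono) auto
    show ?thesis unfolding d_def eq[OF that pos]
      using integral_increment[OF pos le fi[OF that]] by simp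
  qed
  define G where "G \<omega> s = b (Y s \<omega>) * slope (scale (\<epsilon> + T - s)) g (Y s \<omega>) 0" for \<omega> s
  have SA: "S n \<omega> = (\<Sum>i<Suc n. P (\<epsilon> + real (n - i) * (T / real (Suc n))) g (X (real (Suc i) * (T / real (Suc n))) \<omega>)
      - P (\<epsilon> + real (n - i) * (T / real (Suc n))) g (X (real (Suc i) * (T / real (Suc n))) \<omega> - integral {real i * (T / real (Suc n))..real (Suc i) * (T / real (Suc n))} (\<lambda>s. b (X s \<omega>))))" if "\<omega> \<in> A" for n \<omega>
    unfolding S_def dA[OF that] h_def ..
  have path: "(\<lambda>n. S n \<omega>) \<longlonglongrightarrow> integral {0..T} (G \<omega>)" "\<bar>S n \<omega>\<bar> \<le> B * (K / scale \<epsilon>) * T" if w: "\<omega> \<in> A" for \<omega> n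
  proof -
    have "integral {0..T} (G \<omega>) = integral {0..T} (\<lambda>s. b (X s \<omega>) * slope (scale (\<epsilon> + T - s)) g (X s \<omega>) 0)"
      by (rule integral_cong) (use w in \<open>auto simp: G_def Y_def\<close>)
    with drift_sum_tendsto(2,3)[OF T e right[OF w] fi[OF w] bB g] show "(\<lambda>n. S n \<omega>) \<longlonglongrightarrow> integral {0..T} (G \<omega>)" "\<bar>S n \<omega>\<bar> \<le> B * (K / scale \<epsilon>) * T"
      unfolding SA[OF w] by auto
  qed
  interpret pair: pair_sigma_finite lborel M ..
  have Gm: "(\<lambda>(s, \<omega>). indicator {0..T} s * G \<omega> s) \<in> borel_measurable (lborel \<Otimes>\<^sub>M M)"
    unfolding G_def slope_def scale_def by measurable
  have Gb: "\<bar>indicator {0..T} s * G \<omega> s\<bar> \<le> B * (K / scale \<epsilon>) * indicator {0..T} s" for s \<omega>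
  proof (cases "s \<in> {0..T}")
    case True
    have "\<bar>slope (scale (\<epsilon> + T - s)) g (Y s \<omega>) 0\<bar> \<le> K / scale (\<epsilon> + T - s)"
      using True e by (intro slope_abs_le gm g scale_pos) auto
    also have "\<dots> \<le> K / scale \<epsilon>" unfolding scale_def
      using True e \<alpha> K_ge by (intro divide_left_mono mult_pos_pos powr_mono2) auto
    finally have "\<bar>G \<omega> s\<bar> \<le> B * (K / scale \<epsilon>)" unfolding G_def abs_mult using bB B0 by (intro mult_mono) auto
    then show ?thesis using True by simp
  qed simp
  have Gi: "integrable (lborel \<Otimes>\<^sub>M M) (\<lambda>(s, \<omega>). indicator {0..T} s * G \<omega> s)"
  proof (rule Bochner_Integration.integrable_bound[OF _ Gm])
    have "integrable (lborel \<Otimes>\<^sub>M M) (indicator ({0..T} \<times> space M) :: real \<times> 'w \<Rightarrow> real)"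
      by (rule integrable_real_indicator) (auto simp: emeasure_pair_measure_Times emeasure_space_1 emeasure_lborel_Icc_eq)
    then show "integrable (lborel \<Otimes>\<^sub>M M) (\<lambda>z. B * (K / scale \<epsilon>) * indicator ({0..T} \<times> space M) z)" by simp
    show "AE z in (lborel :: real measure) \<Otimes>\<^sub>M M. norm (case z of (s, \<omega>) \<Rightarrow> indicator {0..T} s * G \<omega> s) \<le> norm (B * (K / scale \<epsilon>) * indicator ({0..T} \<times> space M) z)"
    proof (rule AE_I2)
      fix z :: "real \<times> 'w" assume z: "z \<in> space (lborel \<Otimes>\<^sub>M M)"
      obtain s \<omega> where zs: "z = (s, \<omega>)" by (cases z)
      have ind: "indicator ({0..T} \<times> space M) z = (indicator {0..T} s :: real)"
        using z by (simp add: zs space_pair_measure indicator_def)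
      show "norm (case z of (s, \<omega>) \<Rightarrow> indicator {0..T} s * G \<omega> s) \<le> norm (B * (K / scale \<epsilon>) * indicator ({0..T} \<times> space M) z)"
        unfolding ind unfolding zs prod.case real_norm_def by (rule order_trans[OF Gb abs_ge_self])
    qed
  qed
  have [measurable]: "(\<lambda>y. slope \<sigma> g y 0) \<in> borel_measurable borel" for \<sigma> unfolding slope_def by measurable
  have \<phi>eq: "expectation (G' s) = \<phi> s" if "\<And>\<omega>. G' s \<omega> = G \<omega> s" "0 \<le> s" for G' s
    unfolding \<phi>_def
  proof (rule integral_cong_AE)
    have [measurable]: "X s \<in> borel_measurable M" "Y s \<in> borel_measurable M" using that(2) unfolding Y_def by measurable
    have "G' s = (\<lambda>\<omega>. G \<omega> s)" using that(1) by blast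
    then show "G' s \<in> borel_measurable M" unfolding G_def by simp
    show "(\<lambda>\<omega>. b (X s \<omega>) * slope (scale (\<epsilon> + T - s)) g (X s \<omega>) 0) \<in> borel_measurable M"
      by measurable
    show "AE \<omega> in M. G' s \<omega> = b (X s \<omega>) * slope (scale (\<epsilon> + T - s)) g (X s \<omega>) 0"
      using AEA by eventually_elim (use that in \<open>simp add: G_def Y_def\<close>)
  qed
  have i1: "integrable lborel (\<lambda>s. expectation (\<lambda>\<omega>. indicator {0..T} s * G \<omega> s))"
    using pair.integrable_fst'[OF Gi] by (simp add: case_prod_beta')
  have \<phi>ind: "expectation (\<lambda>\<omega>. indicator {0..T} s * G \<omega> s) = indicator {0..T} s * \<phi> s" for s
    using \<phi>eq[of "\<lambda>s \<omega>. G \<omega> s" s] by (cases "s \<in> {0..T}") auto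
  have \<phi>i: "set_integrable lborel {0..T} \<phi>" using i1 unfolding \<phi>ind set_integrable_def by simp
  then show "\<phi> integrable_on {0..T}" using set_borel_integral_eq_integral(1) by blast
  have fub: "expectation (\<lambda>\<omega>. \<integral>s. indicator {0..T} s * G \<omega> s \<partial>lborel) = integral {0..T} \<phi>"
    using pair.Fubini_integral[OF Gi] set_borel_integral_eq_integral(2)[OF \<phi>i]
    unfolding \<phi>ind set_lebesgue_integral_def by simp
  have pathL: "(\<integral>s. indicator {0..T} s * G \<omega> s \<partial>lborel) = integral {0..T} (G \<omega>)" if "\<omega> \<in> space M" for \<omega>
  proof -
    have Lm: "(\<lambda>s. indicator {0..T} s * G \<omega> s) \<in> borel_measurable lborel" using measurable_Pair1[OF Gm that] by simp
    have "set_integrable lborel {0..T} (G \<omega>)" unfolding set_integrable_def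
    proof (rule integrable_dominated)
      show "integrable lborel (\<lambda>s. B * (K / scale \<epsilon>) * indicator {0..T} s)"
        by (intro integrable_mult_right integrable_real_indicator) (auto simp: emeasure_lborel_Icc_eq)
      show "\<bar>indicator {0..T} s *\<^sub>R G \<omega> s\<bar> \<le> B * (K / scale \<epsilon>) * indicator {0..T} s" for s
        unfolding real_scaleR_def by (rule Gb)
    qed (use Lm in simp)
    from set_borel_integral_eq_integral(2)[OF this] show ?thesis by (simp add: set_lebesgue_integral_def)
  qed
  have "(\<lambda>n. expectation (S n)) \<longlonglongrightarrow> expectation (\<lambda>\<omega>. \<integral>s. indicator {0..T} s * G \<omega> s \<partial>lborel)"
  proof (rule integral_dominated_convergence[where w="\<lambda>_. B * (K / scale \<epsilon>) * T"])
    show "(\<lambda>\<omega>. \<integral>s. indicator {0..T} s * G \<omega> s \<partial>lborel) \<in> borel_measurable M"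
      using borel_measurable_integrable[OF pair.integrable_snd[OF Gi]] by simp
    show "AE \<omega> in M. (\<lambda>n. S n \<omega>) \<longlonglongrightarrow> (\<integral>s. indicator {0..T} s * G \<omega> s \<partial>lborel)"
      using AEA AE_space by eventually_elim (simp add: pathL path)
    show "AE \<omega> in M. norm (S n \<omega>) \<le> B * (K / scale \<epsilon>) * T" for n
      using AEA by eventually_elim (simp only: real_norm_def path(2))
  qed auto
  moreover have "expectation (S n) = expectation (\<lambda>\<omega>. P \<epsilon> g (X T \<omega>)) - expectation (\<lambda>\<omega>. P (\<epsilon> + T) g (x + Z 0 \<omega>))" for n
  proof -
    have Pint: "integrable M (\<lambda>\<omega>. P r g (f \<omega>))" if "f \<in> borel_measurable M" for f r
      by (rule integrable_bounded[where B=1]) (use that P_abs_le[OF gm g(2)] in auto)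
    have "expectation (\<lambda>\<omega>. P \<epsilon> g (X (real (Suc n) * h n) \<omega>)) = expectation (\<lambda>\<omega>. P (\<epsilon> + real (Suc n) * h n) g (X (real 0 * h n) \<omega>)) +
      (\<Sum>i<Suc n. expectation (\<lambda>\<omega>. P (\<epsilon> + real (Suc n - Suc i) * h n) g (X (real (Suc i) * h n) \<omega>)
        - P (\<epsilon> + real (Suc n - Suc i) * h n) g (X (real (Suc i) * h n) \<omega> - d n i \<omega>)))"
      unfolding d_def
      by (rule grid_telescope[OF h, of "\<lambda>i. X (real i * h n)" n g \<epsilon> "Suc n"]) (use XF pos gm g e in auto)
    also have "(\<Sum>i<Suc n. expectation (\<lambda>\<omega>. P (\<epsilon> + real (Suc n - Suc i) * h n) g (X (real (Suc i) * h n) \<omega>)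
        - P (\<epsilon> + real (Suc n - Suc i) * h n) g (X (real (Suc i) * h n) \<omega> - d n i \<omega>))) = expectation (S n)"
      unfolding S_def diff_Suc_Suc
      by (rule Bochner_Integration.integral_sum[symmetric]) (intro Bochner_Integration.integrable_diff Pint; measurable)
    also have "expectation (\<lambda>\<omega>. P (\<epsilon> + real (Suc n) * h n) g (X (real 0 * h n) \<omega>)) = expectation (\<lambda>\<omega>. P (\<epsilon> + T) g (x + Z 0 \<omega>))"
      unfolding hT
    proof (rule integral_cong_AE)
      have "Z 0 \<in> borel_measurable M" "X 0 \<in> borel_measurable M" by auto
      then show "(\<lambda>\<omega>. P (\<epsilon> + T) g (X (real 0 * h n) \<omega>)) \<in> borel_measurable M" "(\<lambda>\<omega>. P (\<epsilon> + T) g (x + Z 0 \<omega>)) \<in> borel_measurable M"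
        by measurable
      show "AE \<omega> in M. P (\<epsilon> + T) g (X (real 0 * h n) \<omega>) = P (\<epsilon> + T) g (x + Z 0 \<omega>)"
        using AEA by eventually_elim (simp add: eq)
    qed
    finally show ?thesis unfolding hT by simp
  qed
  ultimately have "expectation (\<lambda>\<omega>. P \<epsilon> g (X T \<omega>)) - expectation (\<lambda>\<omega>. P (\<epsilon> + T) g (x + Z 0 \<omega>)) = expectation (\<lambda>\<omega>. \<integral>s. indicator {0..T} s * G \<omega> s \<partial>lborel)"
    using LIMSEQ_unique[OF tendsto_const] by simp
  then show "expectation (\<lambda>\<omega>. P \<epsilon> g (X T \<omega>)) = expectation (\<lambda>\<omega>. P (\<epsilon> + T) g (x + Z 0 \<omega>)) + integral {0..T} \<phi>"
    unfolding fub by simp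
qed

end

section \<open>Uniqueness of one-dimensional laws\<close>

lemma continuous_approximation:
  fixes f :: "real \<Rightarrow> real"
  assumes "f \<in> borel_measurable lebesgue" "AE z in lebesgue. \<bar>f z\<bar> \<le> B" "0 \<le> B"
  obtains \<phi> :: "nat \<Rightarrow> real \<Rightarrow> real" and N where "\<And>n. continuous_on UNIV (\<phi> n)" "\<And>n z. \<bar>\<phi> n z\<bar> \<le> B"
    "N \<in> null_sets lborel" "\<And>z. z \<notin> N \<Longrightarrow> (\<lambda>n. \<phi> n z) \<longlonglongrightarrow> f z" "\<And>z. z \<notin> N \<Longrightarrow> \<bar>f z\<bar> \<le> B"
proof -
  have "f measurable_on UNIV"
    using assms(1) by (subst measurable_on_iff_borel_measurable) auto
  then obtain N0 g where g: "negligible N0" "\<And>n. continuous_on UNIV (g n)" "\<And>z. z \<notin> N0 \<Longrightarrow> (\<lambda>n. g n z) \<longlonglongrightarrow> f z"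
    unfolding measurable_on_def by auto
  from assms(2) obtain N1 where "{z \<in> space lebesgue. \<not> \<bar>f z\<bar> \<le> B} \<subseteq> N1" "emeasure lebesgue N1 = 0" "N1 \<in> sets lebesgue"
    by (rule AE_E)
  then have N1: "N1 \<in> null_sets lebesgue" "{z. \<not> \<bar>f z\<bar> \<le> B} \<subseteq> N1" by (auto intro: null_setsI)
  have "N0 \<union> N1 \<in> null_sets lebesgue" using g(1) N1 by (auto simp: negligible_iff_null_sets)
  then obtain N where N: "N \<in> null_sets lborel" "N0 \<union> N1 \<subseteq> N" by (auto simp: null_sets_completion_iff2)
  show ?thesis
  proof (rule that[of "\<lambda>n z. max (- B) (min B (g n z))" N])
    show "continuous_on UNIV (\<lambda>z. max (- B) (min B (g n z)))" for n by (intro continuous_intros g)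
    show "\<bar>max (- B) (min B (g n z))\<bar> \<le> B" for n z using assms(3) by auto
    show fb: "\<bar>f z\<bar> \<le> B" if "z \<notin> N" for z using that N N1 by auto
    show "(\<lambda>n. max (- B) (min B (g n z))) \<longlonglongrightarrow> f z" if "z \<notin> N" for z
    proof -
      have "(\<lambda>n. max (- B) (min B (g n z))) \<longlonglongrightarrow> max (- B) (min B (f z))"
        by (intro tendsto_intros g(3)) (use that N in auto)
      then show ?thesis using fb[OF that] by (simp add: abs_le_iff min_def max_def split: if_splits)
    qed
  qed fact
qed

text \<open>An exponential weight makes the integral operator with kernel \<open>u powr -
  \<beta>\<close> a contraction on an interval of any prescribed length.\<close>
lemma powr_exp_integral_small:
  fixes \<beta> T \<eta> :: real
  assumes \<beta>: "0 < \<beta>" "\<beta> < 1" and T: "0 \<le> T" and \<eta>: "0 < \<eta>"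
  obtains l where "0 \<le> l" "\<And>t. t \<in> {0..T} \<Longrightarrow> (\<lambda>u. u powr - \<beta> * exp (- (l * u))) integrable_on {0..t}"
    "\<And>t. t \<in> {0..T} \<Longrightarrow> integral {0..t} (\<lambda>u. u powr - \<beta> * exp (- (l * u))) \<le> \<eta>"
proof -
  have dom: "(\<lambda>u. u powr - \<beta>) integrable_on {0..t}" if "0 \<le> t" for t
    using has_integral_powr_from_0[of "- \<beta>" t] \<beta> that by (auto simp: has_integral_integrable)
  have int: "(\<lambda>u. u powr - \<beta> * exp (- (l * u))) integrable_on {0..t}" if "0 \<le> l" "0 \<le> t" for l t
  proof (rule measurable_bounded_by_integrable_imp_integrable[OF _ dom[OF that(2)]])
    have "(\<lambda>u. u powr - \<beta> * exp (- (l * u))) \<in> borel_measurable borel" by measurable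
    then show "(\<lambda>u. u powr - \<beta> * exp (- (l * u))) \<in> borel_measurable (lebesgue_on {0..t})"
      by (intro measurable_restrict_space1 measurable_completion) simp
    show "norm (u powr - \<beta> * exp (- (l * u))) \<le> u powr - \<beta>" if "u \<in> {0..t}" for u
      using that \<open>0 \<le> l\<close> by (auto simp: abs_mult intro!: mult_left_le)
  qed simp
  have "(\<lambda>n. integral {0..T} (\<lambda>u. u powr - \<beta> * exp (- (real n * u)))) \<longlonglongrightarrow> integral {0..T} (\<lambda>u. 0)"
  proof (rule dominated_convergence(2)[OF int[of "real _"] dom])
    show "norm (u powr - \<beta> * exp (- (real n * u))) \<le> u powr - \<beta>" if "u \<in> {0..T}" for u n
      using that by (auto simp: abs_mult intro!: mult_left_le)
    show "(\<lambda>n. u powr - \<beta> * exp (- (real n * u))) \<longlonglongrightarrow> 0" if "u \<in> {0..T}" for u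
    proof (cases "u = 0")
      case False
      then have u: "0 < u" using that by auto
      have "(\<lambda>n. (exp (- u)) ^ n) \<longlonglongrightarrow> 0" by (rule LIMSEQ_power_zero) (use u in simp)
      then have "(\<lambda>n. exp (- (real n * u))) \<longlonglongrightarrow> 0" by (simp add: exp_of_nat_mult[symmetric])
      then have "(\<lambda>n. u powr - \<beta> * exp (- (real n * u))) \<longlonglongrightarrow> u powr - \<beta> * 0" by (intro tendsto_mult tendsto_const)
      then show ?thesis by simp
    qed simp
  qed (use T in auto)
  then have "\<forall>\<^sub>F n in sequentially. integral {0..T} (\<lambda>u. u powr - \<beta> * exp (- (real n * u))) < \<eta>"
    using \<eta> by (auto dest: order_tendstoD)
  then obtain n where n: "integral {0..T} (\<lambda>u. u powr - \<beta> * exp (- (real n * u))) < \<eta>"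
    unfolding eventually_sequentially by blast
  show ?thesis
  proof (rule that[of "real n"])
    fix t assume t: "t \<in> {0..T}"
    show "(\<lambda>u. u powr - \<beta> * exp (- (real n * u))) integrable_on {0..t}" using int t by simp
    have "integral {0..t} (\<lambda>u. u powr - \<beta> * exp (- (real n * u))) \<le> integral {0..T} (\<lambda>u. u powr - \<beta> * exp (- (real n * u)))"
      using t T by (intro integral_subset_le int) auto
    then show "integral {0..t} (\<lambda>u. u powr - \<beta> * exp (- (real n * u))) \<le> \<eta>" using n by simp
  qed simp
qed

context stable_noise begin

lemma solves_measurable: "solves b x X \<Longrightarrow> 0 \<le> t \<Longrightarrow> X t \<in> borel_measurable M"
  unfolding solves_def using F_M_measurable by blast

text \<open>Stated for a Lipschitz path \<open>X - Z\<close> and not for solutions, because it is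
  also needed for a limit of solutions before that limit is known to solve an equation.\<close>
lemma lipschitz_drift_occupation:
  fixes X :: "real \<Rightarrow> 'w \<Rightarrow> real"
  assumes T: "0 < T" and X: "\<And>t. 0 \<le> t \<Longrightarrow> X t \<in> borel_measurable (F t)" and B: "0 \<le> B"
    and A: "A \<in> sets M"
    and right: "\<And>\<omega> t. \<omega> \<in> A \<Longrightarrow> 0 \<le> t \<Longrightarrow> continuous (at_right t) (\<lambda>t. X t \<omega>)"
    and lip: "\<And>\<omega> s t. \<omega> \<in> A \<Longrightarrow> 0 \<le> s \<Longrightarrow> s \<le> t \<Longrightarrow> \<bar>(X t \<omega> - Z t \<omega>) - (X s \<omega> - Z s \<omega>)\<bar> \<le> B * (t - s)"
  shows "open U \<Longrightarrow> emeasure lborel U = ennreal m \<Longrightarrow> 0 \<le> m \<Longrightarrow>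
     (\<integral>\<^sup>+\<omega>. indicator A \<omega> * (\<integral>\<^sup>+t. indicator {0<..<T} t * indicator U (X t \<omega>) \<partial>lborel) \<partial>M) \<le> ennreal (occ_const T * m powr \<theta> * (1 + B * T))"
    and "N \<in> null_sets lebesgue \<Longrightarrow> AE \<omega> in M. \<omega> \<in> A \<longrightarrow> (AE t in lborel. 0 < t \<and> t < T \<longrightarrow> X t \<omega> \<notin> N)"
proof -
  have v: "0 \<le> B * T" using B T by simp
  have cont: "continuous_on {0..T} (\<lambda>t. X t \<omega> - Z t \<omega>)" if "\<omega> \<in> A" for \<omega>
  proof (rule lipschitz_on_continuous_on[of B], rule lipschitz_onI)
    fix s t assume "s \<in> {0..T}" "t \<in> {0..T}"
    then show "dist (X s \<omega> - Z s \<omega>) (X t \<omega> - Z t \<omega>) \<le> B * dist s t"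
      using lip[OF that, of s t] lip[OF that, of t s] by (cases "s \<le> t") (auto simp: dist_real_def abs_minus_commute)
  qed (rule B)
  have var: "(\<Sum>i<n. \<bar>(X (real (Suc i) * (T / real n)) \<omega> - Z (real (Suc i) * (T / real n)) \<omega>)
        - (X (real i * (T / real n)) \<omega> - Z (real i * (T / real n)) \<omega>)\<bar>) \<le> B * T" if "\<omega> \<in> A" "0 < n" for \<omega> n
  proof -
    have h: "0 \<le> T / real n" using T by simp
    have "(\<Sum>i<n. \<bar>(X (real (Suc i) * (T / real n)) \<omega> - Z (real (Suc i) * (T / real n)) \<omega>)
        - (X (real i * (T / real n)) \<omega> - Z (real i * (T / real n)) \<omega>)\<bar>) \<le> (\<Sum>i<n. B * (T / real n))"
    proof (rule sum_mono)
      fix i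
      have "real i * (T / real n) \<le> real (Suc i) * (T / real n)" "0 \<le> real i * (T / real n)"
        using h by (auto intro!: mult_right_mono simp del: times_divide_eq_right)
      from lip[OF that(1) this(2,1)]
      have "\<bar>(X (real (Suc i) * (T / real n)) \<omega> - Z (real (Suc i) * (T / real n)) \<omega>) - (X (real i * (T / real n)) \<omega> - Z (real i * (T / real n)) \<omega>)\<bar>
        \<le> B * (real (Suc i) * (T / real n) - real i * (T / real n))" .
      also have "real (Suc i) * (T / real n) - real i * (T / real n) = T / real n"
        by (simp add: left_diff_distrib[symmetric] del: times_divide_eq_right)
      finally show "\<bar>(X (real (Suc i) * (T / real n)) \<omega> - Z (real (Suc i) * (T / real n)) \<omega>) - (X (real i * (T / real n)) \<omega> - Z (real i * (T / real n)) \<omega>)\<bar> \<le> B * (T / real n)" .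
    qed
    also have "\<dots> = B * T" using that(2) by simp
    finally show ?thesis .
  qed
  show "open U \<Longrightarrow> emeasure lborel U = ennreal m \<Longrightarrow> 0 \<le> m \<Longrightarrow>
     (\<integral>\<^sup>+\<omega>. indicator A \<omega> * (\<integral>\<^sup>+t. indicator {0<..<T} t * indicator U (X t \<omega>) \<partial>lborel) \<partial>M) \<le> ennreal (occ_const T * m powr \<theta> * (1 + B * T))"
    by (rule occupation_bound[OF T X _ _ _ v A right cont var])
  show "N \<in> null_sets lebesgue \<Longrightarrow> AE \<omega> in M. \<omega> \<in> A \<longrightarrow> (AE t in lborel. 0 < t \<and> t < T \<longrightarrow> X t \<omega> \<notin> N)"
    by (rule occupation_null[OF T X _ v A right cont var])
qed

lemma solves_lipschitz:
  assumes "\<And>t. 0 \<le> t \<Longrightarrow> continuous (at_right t) (\<lambda>t. X t \<omega>)"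
    and "\<And>t. 0 \<le> t \<Longrightarrow> X t \<omega> = x + integral {0..t} (\<lambda>s. b (X s \<omega>)) + Z t \<omega>"
    and "b \<in> borel_measurable borel" "\<And>z. \<bar>b z\<bar> \<le> B" "0 \<le> s" "s \<le> t"
  shows "\<bar>(X t \<omega> - Z t \<omega>) - (X s \<omega> - Z s \<omega>)\<bar> \<le> B * (t - s)"
proof -
  have i: "(\<lambda>s. b (X s \<omega>)) integrable_on {0..t}" "(\<lambda>s. b (X s \<omega>)) integrable_on {s..t}"
    using drift_integrable[of "\<lambda>t. X t \<omega>" b B] assms by auto
  have "(X t \<omega> - Z t \<omega>) - (X s \<omega> - Z s \<omega>) = integral {s..t} (\<lambda>s. b (X s \<omega>))"
    using assms(2)[of t] assms(2)[of s] integral_increment[OF assms(5,6) i(1)] assms(5,6) by simp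
  then show ?thesis using integral_increment_bound[OF assms(6) i(2), of B] assms(4) by simp
qed

lemma solves_avoids_null:
  assumes X: "solves b x X" and b: "b \<in> borel_measurable borel" "\<And>z. \<bar>b z\<bar> \<le> B" and N: "N \<in> null_sets lebesgue"
  shows "AE \<omega> in M. AE t in lborel. 0 < t \<longrightarrow> X t \<omega> \<notin> N"
proof -
  obtain A where A: "A \<in> sets M" "prob A = 1"
    and right: "\<And>\<omega> t. \<omega> \<in> A \<Longrightarrow> 0 \<le> t \<Longrightarrow> continuous (at_right t) (\<lambda>t. X t \<omega>)"
    and eq: "\<And>\<omega> t. \<omega> \<in> A \<Longrightarrow> 0 \<le> t \<Longrightarrow> X t \<omega> = x + integral {0..t} (\<lambda>s. b (X s \<omega>)) + Z t \<omega>"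
    using solves_good_set[OF X] by blast
  have B0: "0 \<le> B" using b(2)[of 0] by linarith
  have "AE \<omega> in M. \<omega> \<in> A \<longrightarrow> (AE t in lborel. 0 < t \<and> t < real (Suc n) \<longrightarrow> X t \<omega> \<notin> N)" for n
  proof (rule lipschitz_drift_occupation(2)[where B=B, OF _ _ B0 A(1) _ _ N])
    show "X t \<in> borel_measurable (F t)" if "0 \<le> t" for t using X that by (simp add: solves_def)
    show "\<bar>(X t \<omega> - Z t \<omega>) - (X s \<omega> - Z s \<omega>)\<bar> \<le> B * (t - s)" if "\<omega> \<in> A" "0 \<le> s" "s \<le> t" for \<omega> s t
      by (rule solves_lipschitz[where X=X and \<omega>=\<omega> and x=x and b=b and B=B]) (use right eq b that in auto)
  qed (use right in auto)
  then have "AE \<omega> in M. \<forall>n. \<omega> \<in> A \<longrightarrow> (AE t in lborel. 0 < t \<and> t < real (Suc n) \<longrightarrow> X t \<omega> \<notin> N)"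
    by (rule AE_all_countable[THEN iffD2, OF allI])
  with AE_good[OF A] show ?thesis
  proof eventually_elim
    case (elim \<omega>)
    then have "\<forall>n. AE t in lborel. 0 < t \<and> t < real (Suc n) \<longrightarrow> X t \<omega> \<notin> N" by blast
    then have "AE t in lborel. \<forall>n. 0 < t \<and> t < real (Suc n) \<longrightarrow> X t \<omega> \<notin> N" by (rule AE_all_countable[THEN iffD2])
    then show "AE t in lborel. 0 < t \<longrightarrow> X t \<omega> \<notin> N"
    proof eventually_elim
      case (elim t)
      obtain n where "t < real n" using reals_Archimedean2 by blast
      then have "t < real (Suc n)" by simp
      then show ?case using elim by blast
    qed
  qed
qed

text \<open>The order of the quantifiers is exchanged by Fubini's theorem, for use at a fixed
  time.\<close>
lemma solves_avoids_null':
  assumes X: "solves b x X" and b: "b \<in> borel_measurable borel" "\<And>z. \<bar>b z\<bar> \<le> B" and N: "N \<in> null_sets lborel"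
  shows "AE t in lborel. 0 < t \<longrightarrow> (AE \<omega> in M. X t \<omega> \<notin> N)"
proof -
  obtain A where A[measurable]: "A \<in> sets M" and A1: "prob A = 1"
    and right: "\<And>\<omega> t. \<omega> \<in> A \<Longrightarrow> 0 \<le> t \<Longrightarrow> continuous (at_right t) (\<lambda>t. X t \<omega>)"
    and "\<And>\<omega> t. \<omega> \<in> A \<Longrightarrow> 0 \<le> t \<Longrightarrow> X t \<omega> = x + integral {0..t} (\<lambda>s. b (X s \<omega>)) + Z t \<omega>"
    using solves_good_set[OF X] by blast
  have [measurable]: "N \<in> sets borel" using N by (auto simp: null_sets_def)
  have Nl: "N \<in> null_sets lebesgue" using N by (rule null_sets_completionI)
  define Y where "Y t \<omega> = (if \<omega> \<in> A \<and> 0 \<le> t then X t \<omega> else 0)" for t \<omega>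
  have [measurable]: "(\<lambda>(t, \<omega>). Y t \<omega>) \<in> borel_measurable (lborel \<Otimes>\<^sub>M M)"
    unfolding Y_def by (rule joint_measurable[OF solves_measurable[OF X] A right])
  interpret pair: pair_sigma_finite lborel M ..
  have "AE \<omega> in M. AE t in lborel. 0 < t \<longrightarrow> Y t \<omega> \<notin> N"
    using solves_avoids_null[OF X b Nl] AE_good[OF A A1]
  proof eventually_elim
    case (elim \<omega>)
    from elim(1) show ?case by eventually_elim (use elim(2) in \<open>auto simp: Y_def\<close>)
  qed
  moreover have "{z \<in> space (lborel \<Otimes>\<^sub>M M). 0 < fst z \<longrightarrow> Y (fst z) (snd z) \<notin> N} \<in> sets (lborel \<Otimes>\<^sub>M M)"
  proof -
    have "(\<lambda>z. Y (fst z) (snd z)) \<in> borel_measurable (lborel \<Otimes>\<^sub>M M)"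
      using \<open>(\<lambda>(t, \<omega>). Y t \<omega>) \<in> _\<close> by (simp add: case_prod_beta')
    from measurable_sets[OF this \<open>N \<in> sets borel\<close>]
    have 1: "{z \<in> space (lborel \<Otimes>\<^sub>M M). Y (fst z) (snd z) \<in> N} \<in> sets (lborel \<Otimes>\<^sub>M M)"
      by (simp add: vimage_def Int_def conj_commute)
    have "(fst :: real \<times> 'w \<Rightarrow> real) \<in> borel_measurable (lborel \<Otimes>\<^sub>M M)"
      using measurable_fst[of lborel M] by simp
    then have 2: "{z \<in> space (lborel \<Otimes>\<^sub>M M). 0 < (fst z :: real)} \<in> sets (lborel \<Otimes>\<^sub>M M)"
      by (intro borel_measurable_less) auto
    show ?thesis by (intro sets.sets_Collect_imp sets.sets_Collect_neg 1 2)
  qed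
  ultimately have "AE t in lborel. AE \<omega> in M. 0 < t \<longrightarrow> Y t \<omega> \<notin> N"
    using pair.AE_commute[of "\<lambda>t \<omega>. 0 < t \<longrightarrow> Y t \<omega> \<notin> N"] by blast
  then show ?thesis
  proof eventually_elim
    case (elim t)
    show ?case
    proof
      assume t: "0 < t"
      show "AE \<omega> in M. X t \<omega> \<notin> N"
        using elim AE_good[OF A A1] by eventually_elim (use t in \<open>auto simp: Y_def\<close>)
    qed
  qed
qed

text \<open>A bound \<open>a * exp (l * s)\<close> on the distance of the laws, tested against
  continuous functions bounded by \<open>1\<close>, improves by the factor \<open>1 / 2\<close>. The
  difference of the two Duhamel formulas involves the test function \<open>b * slope\<close>, which
  has size \<open>B * K * (T - s) powr (- 1 / \<alpha>)\<close> but is not continuous. For almost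
  every \<open>s\<close> both solutions avoid the null set where a continuous approximation of
  \<open>b\<close> fails to converge, so the bound extends to it.\<close>
lemma law_contraction:
  assumes X: "solves b x X" and Y: "solves b x Y" and b[measurable]: "b \<in> borel_measurable borel" and bB: "\<And>z. \<bar>b z\<bar> \<le> B"
    and B: "0 < B" and a: "0 \<le> a" and T: "0 \<le> T" "T \<le> T0"
    and hyp: "\<And>s g. 0 \<le> s \<Longrightarrow> s \<le> T0 \<Longrightarrow> continuous_on UNIV g \<Longrightarrow> (\<And>y. \<bar>g y\<bar> \<le> 1) \<Longrightarrow>
       \<bar>expectation (\<lambda>\<omega>. g (X s \<omega>)) - expectation (\<lambda>\<omega>. g (Y s \<omega>))\<bar> \<le> a * exp (l * s)"
    and wi: "(\<lambda>u. u powr - (1 / \<alpha>) * exp (- (l * u))) integrable_on {0..T}"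
    and wb: "B * K * integral {0..T} (\<lambda>u. u powr - (1 / \<alpha>) * exp (- (l * u))) \<le> 1 / 2"
    and g: "continuous_on UNIV g" "\<And>y. \<bar>g y\<bar> \<le> 1"
  shows "\<bar>expectation (\<lambda>\<omega>. g (X T \<omega>)) - expectation (\<lambda>\<omega>. g (Y T \<omega>))\<bar> \<le> a / 2 * exp (l * T)"
proof (cases "T = 0")
  case True
  have "AE \<omega> in M. X 0 \<omega> = Y 0 \<omega>" using X Y unfolding solves_def by (auto elim: AE_mp)
  moreover have gm[measurable]: "g \<in> borel_measurable borel" using g(1) by (rule borel_measurable_continuous_onI)
  moreover have [measurable]: "X 0 \<in> borel_measurable M" "Y 0 \<in> borel_measurable M" using solves_measurable[OF X] solves_measurable[OF Y] by auto
  ultimately have "expectation (\<lambda>\<omega>. g (X 0 \<omega>)) = expectation (\<lambda>\<omega>. g (Y 0 \<omega>))"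
    by (intro integral_cong_AE) auto
  then show ?thesis using True a by simp
next
  case False
  then have T': "0 < T" using T by simp
  have gm[measurable]: "g \<in> borel_measurable borel" using g(1) by (rule borel_measurable_continuous_onI)
  have Xm: "X t \<in> borel_measurable M" and Ym: "Y t \<in> borel_measurable M" if "0 \<le> t" for t
    using solves_measurable[OF X that] solves_measurable[OF Y that] .
  have "b \<in> borel_measurable lebesgue" "AE z in lebesgue. \<bar>b z\<bar> \<le> B"
    using bB by (auto intro: measurable_completion)
  then obtain \<phi> :: "nat \<Rightarrow> real \<Rightarrow> real" and N where \<phi>: "\<And>n. continuous_on UNIV (\<phi> n)" "\<And>n z. \<bar>\<phi> n z\<bar> \<le> B"
    "N \<in> null_sets lborel" "\<And>z. z \<notin> N \<Longrightarrow> (\<lambda>n. \<phi> n z) \<longlonglongrightarrow> b z" "\<And>z. z \<notin> N \<Longrightarrow> \<bar>b z\<bar> \<le> B"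
    using less_imp_le[OF B] by (rule continuous_approximation) (blast intro: that)
  have [measurable]: "\<phi> n \<in> borel_measurable borel" for n using \<phi>(1) by (rule borel_measurable_continuous_onI)
  define w where "w u = u powr - (1 / \<alpha>) * exp (- (l * u))" for u
  define I where "I = integral {0..T} w"
  have w_eq: "w = (\<lambda>u. u powr - (1 / \<alpha>) * exp (- (l * u)))" by (simp add: w_def fun_eq_iff)
  have wI: "B * K * I \<le> 1 / 2" using wb unfolding I_def w_eq .
  define W where "W s = B * K * a * exp (l * T) * w (T - s)" for s
  have Wint: "(W has_integral B * K * a * exp (l * T) * I) {0..T}"
  proof -
    have "(w has_integral I) (cbox 0 T)" using wi unfolding w_def I_def by (simp add: integrable_integral)
    from has_integral_affinity[OF this, of "-1" T]
    have "((\<lambda>s. w (T - s)) has_integral I) ((\<lambda>x. T - x) ` {0..T})" by (simp add: algebra_simps)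
    moreover have "(\<lambda>x. T - x) ` {0..T} = {0..T}" by (auto intro!: image_eqI[of _ _ "T - _"])
    ultimately show ?thesis unfolding W_def by (intro has_integral_mult_right) simp
  qed
  have main: "\<bar>expectation (\<lambda>\<omega>. P \<epsilon> g (X T \<omega>)) - expectation (\<lambda>\<omega>. P \<epsilon> g (Y T \<omega>))\<bar> \<le> a / 2 * exp (l * T)" if e: "0 < \<epsilon>" for \<epsilon>
  proof -
    define Rs where "Rs s z = slope (scale (\<epsilon> + T - s)) g z 0" for s z
    define f where "f s = expectation (\<lambda>\<omega>. b (X s \<omega>) * Rs s (X s \<omega>)) - expectation (\<lambda>\<omega>. b (Y s \<omega>) * Rs s (Y s \<omega>))" for s
    note dX = duhamel[OF X b bB T' e g, folded Rs_def] and dY = duhamel[OF Y b bB T' e g, folded Rs_def]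
    have fi: "f integrable_on {0..T}" unfolding f_def by (intro integrable_diff dX(1) dY(1))
    have eq: "expectation (\<lambda>\<omega>. P \<epsilon> g (X T \<omega>)) - expectation (\<lambda>\<omega>. P \<epsilon> g (Y T \<omega>)) = integral {0..T} f"
      unfolding f_def dX(2) dY(2) by (subst Henstock_Kurzweil_Integration.integral_diff[OF dX(1) dY(1)]) simp
    have fW: "AE s in lborel. s \<in> {0<..<T} \<longrightarrow> \<bar>f s\<bar> \<le> W s"
      using solves_avoids_null'[OF X b bB \<phi>(3)] solves_avoids_null'[OF Y b bB \<phi>(3)]
    proof eventually_elim
      case (elim s)
      show ?case
      proof
        assume s: "s \<in> {0<..<T}"
        then have s0: "0 \<le> s" "s \<le> T0" using T by auto
        define \<sigma> where "\<sigma> = scale (\<epsilon> + T - s)"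
        have \<sigma>: "0 < \<sigma>" unfolding \<sigma>_def using s e by (intro scale_pos) auto
        have Rc: "continuous_on UNIV (Rs s)"
          unfolding continuous_on_sequentially Rs_def \<sigma>_def[symmetric]
          using slope_tendsto[OF g \<sigma> tendsto_const _ tendsto_const] by (auto simp: o_def)
        have [measurable]: "Rs s \<in> borel_measurable borel" using Rc by (rule borel_measurable_continuous_onI)
        have Rb: "\<bar>Rs s z\<bar> \<le> K / \<sigma>" for z unfolding Rs_def \<sigma>_def[symmetric] by (rule slope_abs_le[OF gm g(2) \<sigma>])
        define c where "c = B * (K / \<sigma>)"
        have c: "0 < c" using B K_ge \<sigma> by (simp add: c_def)
        have \<phi>slope: "\<bar>\<phi> n z * Rs s z\<bar> \<le> c" for n z
          unfolding abs_mult c_def using \<phi>(2) Rb B by (intro mult_mono) auto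
        have lim: "(\<lambda>n. expectation (\<lambda>\<omega>. \<phi> n (V \<omega>) * Rs s (V \<omega>))) \<longlonglongrightarrow> expectation (\<lambda>\<omega>. b (V \<omega>) * Rs s (V \<omega>))"
          if [measurable]: "V \<in> borel_measurable M" and V: "AE \<omega> in M. V \<omega> \<notin> N" for V
        proof (rule integral_dominated_convergence[where w="\<lambda>_. c"])
          show "AE \<omega> in M. (\<lambda>n. \<phi> n (V \<omega>) * Rs s (V \<omega>)) \<longlonglongrightarrow> b (V \<omega>) * Rs s (V \<omega>)"
            using V by eventually_elim (intro tendsto_mult tendsto_const \<phi>(4))
        qed (use \<phi>slope in auto)
        have step: "\<bar>expectation (\<lambda>\<omega>. \<phi> n (X s \<omega>) * Rs s (X s \<omega>)) - expectation (\<lambda>\<omega>. \<phi> n (Y s \<omega>) * Rs s (Y s \<omega>))\<bar> \<le> c * (a * exp (l * s))" for n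
        proof -
          have "\<bar>expectation (\<lambda>\<omega>. (\<lambda>z. \<phi> n z * Rs s z / c) (X s \<omega>)) - expectation (\<lambda>\<omega>. (\<lambda>z. \<phi> n z * Rs s z / c) (Y s \<omega>))\<bar> \<le> a * exp (l * s)"
          proof (rule hyp[OF s0])
            show "continuous_on UNIV (\<lambda>z. \<phi> n z * Rs s z / c)" using c by (intro continuous_intros \<phi>(1) Rc) auto
            show "\<bar>\<phi> n z * Rs s z / c\<bar> \<le> 1" for z using \<phi>slope[of n z] c by (simp add: abs_divide)
          qed
          moreover have "\<bar>u / c - v / c\<bar> = \<bar>u - v\<bar> / c" for u v using c by (simp add: diff_divide_distrib[symmetric] abs_divide)
          ultimately show ?thesis using c by (simp add: pos_divide_le_eq mult.commute)
        qed
        have "\<bar>f s\<bar> \<le> c * (a * exp (l * s))"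
          unfolding f_def
          by (rule LIMSEQ_le_const2[OF tendsto_rabs[OF tendsto_diff[OF lim lim]]]) (use step elim s Xm Ym in auto)
        also have "\<dots> \<le> (B * (K * (T - s) powr - (1 / \<alpha>))) * (a * exp (l * s))"
        proof (intro mult_right_mono)
          have "(T - s) powr (1 / \<alpha>) \<le> \<sigma>" unfolding \<sigma>_def scale_def using s e \<alpha> by (intro powr_mono2) auto
          then have "K / \<sigma> \<le> K / (T - s) powr (1 / \<alpha>)" using s \<sigma> K_ge by (intro divide_left_mono mult_pos_pos) auto
          then show "c \<le> B * (K * (T - s) powr - (1 / \<alpha>))"
            unfolding c_def using B by (intro mult_left_mono) (auto simp: powr_minus_divide)
        qed (use a in auto)
        also have "exp (l * s) = exp (l * T) * exp (- (l * (T - s)))" by (simp add: exp_add[symmetric] algebra_simps)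
        finally show "\<bar>f s\<bar> \<le> W s" by (simp add: W_def w_def mult_ac)
      qed
    qed
    \<comment> \<open>The bound \<open>W\<close> holds for almost every \<open>s\<close>; changing
      \<open>f\<close> on the exceptional null set does not affect its integral.\<close>
    define f' where "f' s = (if \<bar>f s\<bar> \<le> W s then f s else 0)" for s
    obtain N' where N': "N' \<in> null_sets lborel" "{s. \<not> (s \<in> {0<..<T} \<longrightarrow> \<bar>f s\<bar> \<le> W s)} \<subseteq> N'"
      using fW by (auto elim!: AE_E simp: null_sets_def)
    have neg: "negligible (N' \<union> {0, T})"
      using N'(1) by (intro negligible_Un) (auto simp: negligible_iff_null_sets null_sets_completionI)
    have W0: "0 \<le> W s" for s using B K_ge a by (simp add: W_def w_def)
    have eqf: "f' s = f s" if "s \<in> {0..T} - (N' \<union> {0, T})" for s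
    proof -
      have "s \<in> {0<..<T}" using that by auto
      then have "\<bar>f s\<bar> \<le> W s" using that N'(2) by blast
      then show ?thesis by (simp add: f'_def)
    qed
    have "f' integrable_on {0..T}" by (rule integrable_spike[OF fi neg eqf])
    moreover have "integral {0..T} f' = integral {0..T} f" by (rule integral_spike[OF neg]) (use eqf in auto)
    moreover have "norm (integral {0..T} f') \<le> integral {0..T} W"
    proof (rule integral_norm_bound_integral)
      show "W integrable_on {0..T}" using Wint by (auto simp: has_integral_integrable)
      show "norm (f' s) \<le> W s" for s using W0[of s] by (simp add: f'_def)
    qed fact
    moreover have "integral {0..T} W = B * K * a * exp (l * T) * I" using Wint by (rule integral_unique)
    moreover have "B * K * a * exp (l * T) * I \<le> a / 2 * exp (l * T)"
      using mult_left_mono[OF wI, of "a * exp (l * T)"] a by (simp add: mult_ac)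
    ultimately show ?thesis unfolding eq by simp
  qed
  have lim: "(\<lambda>n. expectation (\<lambda>\<omega>. P (1 / real (Suc n)) g (V \<omega>))) \<longlonglongrightarrow> expectation (\<lambda>\<omega>. g (V \<omega>))"
    if [measurable]: "V \<in> borel_measurable M" for V
  proof (rule integral_dominated_convergence[where w="\<lambda>_. 1"])
    have "(\<lambda>n. scale (1 / real (Suc n))) \<longlonglongrightarrow> 0 powr (1 / \<alpha>)" unfolding scale_def
      using LIMSEQ_inverse_real_of_nat \<alpha> by (intro tendsto_powr') (auto simp: inverse_eq_divide intro!: always_eventually)
    then show "AE \<omega> in M. (\<lambda>n. P (1 / real (Suc n)) g (V \<omega>)) \<longlonglongrightarrow> g (V \<omega>)"
      unfolding P_def by (intro AE_I2 scaled_mean_tendsto_small[OF g]) simp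
  qed (use P_abs_le[OF gm g(2)] in auto)
  show ?thesis
    by (rule LIMSEQ_le_const2[OF tendsto_rabs[OF tendsto_diff[OF lim lim]]]) (use main Xm Ym T in auto)
qed

text \<open>The trivial distance \<open>2\<close> starts an iteration of
  \<open>law_contraction\<close>.\<close>
lemma law_unique:
  fixes g :: "real \<Rightarrow> real"
  assumes X: "solves b x X" and Y: "solves b x Y" and b: "b \<in> borel_measurable borel" and bB: "\<And>z. \<bar>b z\<bar> \<le> B"
    and T: "0 \<le> T" and g: "continuous_on UNIV g" "\<And>y. \<bar>g y\<bar> \<le> 1"
  shows "expectation (\<lambda>\<omega>. g (X T \<omega>)) = expectation (\<lambda>\<omega>. g (Y T \<omega>))"
proof -
  \<comment> \<open>A strictly positive bound, so that the contraction constant below is well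
    defined.\<close>
  define B' where "B' = B + 1"
  have bB': "\<bar>b z\<bar> \<le> B'" for z using bB[of z] by (simp add: B'_def)
  have B': "0 < B'" using bB[of 0] by (simp add: B'_def)
  have BK: "0 < B' * K" using B' K_ge by simp
  obtain l where l: "0 \<le> l" "\<And>t. t \<in> {0..T} \<Longrightarrow> (\<lambda>u. u powr - (1 / \<alpha>) * exp (- (l * u))) integrable_on {0..t}"
    "\<And>t. t \<in> {0..T} \<Longrightarrow> integral {0..t} (\<lambda>u. u powr - (1 / \<alpha>) * exp (- (l * u))) \<le> 1 / (2 * (B' * K))"
    using powr_exp_integral_small[of "1 / \<alpha>" T "1 / (2 * (B' * K))"] \<alpha> T BK by auto
  have wb: "B' * K * integral {0..t} (\<lambda>u. u powr - (1 / \<alpha>) * exp (- (l * u))) \<le> 1 / 2" if "t \<in> {0..T}" for t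
  proof -
    have "B' * K * (1 / (2 * (B' * K))) = 1 / 2" using B' K_ge(3) by (simp add: field_simps)
    then show ?thesis using mult_left_mono[OF l(3)[OF that] less_imp_le[OF BK]] by simp
  qed
  have claim: "\<bar>expectation (\<lambda>\<omega>. f (X s \<omega>)) - expectation (\<lambda>\<omega>. f (Y s \<omega>))\<bar> \<le> 2 / 2 ^ n * exp (l * s)"
    if "0 \<le> s" "s \<le> T" "continuous_on UNIV f" "\<And>y. \<bar>f y\<bar> \<le> 1" for n s f
    using that
  proof (induction n arbitrary: s f)
    case 0
    have [measurable]: "f \<in> borel_measurable borel" using 0(3) by (rule borel_measurable_continuous_onI)
    have b1: "\<bar>expectation (\<lambda>\<omega>. f (V \<omega>))\<bar> \<le> 1" if [measurable]: "V \<in> borel_measurable M" for V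
    proof -
      have "integrable M (\<lambda>\<omega>. f (V \<omega>))" by (rule integrable_bounded[where B=1]) (use 0(4) in auto)
      then show ?thesis using 0(4) integral_le_const[of "\<lambda>\<omega>. f (V \<omega>)" 1] integral_ge_const[of "\<lambda>\<omega>. f (V \<omega>)" "-1"]
        by (auto simp: abs_le_iff minus_le_iff)
    qed
    have "1 \<le> exp (l * s)" using l(1) 0 by simp
    then have "\<bar>expectation (\<lambda>\<omega>. f (X s \<omega>)) - expectation (\<lambda>\<omega>. f (Y s \<omega>))\<bar> \<le> 2 * exp (l * s)"
      using b1[OF solves_measurable[OF X 0(1)]] b1[OF solves_measurable[OF Y 0(1)]] by linarith
    then show ?case by simp
  next
    case (Suc n)
    have "\<bar>expectation (\<lambda>\<omega>. f (X s \<omega>)) - expectation (\<lambda>\<omega>. f (Y s \<omega>))\<bar> \<le> (2 / 2 ^ n) / 2 * exp (l * s)"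
      by (rule law_contraction[OF X Y b bB' B' _ Suc.prems(1,2) Suc.IH l(2) wb Suc.prems(3,4)]) (use Suc.prems in auto)
    then show ?case by simp
  qed
  have "(\<lambda>n. 2 / 2 ^ n * exp (l * T)) \<longlonglongrightarrow> 0"
    using tendsto_mult[OF tendsto_const LIMSEQ_power_zero[of "1 / 2 :: real"], of "2 * exp (l * T)"] by (simp add: power_divide mult.commute)
  then have "\<bar>expectation (\<lambda>\<omega>. g (X T \<omega>)) - expectation (\<lambda>\<omega>. g (Y T \<omega>))\<bar> \<le> 0"
    by (rule LIMSEQ_le_const) (use claim[OF T order_refl g(1)] g(2) in auto)
  then show ?thesis by simp
qed

end

section \<open>Pathwise uniqueness\<close>

text \<open>The chain rule for the positive part of an absolutely continuous function
  \<open>w\<close>, whose density \<open>r\<close> vanishes wherever \<open>w\<close> does, proved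
  without almost everywhere differentiation. Over a grid interval without zeros of \<open>w\<close>
  the identity is exact, as \<open>w\<close> has constant sign there. Over the other intervals the
  error is at most \<open>2 * \<integral> \<bar>r\<bar>\<close>; these intervals shrink to the zero
  set of \<open>w\<close>, where \<open>r = 0\<close>.\<close>
lemma positive_part_integral:
  fixes w r q :: "real \<Rightarrow> real"
  assumes T: "0 < T" and r: "r absolutely_integrable_on {0..T}" and q: "q integrable_on {0..T}" and rB: "\<And>s. \<bar>r s\<bar> \<le> B"
    and w: "\<And>s. s \<in> {0..T} \<Longrightarrow> w s = integral {0..s} r"
    and qr: "\<And>s. s \<in> {0..T} \<Longrightarrow> q s = (if 0 < w s then r s else 0)"
    and z: "\<And>s. s \<in> {0..T} \<Longrightarrow> w s = 0 \<Longrightarrow> r s = 0"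
  shows "max 0 (w T) = integral {0..T} q"
proof -
  have ri: "r integrable_on {0..T}" and ai: "(\<lambda>s. 2 * \<bar>r s\<bar>) integrable_on {0..T}"
    using set_lebesgue_integral_eq_integral(1)[OF r] set_lebesgue_integral_eq_integral(1)[OF absolutely_integrable_norm[OF r]] by (auto simp: o_def)
  have wc: "continuous_on {0..T} w"
    using indefinite_integral_continuous_1[OF ri] by (rule continuous_on_eq) (use w in auto)
  have B0: "0 \<le> B" using rB[of 0] by linarith
  define h where "h n = T / real (Suc n)" for n
  have h: "0 < h n" and hT: "real (Suc n) * h n = T" for n using T by (auto simp: h_def)
  define c where "c n i = (if \<exists>s\<in>{real i * h n..real (Suc i) * h n}. w s = 0 then 1 else 0 :: real)" for n i
  define \<Phi> where "\<Phi> n s = (2 * \<bar>r s\<bar>) * c n (min (nat \<lfloor>s / h n\<rfloor>) n)" for n s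
  define S where "S n = (\<Sum>i<Suc n. integral {real i * h n..real (Suc i) * h n} (\<lambda>s. 2 * \<bar>r s\<bar>) * c n i)" for n
  have \<Phi>i: "(\<Phi> n has_integral S n) {0..T}" for n
    unfolding \<Phi>_def S_def using step_has_integral[OF h, of "\<lambda>s. 2 * \<bar>r s\<bar>" n n "c n"] ai hT[of n] by simp
  have bound: "\<bar>max 0 (w T) - integral {0..T} q\<bar> \<le> S n" for n
  proof -
    have qsum: "(\<Sum>i<Suc n. integral {real i * h n..real (Suc i) * h n} q) = integral {0..T} q"
      using integral_unique[OF step_has_integral[OF h, of q n n "\<lambda>_. 1"]] q hT[of n] by simp
    have tele: "(\<Sum>i<Suc n. max 0 (w (real (Suc i) * h n)) - max 0 (w (real i * h n))) = max 0 (w T)"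
      using sum_lessThan_telescope[of "\<lambda>i. max 0 (w (real i * h n))" "Suc n"] hT[of n] w[of 0] T by simp
    have "\<bar>(max 0 (w (real (Suc i) * h n)) - max 0 (w (real i * h n))) - integral {real i * h n..real (Suc i) * h n} q\<bar>
        \<le> integral {real i * h n..real (Suc i) * h n} (\<lambda>s. 2 * \<bar>r s\<bar>) * c n i" if i: "i < Suc n" for i
    proof -
      define a b where "a = real i * h n" and "b = real (Suc i) * h n"
      have "real (Suc i) * h n \<le> real (Suc n) * h n" using i h[of n] by (intro mult_right_mono) auto
      then have ab: "0 \<le> a" "a \<le> b" "b \<le> T" using h[of n] hT[of n] by (auto simp: a_def b_def intro!: mult_right_mono)
      have sub: "{a..b} \<subseteq> {0..T}" using ab by auto
      have i': "r integrable_on {a..b}" "q integrable_on {a..b}" "(\<lambda>s. 2 * \<bar>r s\<bar>) integrable_on {a..b}"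
        using integrable_on_subinterval[OF ri sub] integrable_on_subinterval[OF q sub] integrable_on_subinterval[OF ai sub] .
      have wab: "w b - w a = integral {a..b} r"
        using integral_increment[OF ab(1,2) integrable_on_subinterval[OF ri]] ab w by auto
      have ra: "\<bar>integral {a..b} r\<bar> \<le> integral {a..b} (\<lambda>s. 2 * \<bar>r s\<bar>) / 2" and qa: "\<bar>integral {a..b} q\<bar> \<le> integral {a..b} (\<lambda>s. 2 * \<bar>r s\<bar>) / 2"
      proof -
        have i1: "(\<lambda>s. \<bar>r s\<bar>) integrable_on {a..b}" using integrable_on_mult_right[OF i'(3), of "1/2"] by simp
        have "norm (integral {a..b} r) \<le> integral {a..b} (\<lambda>s. \<bar>r s\<bar>)" "norm (integral {a..b} q) \<le> integral {a..b} (\<lambda>s. \<bar>r s\<bar>)"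
          by (rule integral_norm_bound_integral[OF i'(1) i1] integral_norm_bound_integral[OF i'(2) i1], use qr sub in force)+
        then show "\<bar>integral {a..b} r\<bar> \<le> integral {a..b} (\<lambda>s. 2 * \<bar>r s\<bar>) / 2" "\<bar>integral {a..b} q\<bar> \<le> integral {a..b} (\<lambda>s. 2 * \<bar>r s\<bar>) / 2" by auto
      qed
      show ?thesis
      proof (cases "\<exists>s\<in>{a..b}. w s = 0")
        case True
        then have "c n i = 1" unfolding c_def a_def b_def by simp
        moreover have "\<bar>max 0 (w b) - max 0 (w a)\<bar> \<le> \<bar>w b - w a\<bar>" by auto
        ultimately show ?thesis using ra qa unfolding wab by (simp add: a_def[symmetric] b_def[symmetric] del: of_nat_Suc)
      next
        case False
        have wc': "continuous_on {a..s} w" if "s \<le> b" for s using continuous_on_subset[OF wc] ab that by auto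
        have "(max 0 (w b) - max 0 (w a)) = integral {a..b} q"
        proof (cases "0 < w a")
          case pos: True
          have "0 < w s" if s: "s \<in> {a..b}" for s
          proof (rule ccontr)
            assume "\<not> 0 < w s"
            then have "\<exists>x\<ge>a. x \<le> s \<and> w x = 0" using pos s by (intro IVT2' wc') auto
            then show False using False s by auto
          qed
          then have "integral {a..b} q = integral {a..b} r" "0 < w b" using sub qr ab by (auto intro!: integral_cong)
          then show ?thesis using pos wab by simp
        next
          case np: False
          have "w s < 0" if s: "s \<in> {a..b}" for s
          proof (rule ccontr)
            assume "\<not> w s < 0"
            then have "\<exists>x\<ge>a. x \<le> s \<and> w x = 0" using np s by (intro IVT' wc') auto
            then show False using False s by auto
          qed
          then have "integral {a..b} q = integral {a..b} (\<lambda>_. 0)" "w b < 0" using sub qr ab by (force intro!: integral_cong)+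
          then show ?thesis using np by simp
        qed
        moreover have "c n i = 0" using False unfolding c_def a_def b_def by simp
        ultimately show ?thesis unfolding a_def b_def by simp
      qed
    qed
    then have "(\<Sum>i<Suc n. \<bar>(max 0 (w (real (Suc i) * h n)) - max 0 (w (real i * h n))) - integral {real i * h n..real (Suc i) * h n} q\<bar>) \<le> S n"
      unfolding S_def by (intro sum_mono) auto
    moreover have "\<bar>\<Sum>i<Suc n. (max 0 (w (real (Suc i) * h n)) - max 0 (w (real i * h n))) - integral {real i * h n..real (Suc i) * h n} q\<bar> \<le>
      (\<Sum>i<Suc n. \<bar>(max 0 (w (real (Suc i) * h n)) - max 0 (w (real i * h n))) - integral {real i * h n..real (Suc i) * h n} q\<bar>)"
      by (rule sum_abs)
    ultimately show ?thesis unfolding sum_subtractf[of _ "\<lambda>i. integral {real i * h n..real (Suc i) * h n} q"] qsum tele by linarith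
  qed
  have lim: "(\<lambda>n. \<Phi> n s) \<longlonglongrightarrow> 0" if s: "s \<in> {0..T}" for s
  proof (cases "w s = 0")
    case True
    then show ?thesis using z[OF s] by (simp add: \<Phi>_def)
  next
    case False
    have "(w \<longlongrightarrow> w s) (at s within {0..T})" using wc s by (auto simp: continuous_on_def)
    then have "\<forall>\<^sub>F u in at s within {0..T}. w u \<noteq> 0" using False by (rule tendsto_imp_eventually_ne)
    then obtain e where e: "0 < e" "\<And>u. u \<in> {0..T} \<Longrightarrow> dist u s < e \<Longrightarrow> w u \<noteq> 0"
      using False unfolding eventually_at by (metis dist_eq_0_iff)
    have h0: "h \<longlonglongrightarrow> 0" unfolding h_def using LIMSEQ_Suc[OF lim_const_over_n[of T]] by simp
    have "\<forall>\<^sub>F n in sequentially. h n < e" using h0 e(1) by (auto dest: order_tendstoD)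
    then have "\<forall>\<^sub>F n in sequentially. \<Phi> n s = 0"
    proof eventually_elim
      case (elim n)
      define k where "k = min (nat \<lfloor>s / h n\<rfloor>) n"
      have kb: "real k * h n \<le> s" "s \<le> real (Suc k) * h n" "real (Suc k) * h n \<le> T" "0 \<le> real k * h n"
        using grid_bracket(2-4)[OF T s h_def refl, of n] h[of n] by (auto simp: k_def)
      have "w u \<noteq> 0" if "u \<in> {real k * h n..real (Suc k) * h n}" for u
      proof (rule e(2))
        show "u \<in> {0..T}" using that kb by auto
        have "real (Suc k) * h n = real k * h n + h n" by (simp add: algebra_simps)
        then show "dist u s < e" using that kb elim by (auto simp: dist_real_def abs_if)
      qed
      then have "c n k = 0" unfolding c_def by auto
      then show ?case by (simp add: \<Phi>_def k_def)
    qed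
    then show ?thesis by (rule tendsto_eventually)
  qed
  have "(\<lambda>n. integral {0..T} (\<Phi> n)) \<longlonglongrightarrow> integral {0..T} (\<lambda>_. 0)"
  proof (rule dominated_convergence(2)[where h="\<lambda>_. 2 * B"])
    show "norm (\<Phi> n s) \<le> 2 * B" for n s
      using rB[of s] B0 by (auto simp: \<Phi>_def c_def abs_mult)
  qed (use \<Phi>i lim in \<open>auto simp: has_integral_integrable\<close>)
  moreover have "integral {0..T} (\<Phi> n) = S n" for n using \<Phi>i by (rule integral_unique)
  ultimately have "S \<longlonglongrightarrow> 0" by simp
  then have "\<bar>max 0 (w T) - integral {0..T} q\<bar> \<le> 0" by (rule LIMSEQ_le_const) (use bound in auto)
  then show ?thesis by simp
qed

context stable_noise begin

text \<open>The noise cancels in \<open>X - Y\<close>, so \<open>X - Y\<close> is the integral of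
  \<open>b X - b Y\<close>, which vanishes where \<open>X = Y\<close>. Hence the positive part of
  \<open>X - Y\<close> has drift \<open>b (max X Y) - b Y\<close>, and \<open>max X Y\<close> is
  \<open>Y\<close> plus this positive part.\<close>
lemma solves_max:
  assumes X: "solves b x X" and Y: "solves b x Y" and b: "b \<in> borel_measurable borel" "\<And>z. \<bar>b z\<bar> \<le> B"
  shows "solves b x (\<lambda>t \<omega>. max (X t \<omega>) (Y t \<omega>))"
  unfolding solves_def
proof (intro conjI allI impI)
  show "(\<lambda>\<omega>. max (X t \<omega>) (Y t \<omega>)) \<in> borel_measurable (F t)" if "0 \<le> t" for t
    using X Y that unfolding solves_def by (intro borel_measurable_max) auto
  have rX: "AE \<omega> in M. \<forall>t\<ge>0. continuous (at_right t) (\<lambda>t. X t \<omega>)" and rY: "AE \<omega> in M. \<forall>t\<ge>0. continuous (at_right t) (\<lambda>t. Y t \<omega>)"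
    and eX: "AE \<omega> in M. \<forall>t\<ge>0. X t \<omega> = x + integral {0..t} (\<lambda>s. b (X s \<omega>)) + Z t \<omega>"
    and eY: "AE \<omega> in M. \<forall>t\<ge>0. Y t \<omega> = x + integral {0..t} (\<lambda>s. b (Y s \<omega>)) + Z t \<omega>"
    using X Y unfolding solves_def by auto
  show "AE \<omega> in M. \<forall>t\<ge>0. continuous (at_right t) (\<lambda>t. max (X t \<omega>) (Y t \<omega>))"
    using rX rY by eventually_elim (auto intro: continuous_max)
  show "AE \<omega> in M. \<forall>t\<ge>0. max (X t \<omega>) (Y t \<omega>) = x + integral {0..t} (\<lambda>s. b (max (X s \<omega>) (Y s \<omega>))) + Z t \<omega>"
    using rX rY eX eY
  proof eventually_elim
    case (elim \<omega>)
    have rm: "continuous (at_right t) (\<lambda>t. max (X t \<omega>) (Y t \<omega>))" if "0 \<le> t" for t using elim(1,2) that by (auto intro: continuous_max)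
    show ?case
    proof (intro allI impI)
      fix t :: real assume t: "0 \<le> t"
      show "max (X t \<omega>) (Y t \<omega>) = x + integral {0..t} (\<lambda>s. b (max (X s \<omega>) (Y s \<omega>))) + Z t \<omega>"
      proof (cases "t = 0")
        case True
        then show ?thesis using elim(3,4) by simp
      next
        case False
        then have t': "0 < t" using t by simp
        define w where "w s = X s \<omega> - Y s \<omega>" for s
        define r where "r s = b (X s \<omega>) - b (Y s \<omega>)" for s
        define q where "q s = b (max (X s \<omega>) (Y s \<omega>)) - b (Y s \<omega>)" for s
        have ai: "(\<lambda>s. b (X s \<omega>)) absolutely_integrable_on {0..s}" "(\<lambda>s. b (Y s \<omega>)) absolutely_integrable_on {0..s}"
          "(\<lambda>s. b (max (X s \<omega>) (Y s \<omega>))) absolutely_integrable_on {0..s}" for s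
          using elim(1,2) rm by (auto intro!: drift_absolutely_integrable[where b=b and B=B] b)
        note ii = ai[THEN set_lebesgue_integral_eq_integral(1)]
        have "max 0 (w t) = integral {0..t} q"
        proof (rule positive_part_integral[OF t'])
          show "r absolutely_integrable_on {0..t}" unfolding r_def by (intro set_integral_diff ai)
          show "q integrable_on {0..t}" unfolding q_def by (intro integrable_diff ii)
          show "\<bar>r s\<bar> \<le> 2 * B" for s using b(2)[of "X s \<omega>"] b(2)[of "Y s \<omega>"] unfolding r_def by linarith
          show "w s = integral {0..s} r" if "s \<in> {0..t}" for s
            unfolding w_def r_def using elim(3,4) that ii
            by (subst Henstock_Kurzweil_Integration.integral_diff) auto
          show "q s = (if 0 < w s then r s else 0)" for s by (auto simp: q_def w_def r_def max_def)
          show "w s = 0 \<Longrightarrow> r s = 0" for s by (auto simp: w_def r_def)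
        qed
        also have "\<dots> = integral {0..t} (\<lambda>s. b (max (X s \<omega>) (Y s \<omega>))) - integral {0..t} (\<lambda>s. b (Y s \<omega>))"
          unfolding q_def by (rule Henstock_Kurzweil_Integration.integral_diff[OF ii(3,2)])
        finally have "max 0 (w t) = integral {0..t} (\<lambda>s. b (max (X s \<omega>) (Y s \<omega>))) - integral {0..t} (\<lambda>s. b (Y s \<omega>))" .
        moreover have "max (X t \<omega>) (Y t \<omega>) = Y t \<omega> + max 0 (w t)" by (auto simp: w_def)
        moreover have "Y t \<omega> = x + integral {0..t} (\<lambda>s. b (Y s \<omega>)) + Z t \<omega>" using elim(4) t by blast
        ultimately show ?thesis by simp
      qed
    qed
  qed
qed

lemma right_continuous_AE_eq:
  fixes X Y :: "real \<Rightarrow> 'w \<Rightarrow> real"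
  assumes rX: "AE \<omega> in M. \<forall>t\<ge>0. continuous (at_right t) (\<lambda>t. X t \<omega>)" and rY: "AE \<omega> in M. \<forall>t\<ge>0. continuous (at_right t) (\<lambda>t. Y t \<omega>)"
    and eq: "\<And>t. 0 \<le> t \<Longrightarrow> AE \<omega> in M. X t \<omega> = Y t \<omega>"
  shows "AE \<omega> in M. \<forall>t\<ge>0. X t \<omega> = Y t \<omega>"
proof -
  have "AE \<omega> in M. \<forall>i n. X (real i / real (Suc n)) \<omega> = Y (real i / real (Suc n)) \<omega>"
    unfolding AE_all_countable by (intro allI eq) simp
  with rX rY show ?thesis
  proof eventually_elim
    case (elim \<omega>)
    show ?case
    proof (intro allI impI)
      fix t :: real assume t: "0 \<le> t"
      define k where "k n = nat \<lceil>t * real (Suc n)\<rceil>" for n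
      define s where "s n = real (k n) / real (Suc n)" for n
      have sb: "t \<le> s n" "s n \<le> t + 1 / real (Suc n)" for n
      proof -
        have t0: "0 \<le> t * real (Suc n)" using t by simp
        have "t * real (Suc n) \<le> real (k n)" using t0 unfolding k_def by linarith
        then show "t \<le> s n" unfolding s_def by (subst pos_le_divide_eq) auto
        have "real (k n) \<le> t * real (Suc n) + 1" using t0 unfolding k_def by linarith
        then have "real (k n) / real (Suc n) \<le> (t * real (Suc n) + 1) / real (Suc n)" by (intro divide_right_mono) auto
        then show "s n \<le> t + 1 / real (Suc n)" by (simp add: s_def add_divide_distrib del: of_nat_Suc)
      qed
      have s1: "s \<longlonglongrightarrow> t"
      proof (rule real_tendsto_sandwich[of "\<lambda>_. t" _ _ "\<lambda>n. t + 1 / real (Suc n)"])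
        show "(\<lambda>n. t + 1 / real (Suc n)) \<longlonglongrightarrow> t"
          using tendsto_add[OF tendsto_const LIMSEQ_inverse_real_of_nat, of t] by (simp add: inverse_eq_divide)
      qed (use sb in \<open>auto intro!: always_eventually\<close>)
      have "(\<lambda>n. X (s n) \<omega>) \<longlonglongrightarrow> X t \<omega>" "(\<lambda>n. Y (s n) \<omega>) \<longlonglongrightarrow> Y t \<omega>"
        by (rule right_continuous_seq[of t "\<lambda>t. X t \<omega>" s] right_continuous_seq[of t "\<lambda>t. Y t \<omega>" s]; use elim(1,2) t sb s1 in simp)+
      moreover have "X (s n) \<omega> = Y (s n) \<omega>" for n using elim(3) unfolding s_def by blast
      ultimately show "X t \<omega> = Y t \<omega>" using LIMSEQ_unique by auto
    qed
  qed
qed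

text \<open>Two ordered random variables with the same law agree almost surely. The bounded,
  strictly increasing \<open>arctan\<close> detects this by a single expectation.\<close>
lemma solves_unique:
  assumes X: "solves b x X" and Y: "solves b x Y" and b: "b \<in> borel_measurable borel" "\<And>z. \<bar>b z\<bar> \<le> B"
  shows "AE \<omega> in M. \<forall>t\<ge>0. X t \<omega> = Y t \<omega>"
proof (rule right_continuous_AE_eq)
  show "AE \<omega> in M. \<forall>t\<ge>0. continuous (at_right t) (\<lambda>t. X t \<omega>)" "AE \<omega> in M. \<forall>t\<ge>0. continuous (at_right t) (\<lambda>t. Y t \<omega>)"
    using X Y unfolding solves_def by auto
  fix t :: real assume t: "0 \<le> t"
  define g where "g z = arctan z / 2" for z :: real
  have gc: "continuous_on UNIV g" unfolding g_def by (intro continuous_intros) auto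
  have gb: "\<bar>g z\<bar> \<le> 1" for z
    using arctan_lbound[of z] arctan_ubound[of z] pi_less_4 unfolding g_def by (simp add: abs_le_iff)
  have [measurable]: "g \<in> borel_measurable borel" using gc by (rule borel_measurable_continuous_onI)
  define V where "V t \<omega> = max (X t \<omega>) (Y t \<omega>)" for t \<omega>
  have V: "solves b x V" unfolding V_def by (rule solves_max[OF X Y b])
  have Vm[measurable]: "V t \<in> borel_measurable M" using solves_measurable[OF V t] .
  have gen: "AE \<omega> in M. V t \<omega> = W t \<omega>" if W: "solves b x W" and le: "\<And>\<omega>. W t \<omega> \<le> V t \<omega>" for W
  proof -
    have [measurable]: "W t \<in> borel_measurable M" using solves_measurable[OF W t] .
    have int: "integrable M (\<lambda>\<omega>. g (U \<omega>))" if "U \<in> borel_measurable M" for U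
      by (rule integrable_bounded[where B=1]) (use that gb in auto)
    have "expectation (\<lambda>\<omega>. g (V t \<omega>) - g (W t \<omega>)) = 0"
      using law_unique[OF V W b t gc gb] int by simp
    moreover have nn: "0 \<le> g (V t \<omega>) - g (W t \<omega>)" for \<omega> using le[of \<omega>] by (simp add: g_def arctan_le_iff)
    ultimately have "AE \<omega> in M. g (V t \<omega>) - g (W t \<omega>) = 0"
      by (subst integral_nonneg_eq_0_iff_AE[symmetric]) (use int in auto)
    then show ?thesis by eventually_elim (simp add: g_def arctan_eq_iff)
  qed
  have "AE \<omega> in M. V t \<omega> = X t \<omega>" "AE \<omega> in M. V t \<omega> = Y t \<omega>"
    by (rule gen[OF X] gen[OF Y], simp add: V_def)+
  then show "AE \<omega> in M. X t \<omega> = Y t \<omega>" by eventually_elim simp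
qed

text \<open>The drift \<open>a\<close> may be unbounded on the null set, so a solution is not known
  in advance to have a Lipschitz drift part. Its drift part does have finite variation on \<open>[0,
  T]\<close>, since \<open>a\<close> is integrable along the path. Hence
  \<open>occupation_null\<close> applies on each event \<open>E m\<close> where the variation is at
  most \<open>m\<close>, and these events exhaust almost all of the sample space. So
  \<open>X\<close> avoids the null set and \<open>a\<close> may be replaced by
  \<open>b\<close>.\<close>
lemma sde_solution_imp_solves:
  assumes X: "sde_solution M F Z a x X" and b: "b \<in> borel_measurable borel" "\<And>z. \<bar>b z\<bar> \<le> B"
    and N: "N \<in> null_sets lebesgue" and ab: "\<And>z. z \<notin> N \<Longrightarrow> a z = b z"
  shows "solves b x X"
proof -
  have XF: "X t \<in> borel_measurable (F t)" if "0 \<le> t" for t using X that by (simp add: sde_solution_def adapted_def)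
  have ae: "AE \<omega> in M. (\<forall>T>0. (\<lambda>s. a (X s \<omega>)) absolutely_integrable_on {0..T}) \<and>
      (\<forall>t\<ge>0. X t \<omega> = x + integral {0..t} (\<lambda>s. a (X s \<omega>)) + Z t \<omega>) \<and> (\<forall>t\<ge>0. continuous (at_right t) (\<lambda>t. X t \<omega>))"
  proof -
    have "AE \<omega> in M. (\<forall>T>0. (\<lambda>s. a (X s \<omega>)) absolutely_integrable_on {0..T}) \<and>
        (\<forall>t\<ge>0. X t \<omega> = x + (LINT s:{0..t}|lebesgue. a (X s \<omega>)) + Z t \<omega>)"
      using X by (simp add: sde_solution_def)
    with Z_right show ?thesis
    proof eventually_elim
      case (elim \<omega>)
      have ii: "(\<lambda>s. a (X s \<omega>)) integrable_on {0..t}" if "0 < t" for t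
        using elim(2) that set_lebesgue_integral_eq_integral(1) by blast
      have eq: "X t \<omega> = x + integral {0..t} (\<lambda>s. a (X s \<omega>)) + Z t \<omega>" if "0 \<le> t" for t
      proof -
        have "(LINT s:{0..t}|lebesgue. a (X s \<omega>)) = integral {0..t} (\<lambda>s. a (X s \<omega>))"
        proof (cases "t = 0")
          case True
          have "(LINT s:{0}|lebesgue. a (X s \<omega>)) = 0"
            unfolding set_lebesgue_integral_def
          proof (rule integral_eq_zero_AE)
            have "{0::real} \<in> null_sets lebesgue" by (intro null_sets_completionI) auto
            then show "AE s in lebesgue. indicator {0} s *\<^sub>R a (X s \<omega>) = 0"
              by (rule AE_I') (auto simp: indicator_def)
          qed
          then show ?thesis using True by simp
        next
          case False
          then show ?thesis using elim(2) that set_lebesgue_integral_eq_integral(2)[of "{0..t}" "\<lambda>s. a (X s \<omega>)"] by auto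
        qed
        then show ?thesis using elim(2) that by simp
      qed
      have "(\<lambda>s. a (X s \<omega>)) integrable_on {0..t}" for t
        using ii[of t] integrable_on_refl[of "\<lambda>s. a (X s \<omega>)" 0] by (cases "0 < t"; cases "t = 0") (auto simp: cbox_interval)
      then have "continuous (at_right t) (\<lambda>t. X t \<omega>)" if "0 \<le> t" for t
        by (rule right_continuous_plus_integral[where z="\<lambda>t. Z t \<omega>" and x=x]) (use elim(1) eq that in auto)
      then show ?case using elim(2) eq by blast
    qed
  qed
  define good where "good \<omega> \<longleftrightarrow> (\<forall>T>0. (\<lambda>s. a (X s \<omega>)) absolutely_integrable_on {0..T}) \<and>
      (\<forall>t\<ge>0. X t \<omega> = x + integral {0..t} (\<lambda>s. a (X s \<omega>)) + Z t \<omega>) \<and> (\<forall>t\<ge>0. continuous (at_right t) (\<lambda>t. X t \<omega>))" for \<omega>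
  have "AE \<omega> in M. good \<omega>" using ae unfolding good_def .
  then obtain N0 where N0: "{\<omega> \<in> space M. \<not> good \<omega>} \<subseteq> N0" "emeasure M N0 = 0" "N0 \<in> sets M" by (rule AE_E)
  then have N0': "good \<omega>" if "\<omega> \<in> space M - N0" for \<omega> using that by blast
  define A where "A = space M - N0"
  have A[measurable]: "A \<in> sets M" using N0 by (simp add: A_def)
  have A1: "prob A = 1" unfolding A_def using N0 prob_compl[of N0] by (simp add: emeasure_eq_measure)
  have ai: "(\<lambda>s. a (X s \<omega>)) absolutely_integrable_on {0..T}" if "\<omega> \<in> A" "0 < T" for \<omega> T using N0' that by (simp add: A_def good_def)
  have eq: "X t \<omega> = x + integral {0..t} (\<lambda>s. a (X s \<omega>)) + Z t \<omega>" if "\<omega> \<in> A" "0 \<le> t" for \<omega> t using N0' that unfolding A_def good_def by blast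
  have right: "continuous (at_right t) (\<lambda>t. X t \<omega>)" if "\<omega> \<in> A" "0 \<le> t" for \<omega> t using N0' that by (simp add: A_def good_def)
  note AEA = AE_good[OF A A1]
  have avoid: "AE \<omega> in M. AE t in lborel. 0 < t \<and> t < T \<longrightarrow> X t \<omega> \<notin> N" if T: "0 < T" for T
  proof -
    define V where "V n \<omega> = (\<Sum>i<n. \<bar>(X (real (Suc i) * (T / real n)) \<omega> - Z (real (Suc i) * (T / real n)) \<omega>)
        - (X (real i * (T / real n)) \<omega> - Z (real i * (T / real n)) \<omega>)\<bar>)" for n \<omega>
    have grid: "0 \<le> real i * (T / real n)" for i n using T by simp
    have [measurable]: "X (real i * (T / real n)) \<in> borel_measurable M" "Z (real i * (T / real n)) \<in> borel_measurable M" for i n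
      using F_M_measurable[OF XF[OF grid] grid] Z_measurable[OF grid] .
    have [measurable]: "V n \<in> borel_measurable M" for n unfolding V_def by measurable
    define E where "E m = {\<omega>\<in>A. \<forall>n. V n \<omega> \<le> real m}" for m
    have E[measurable]: "E m \<in> sets M" for m
    proof -
      have "E m = A \<inter> {\<omega>\<in>space M. \<forall>n. V n \<omega> \<le> real m}" using sets.sets_into_space[OF A] by (auto simp: E_def)
      also have "\<dots> \<in> sets M" by measurable
      finally show ?thesis .
    qed
    have "AE \<omega> in M. \<omega> \<in> E m \<longrightarrow> (AE t in lborel. 0 < t \<and> t < T \<longrightarrow> X t \<omega> \<notin> N)" for m
    proof (rule occupation_null[where v="real m", OF T XF N _ E])
      show "continuous_on {0..T} (\<lambda>t. X t \<omega> - Z t \<omega>)" if "\<omega> \<in> E m" for \<omega>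
      proof -
        have w: "\<omega> \<in> A" using that by (simp add: E_def)
        have "continuous_on {0..T} (\<lambda>t. x + integral {0..t} (\<lambda>s. a (X s \<omega>)))"
          using set_lebesgue_integral_eq_integral(1)[OF ai[OF w T]]
          by (intro continuous_intros indefinite_integral_continuous_1)
        then show ?thesis by (rule continuous_on_eq) (use eq[OF w] in auto)
      qed
      show "(\<Sum>i<n. \<bar>(X (real (Suc i) * (T / real n)) \<omega> - Z (real (Suc i) * (T / real n)) \<omega>)
        - (X (real i * (T / real n)) \<omega> - Z (real i * (T / real n)) \<omega>)\<bar>) \<le> real m" if "\<omega> \<in> E m" for \<omega> n
        using that unfolding E_def V_def by blast
    qed (use right in \<open>auto simp: E_def\<close>)
    then have "AE \<omega> in M. \<forall>m. \<omega> \<in> E m \<longrightarrow> (AE t in lborel. 0 < t \<and> t < T \<longrightarrow> X t \<omega> \<notin> N)"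
      by (rule AE_all_countable[THEN iffD2, OF allI])
    with AEA show ?thesis
    proof eventually_elim
      case (elim \<omega>)
      define c where "c = integral {0..T} (\<lambda>s. \<bar>a (X s \<omega>)\<bar>)"
      have abs: "(\<lambda>s. \<bar>a (X s \<omega>)\<bar>) integrable_on {0..T}"
        using set_lebesgue_integral_eq_integral(1)[OF absolutely_integrable_norm[OF ai[OF elim(1) T]]] by (simp add: o_def)
      have Vc: "V n \<omega> \<le> c" for n
      proof (cases n)
        case 0
        then show ?thesis unfolding V_def c_def by (simp add: integral_nonneg[OF abs])
      next
        case (Suc m)
        define h where "h = T / real n"
        have h: "0 < h" "real (Suc m) * h = T" using T Suc by (auto simp: h_def)
        have "\<bar>(X (real (Suc i) * h) \<omega> - Z (real (Suc i) * h) \<omega>) - (X (real i * h) \<omega> - Z (real i * h) \<omega>)\<bar> \<le>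
            integral {real i * h..real (Suc i) * h} (\<lambda>s. \<bar>a (X s \<omega>)\<bar>)" if i: "i < n" for i
        proof -
          have "real (Suc i) * h \<le> real (Suc m) * h" using i h(1) Suc by (intro mult_right_mono) auto
          then have le: "0 \<le> real i * h" "real i * h \<le> real (Suc i) * h" "real (Suc i) * h \<le> T" "0 \<le> real (Suc i) * h"
            using h by (auto intro!: mult_right_mono)
          have sub: "{real i * h..real (Suc i) * h} \<subseteq> {0..T}" "{0..real (Suc i) * h} \<subseteq> {0..T}" using le by auto
          note i0 = set_lebesgue_integral_eq_integral(1)[OF ai[OF elim(1) T]]
          have "(X (real (Suc i) * h) \<omega> - Z (real (Suc i) * h) \<omega>) - (X (real i * h) \<omega> - Z (real i * h) \<omega>) = integral {real i * h..real (Suc i) * h} (\<lambda>s. a (X s \<omega>))"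
            unfolding eq[OF elim(1) le(1)] eq[OF elim(1) le(4)]
            using integral_increment[OF le(1,2) integrable_on_subinterval[OF i0 sub(2)]] by simp
          then show ?thesis
            using integral_norm_bound_integral[OF integrable_on_subinterval[OF i0 sub(1)] integrable_on_subinterval[OF abs sub(1)]] by simp
        qed
        then have "V n \<omega> \<le> (\<Sum>i<n. integral {real i * h..real (Suc i) * h} (\<lambda>s. \<bar>a (X s \<omega>)\<bar>))"
          unfolding V_def h_def[symmetric] by (intro sum_mono) auto
        also have "\<dots> = c"
          using integral_unique[OF step_has_integral[OF h(1), of "\<lambda>s. \<bar>a (X s \<omega>)\<bar>" m "\<lambda>_. 1"]] abs h(2) Suc
          by (simp add: c_def)
        finally show ?thesis .
      qed
      obtain m where "c \<le> real m" using real_arch_simple by blast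
      then have "\<omega> \<in> E m" using Vc elim(1) order_trans unfolding E_def by blast
      then show ?case using elim(2) by blast
    qed
  qed
  have "AE \<omega> in M. \<forall>n. AE t in lborel. 0 < t \<and> t < real (Suc n) \<longrightarrow> X t \<omega> \<notin> N"
    by (rule AE_all_countable[THEN iffD2, OF allI], rule avoid) simp
  with AEA have "AE \<omega> in M. \<forall>t\<ge>0. X t \<omega> = x + integral {0..t} (\<lambda>s. b (X s \<omega>)) + Z t \<omega>"
  proof eventually_elim
    case (elim \<omega>)
    show ?case
    proof (intro allI impI)
      fix t :: real assume t: "0 \<le> t"
      obtain n where n: "t < real n" using reals_Archimedean2 by blast
      from elim(2) have "AE s in lborel. 0 < s \<and> s < real (Suc n) \<longrightarrow> X s \<omega> \<notin> N" by blast
      then obtain N' where N': "{s \<in> space lborel. \<not> (0 < s \<and> s < real (Suc n) \<longrightarrow> X s \<omega> \<notin> N)} \<subseteq> N'" "emeasure lborel N' = 0" "N' \<in> sets lborel"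
        by (rule AE_E)
      then have neg: "negligible (insert 0 N')" by (auto simp: negligible_iff_null_sets null_sets_completionI null_setsI)
      have "integral {0..t} (\<lambda>s. b (X s \<omega>)) = integral {0..t} (\<lambda>s. a (X s \<omega>))"
      proof (rule integral_spike[OF neg])
        fix s assume s: "s \<in> {0..t} - insert 0 N'"
        then have "0 < s" "s < real (Suc n)" using n by auto
        then show "a (X s \<omega>) = b (X s \<omega>)" using s N'(1) by (intro ab) auto
      qed
      then show "X t \<omega> = x + integral {0..t} (\<lambda>s. b (X s \<omega>)) + Z t \<omega>" using eq[OF elim(1) t] by simp
    qed
  qed
  moreover have "AE \<omega> in M. \<forall>t\<ge>0. continuous (at_right t) (\<lambda>t. X t \<omega>)" using AEA by eventually_elim (use right in auto)
  ultimately show ?thesis using XF unfolding solves_def by blast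
qed

lemma solves_imp_sde_solution:
  assumes X: "solves b x X" and b: "b \<in> borel_measurable borel" "\<And>z. \<bar>b z\<bar> \<le> B"
    and N: "N \<in> null_sets lebesgue" and ab: "\<And>z. z \<notin> N \<Longrightarrow> a z = b z"
  shows "sde_solution M F Z a x X"
proof -
  obtain A where A: "A \<in> sets M" "prob A = 1"
    and right: "\<And>\<omega> t. \<omega> \<in> A \<Longrightarrow> 0 \<le> t \<Longrightarrow> continuous (at_right t) (\<lambda>t. X t \<omega>)"
    and eq: "\<And>\<omega> t. \<omega> \<in> A \<Longrightarrow> 0 \<le> t \<Longrightarrow> X t \<omega> = x + integral {0..t} (\<lambda>s. b (X s \<omega>)) + Z t \<omega>"
    using solves_good_set[OF X] by blast
  have "AE \<omega> in M. (\<forall>T>0. set_integrable lebesgue {0..T} (\<lambda>s. a (X s \<omega>))) \<and>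
        (\<forall>t\<ge>0. X t \<omega> = x + (LINT s:{0..t}|lebesgue. a (X s \<omega>)) + Z t \<omega>)"
    using AE_good[OF A] solves_avoids_null[OF X b N]
  proof eventually_elim
    case (elim \<omega>)
    from elim(2) obtain N' where N': "{s \<in> space lborel. \<not> (0 < s \<longrightarrow> X s \<omega> \<notin> N)} \<subseteq> N'" "emeasure lborel N' = 0" "N' \<in> sets lborel"
      by (rule AE_E)
    then have neg: "negligible (insert 0 N')" by (auto simp: negligible_iff_null_sets null_sets_completionI null_setsI)
    have sp: "a (X s \<omega>) = b (X s \<omega>)" if "s \<in> {0..t} - insert 0 N'" for s t
    proof (rule ab)
      have "0 < s" using that by auto
      then show "X s \<omega> \<notin> N" using that N'(1) by auto
    qed
    have bi: "(\<lambda>s. b (X s \<omega>)) absolutely_integrable_on {0..t}" for t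
      by (rule drift_absolutely_integrable[where y="\<lambda>t. X t \<omega>" and b=b and B=B]) (use right elim(1) b in auto)
    have ai: "(\<lambda>s. a (X s \<omega>)) absolutely_integrable_on {0..t}" for t
      by (rule absolutely_integrable_spike[OF bi neg sp])
    have "(LINT s:{0..t}|lebesgue. a (X s \<omega>)) = integral {0..t} (\<lambda>s. b (X s \<omega>))" for t
      unfolding set_lebesgue_integral_eq_integral(2)[OF ai] by (rule integral_spike[OF neg]) (use sp in metis)
    then show ?case using ai eq[OF elim(1)] by simp
  qed
  then show ?thesis using X by (simp add: sde_solution_def adapted_def solves_def)
qed

end

section \<open>Monotone approximation by Lipschitz drifts\<close>

text \<open>The inf-convolution of \<open>g\<close> with \<open>k * \<bar>y - w\<bar>\<close> is
  Lipschitz with constant \<open>k\<close>. For \<open>k = 2 * B / \<delta>\<close>, points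
  \<open>w\<close> farther than \<open>\<delta>\<close> from \<open>y\<close> do not matter for the
  infimum, so \<open>f y\<close> is close to \<open>g y\<close> by uniform continuity.\<close>
lemma lipschitz_approximation:
  fixes g :: "real \<Rightarrow> real"
  assumes g: "continuous_on UNIV g" and B: "\<And>y. \<bar>g y\<bar> \<le> B" and e: "0 < e" and R: "0 \<le> R"
  obtains f :: "real \<Rightarrow> real" and L where "\<And>y y'. \<bar>f y - f y'\<bar> \<le> L * \<bar>y - y'\<bar>" "\<And>y. \<bar>f y\<bar> \<le> B"
    "\<And>y. \<bar>y\<bar> \<le> R \<Longrightarrow> \<bar>f y - g y\<bar> \<le> e"
proof -
  have B0: "0 \<le> B" using B[of 0] by linarith
  have "uniformly_continuous_on {- (R + 1)..R + 1} g"
    by (rule compact_uniformly_continuous) (use g continuous_on_subset in auto)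
  then obtain \<delta>0 where \<delta>0: "0 < \<delta>0" "\<And>y w. y \<in> {- (R + 1)..R + 1} \<Longrightarrow> w \<in> {- (R + 1)..R + 1} \<Longrightarrow> dist w y < \<delta>0 \<Longrightarrow> dist (g w) (g y) < e"
    unfolding uniformly_continuous_on_def using e by metis
  define \<delta> where "\<delta> = min 1 \<delta>0"
  have \<delta>: "0 < \<delta>" "\<delta> \<le> 1" "\<delta> \<le> \<delta>0" using \<delta>0 by (auto simp: \<delta>_def)
  define k where "k = 2 * B / \<delta>"
  have k0: "0 \<le> k" using B0 \<delta> by (simp add: k_def)
  define f where "f y = (INF w. g w + k * \<bar>y - w\<bar>)" for y
  have bdd: "bdd_below (range (\<lambda>w. g w + k * \<bar>y - w\<bar>))" for y
  proof (rule bdd_belowI2)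
    show "- B \<le> g w + k * \<bar>y - w\<bar>" for w using B[of w] k0 mult_nonneg_nonneg[OF k0 abs_ge_zero[of "y - w"]] by linarith
  qed
  have le: "f y \<le> g w + k * \<bar>y - w\<bar>" for y w unfolding f_def by (rule cINF_lower[OF bdd]) simp
  have ge: "c \<le> f y" if "\<And>w. c \<le> g w + k * \<bar>y - w\<bar>" for c y unfolding f_def by (rule cINF_greatest) (use that in auto)
  have one: "f y - f y' \<le> k * \<bar>y - y'\<bar>" for y y'
  proof -
    have "f y - k * \<bar>y - y'\<bar> \<le> f y'"
    proof (rule ge)
      fix w
      have "k * \<bar>y - w\<bar> \<le> k * (\<bar>y - y'\<bar> + \<bar>y' - w\<bar>)" using k0 by (intro mult_left_mono) auto
      then show "f y - k * \<bar>y - y'\<bar> \<le> g w + k * \<bar>y' - w\<bar>" using le[of y w] by (simp add: distrib_left)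
    qed
    then show ?thesis by simp
  qed
  show ?thesis
  proof (rule that[of f k])
    show "\<bar>f y - f y'\<bar> \<le> k * \<bar>y - y'\<bar>" for y y'
      using one[of y y'] one[of y' y] by (simp add: abs_le_iff abs_minus_commute)
    have fg: "f y \<le> g y" for y using le[of y y] by simp
    have "- B \<le> f y" for y
    proof (rule ge)
      show "- B \<le> g w + k * \<bar>y - w\<bar>" for w using B[of w] mult_nonneg_nonneg[OF k0 abs_ge_zero[of "y - w"]] by linarith
    qed
    then have "- B \<le> f y" for y .
    then show "\<bar>f y\<bar> \<le> B" for y using fg[of y] B[of y] abs_ge_self[of "g y"] by (simp add: abs_le_iff minus_le_iff)
    show "\<bar>f y - g y\<bar> \<le> e" if y: "\<bar>y\<bar> \<le> R" for y
    proof -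
      have "g y - e \<le> f y"
      proof (rule ge)
        fix w
        show "g y - e \<le> g w + k * \<bar>y - w\<bar>"
        proof (cases "\<bar>y - w\<bar> < \<delta>")
          case True
          then have "dist (g w) (g y) < e" using \<delta> y by (intro \<delta>0(2)) (auto simp: dist_real_def)
          then show ?thesis using mult_nonneg_nonneg[OF k0 abs_ge_zero[of "y - w"]] by (simp add: dist_real_def)
        next
          case False
          then have "k * \<delta> \<le> k * \<bar>y - w\<bar>" using k0 by (intro mult_left_mono) auto
          then have "2 * B \<le> k * \<bar>y - w\<bar>" using \<delta> by (simp add: k_def)
          then show ?thesis using B[of y] B[of w] e by linarith
        qed
      qed
      then show ?thesis using fg[of y] e by simp
    qed
  qed
qed

lemma lipschitz_sequence_approximation:
  fixes f :: "real \<Rightarrow> real"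
  assumes "f \<in> borel_measurable lebesgue" "AE z in lebesgue. \<bar>f z\<bar> \<le> B" "0 \<le> B"
  obtains \<phi> :: "nat \<Rightarrow> real \<Rightarrow> real" and L N where "\<And>n y y'. \<bar>\<phi> n y - \<phi> n y'\<bar> \<le> L n * \<bar>y - y'\<bar>" "\<And>n y. \<bar>\<phi> n y\<bar> \<le> B"
    "N \<in> null_sets lborel" "\<And>z. z \<notin> N \<Longrightarrow> (\<lambda>n. \<phi> n z) \<longlonglongrightarrow> f z"
proof -
  obtain \<psi> :: "nat \<Rightarrow> real \<Rightarrow> real" and N where \<psi>: "\<And>n. continuous_on UNIV (\<psi> n)" "\<And>n z. \<bar>\<psi> n z\<bar> \<le> B"
    and N: "N \<in> null_sets lborel" "\<And>z. z \<notin> N \<Longrightarrow> (\<lambda>n. \<psi> n z) \<longlonglongrightarrow> f z"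
    using assms by (rule continuous_approximation) (blast intro: that)
  have "\<exists>\<phi> L. (\<forall>y y'. \<bar>\<phi> y - \<phi> y'\<bar> \<le> L * \<bar>y - y'\<bar>) \<and> (\<forall>y. \<bar>\<phi> y\<bar> \<le> B) \<and> (\<forall>y. \<bar>y\<bar> \<le> real n \<longrightarrow> \<bar>\<phi> y - \<psi> n y\<bar> \<le> 1 / real (Suc n))" for n
    by (rule lipschitz_approximation[OF \<psi>(1)[of n] \<psi>(2)[of n], of "1 / real (Suc n)" "real n"]) (simp, simp, blast)
  then obtain \<phi> L where \<phi>: "\<And>n y y'. \<bar>\<phi> n y - \<phi> n y'\<bar> \<le> L n * \<bar>y - y'\<bar>" "\<And>n y. \<bar>\<phi> n y\<bar> \<le> B"
      "\<And>n y. \<bar>y\<bar> \<le> real n \<Longrightarrow> \<bar>\<phi> n y - \<psi> n y\<bar> \<le> 1 / real (Suc n)" by metis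
  show ?thesis
  proof (rule that[of \<phi> L N, OF \<phi>(1,2) N(1)])
    fix z assume z: "z \<notin> N"
    obtain m where m: "\<bar>z\<bar> \<le> real m" using real_arch_simple by blast
    have "(\<lambda>n. \<phi> n z - \<psi> n z) \<longlonglongrightarrow> 0"
    proof (rule Lim_null_comparison)
      show "\<forall>\<^sub>F n in sequentially. norm (\<phi> n z - \<psi> n z) \<le> 1 / real (Suc n)"
        using eventually_ge_at_top[of m]
      proof eventually_elim
        case (elim n)
        then have "\<bar>z\<bar> \<le> real n" using m by simp
        then show ?case using \<phi>(3) by simp
      qed
      show "(\<lambda>n. 1 / real (Suc n)) \<longlonglongrightarrow> 0" using LIMSEQ_inverse_real_of_nat by (simp add: inverse_eq_divide)
    qed
    from tendsto_add[OF this N(2)[OF z]] show "(\<lambda>n. \<phi> n z) \<longlonglongrightarrow> f z" by simp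
  qed
qed

text \<open>Minima over finite windows remain Lipschitz, unlike the infimum of the whole tail, which
  is only reached as a decreasing limit in \<open>k\<close>.\<close>
primrec window_min :: "(nat \<Rightarrow> real \<Rightarrow> real) \<Rightarrow> nat \<Rightarrow> nat \<Rightarrow> real \<Rightarrow> real" where
  "window_min a n 0 y = a n y"
| "window_min a n (Suc k) y = min (window_min a n k y) (a (n + Suc k) y)"

lemma window_min_bounds:
  "(\<And>j. n \<le> j \<Longrightarrow> j \<le> n + k \<Longrightarrow> l \<le> a j y) \<Longrightarrow> l \<le> window_min a n k y"
  "(\<And>j. n \<le> j \<Longrightarrow> j \<le> n + k \<Longrightarrow> a j y \<le> u) \<Longrightarrow> window_min a n k y \<le> u"
  by (induction k) (auto simp: min_le_iff_disj)

lemma window_min_shift: "window_min a n (Suc k) y \<le> window_min a (Suc n) k y"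
proof (induction k)
  case (Suc k)
  have "window_min a n (Suc (Suc k)) y = min (window_min a n (Suc k) y) (a (n + Suc (Suc k)) y)"
    by (rule window_min.simps(2))
  also have "\<dots> \<le> min (window_min a (Suc n) k y) (a (Suc n + Suc k) y)" using Suc by (intro min.mono) auto
  finally show ?case by simp
qed simp

lemma window_min_lipschitz:
  fixes a :: "nat \<Rightarrow> real \<Rightarrow> real"
  assumes "\<And>n y y'. \<bar>a n y - a n y'\<bar> \<le> L n * \<bar>y - y'\<bar>"
  shows "\<exists>L'. \<forall>y y'. \<bar>window_min a n k y - window_min a n k y'\<bar> \<le> L' * \<bar>y - y'\<bar>"
proof (induction k)
  case 0
  then show ?case using assms[of n] by auto
next
  case (Suc k)
  then obtain L' where L': "\<And>y y'. \<bar>window_min a n k y - window_min a n k y'\<bar> \<le> L' * \<bar>y - y'\<bar>" by blast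
  have "\<bar>window_min a n (Suc k) y - window_min a n (Suc k) y'\<bar> \<le> max L' (L (n + Suc k)) * \<bar>y - y'\<bar>" for y y'
  proof -
    have "L' * \<bar>y - y'\<bar> \<le> max L' (L (n + Suc k)) * \<bar>y - y'\<bar>" "L (n + Suc k) * \<bar>y - y'\<bar> \<le> max L' (L (n + Suc k)) * \<bar>y - y'\<bar>"
      by (intro mult_right_mono; simp)+
    then have "\<bar>window_min a n k y - window_min a n k y'\<bar> \<le> max L' (L (n + Suc k)) * \<bar>y - y'\<bar>"
      "\<bar>a (n + Suc k) y - a (n + Suc k) y'\<bar> \<le> max L' (L (n + Suc k)) * \<bar>y - y'\<bar>"
      using L'[of y y'] assms[of "n + Suc k" y y'] by linarith+
    then show ?thesis by (auto simp: min_def abs_le_iff)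
  qed
  then show ?case by blast
qed

text \<open>The decreasing limits over \<open>k\<close> are the infima of the tails, and their
  increasing limit \<open>c\<close> is the limit inferior of the sequence, which is a Borel function
  everywhere and the limit wherever that exists.\<close>
lemma window_min_limits:
  fixes a :: "nat \<Rightarrow> real \<Rightarrow> real"
  assumes m: "\<And>n. a n \<in> borel_measurable borel" and B: "\<And>n y. \<bar>a n y\<bar> \<le> B"
  obtains b :: "nat \<Rightarrow> real \<Rightarrow> real" and c where "\<And>n. b n \<in> borel_measurable borel" "c \<in> borel_measurable borel"
    "\<And>n y. \<bar>b n y\<bar> \<le> B" "\<And>y. \<bar>c y\<bar> \<le> B" "\<And>n y. (\<lambda>k. window_min a n k y) \<longlonglongrightarrow> b n y" "\<And>y. (\<lambda>n. b n y) \<longlonglongrightarrow> c y"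
    "\<And>y l. (\<lambda>n. a n y) \<longlonglongrightarrow> l \<Longrightarrow> c y = l"
proof -
  have wm: "window_min a n k \<in> borel_measurable borel" for n k
    by (induction k) (use m in \<open>simp_all add: window_min.simps[abs_def]\<close>)
  have lo: "- B \<le> a n y" and hi: "a n y \<le> B" for n y using B[of n y] by (auto simp: abs_le_iff)
  have wB: "- B \<le> window_min a n k y" "window_min a n k y \<le> B" for n k y
    using window_min_bounds(1)[of n k "- B" a y] window_min_bounds(2)[of n k a y B] lo hi by auto
  define b where "b n y = lim (\<lambda>k. window_min a n k y)" for n y
  have wlim: "(\<lambda>k. window_min a n k y) \<longlonglongrightarrow> b n y" for n y
  proof -
    have "convergent (\<lambda>k. window_min a n k y)"
      by (rule Bseq_monoseq_convergent)
         (use wB in \<open>auto intro!: BseqI'[of _ B] simp: abs_le_iff monoseq_Suc minus_le_iff\<close>)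
    then show ?thesis unfolding b_def by (simp add: convergent_LIMSEQ_iff)
  qed
  have bB: "- B \<le> b n y" "b n y \<le> B" for n y
    using LIMSEQ_le_const[OF wlim, of "- B"] LIMSEQ_le_const2[OF wlim, of _ _ B] wB by auto
  have bmono: "b n y \<le> b (Suc n) y" for n y
    by (rule LIMSEQ_le[OF LIMSEQ_Suc[OF wlim] wlim]) (use window_min_shift in blast)
  define c where "c y = lim (\<lambda>n. b n y)" for y
  have blim: "(\<lambda>n. b n y) \<longlonglongrightarrow> c y" for y
  proof -
    have "convergent (\<lambda>n. b n y)"
      by (rule Bseq_monoseq_convergent)
         (use bB bmono in \<open>auto intro!: BseqI'[of _ B] simp: abs_le_iff monoseq_Suc minus_le_iff\<close>)
    then show ?thesis unfolding c_def by (simp add: convergent_LIMSEQ_iff)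
  qed
  have cB: "- B \<le> c y" "c y \<le> B" for y
    using LIMSEQ_le_const[OF blim, of "- B"] LIMSEQ_le_const2[OF blim, of _ B] bB by auto
  have bm: "b n \<in> borel_measurable borel" for n by (rule borel_measurable_LIMSEQ_real[OF wlim wm])
  show ?thesis
  proof (rule that[of b c, OF bm _ _ _ wlim blim])
    show "c \<in> borel_measurable borel" by (rule borel_measurable_LIMSEQ_real[OF blim bm])
    show "\<bar>b n y\<bar> \<le> B" "\<bar>c y\<bar> \<le> B" for n y using bB[of n y] cB[of y] by (auto simp: abs_le_iff)
    fix y l assume l: "(\<lambda>n. a n y) \<longlonglongrightarrow> l"
    have "\<bar>c y - l\<bar> \<le> e" if e: "0 < e" for e
    proof -
      obtain J where J: "\<And>j. j \<ge> J \<Longrightarrow> \<bar>a j y - l\<bar> < e" using LIMSEQ_D[OF l e] by auto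
      have "l - e \<le> window_min a n k y" "window_min a n k y \<le> l + e" if "n \<ge> J" for n k
      proof -
        have "l - e \<le> a j y" "a j y \<le> l + e" if "n \<le> j" for j using J[of j] \<open>n \<ge> J\<close> that by auto
        then show "l - e \<le> window_min a n k y" "window_min a n k y \<le> l + e"
          by (auto intro!: window_min_bounds)
      qed
      then have "l - e \<le> b n y" "b n y \<le> l + e" if "n \<ge> J" for n
        using LIMSEQ_le_const[OF wlim, of "l - e"] LIMSEQ_le_const2[OF wlim, of n y "l + e"] that by auto
      then have "l - e \<le> c y" "c y \<le> l + e"
        using LIMSEQ_le_const[OF blim, of "l - e"] LIMSEQ_le_const2[OF blim, of y "l + e"] by auto
      then show ?thesis by (simp add: abs_le_iff)
    qed
    then have "\<bar>c y - l\<bar> \<le> 0" by (rule field_le_epsilon[of _ 0, simplified])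
    then show "c y = l" by simp
  qed
qed

section \<open>Lipschitz drifts along a single path\<close>

lemma exp_integral:
  fixes L :: real assumes "0 < L" "s \<le> t"
  shows "((\<lambda>u. L * exp (2 * L * u)) has_integral (exp (2 * L * t) - exp (2 * L * s)) / 2) {s..t}"
proof -
  have "((\<lambda>u. L * exp (2 * L * u)) has_integral exp (2 * L * t) / 2 - exp (2 * L * s) / 2) {s..t}"
    by (rule fundamental_theorem_of_calculus[OF assms(2)])
       (auto intro!: derivative_eq_intros simp: has_real_derivative_iff_has_vector_derivative[symmetric])
  then show ?thesis by (simp add: diff_divide_distrib)
qed

text \<open>If \<open>d = y1 - y2\<close> became positive, weigh it by \<open>exp (- 2 L t)\<close>
  and take a time \<open>t\<close> where the weighted difference is maximal, with value \<open>A >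
  0\<close>. Since the last time before \<open>t\<close> at which \<open>d \<le> 0\<close>, the
  difference grows at rate at most \<open>L * d s \<le> L * A * exp (2 L s)\<close>, hence gains at
  most \<open>A * exp (2 L t) / 2 = d t / 2\<close>, a contradiction.\<close>
lemma drift_comparison:
  fixes y1 y2 z f1 f2 :: "real \<Rightarrow> real"
  assumes r1: "\<And>t. 0 \<le> t \<Longrightarrow> continuous (at_right t) y1" and r2: "\<And>t. 0 \<le> t \<Longrightarrow> continuous (at_right t) y2"
    and e1: "\<And>t. 0 \<le> t \<Longrightarrow> y1 t = x + integral {0..t} (\<lambda>s. f1 (y1 s)) + z t"
    and e2: "\<And>t. 0 \<le> t \<Longrightarrow> y2 t = x + integral {0..t} (\<lambda>s. f2 (y2 s)) + z t"
    and m: "f1 \<in> borel_measurable borel" "f2 \<in> borel_measurable borel" and B: "\<And>u. \<bar>f1 u\<bar> \<le> B" "\<And>u. \<bar>f2 u\<bar> \<le> B"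
    and lip: "\<And>u v. \<bar>f1 u - f1 v\<bar> \<le> L * \<bar>u - v\<bar>" and le: "\<And>u. f1 u \<le> f2 u" and T: "0 \<le> T"
  shows "y1 T \<le> y2 T"
proof (rule ccontr)
  assume neg: "\<not> y1 T \<le> y2 T"
  define L' where "L' = max 1 L"
  have L': "0 < L'" by (simp add: L'_def)
  have lip': "\<bar>f1 u - f1 v\<bar> \<le> L' * \<bar>u - v\<bar>" for u v
    using lip[of u v] mult_right_mono[of L L' "\<bar>u - v\<bar>"] by (simp add: L'_def)
  have i1: "(\<lambda>s. f1 (y1 s)) integrable_on {s..t}" and i2: "(\<lambda>s. f2 (y2 s)) integrable_on {s..t}" if "0 \<le> s" for s t
    using drift_integrable[of y1 f1 B s t] drift_integrable[of y2 f2 B s t] r1 r2 m B that by auto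
  define g where "g s = f1 (y1 s) - f2 (y2 s)" for s
  have gi: "g integrable_on {s..t}" if "0 \<le> s" for s t unfolding g_def by (intro integrable_diff i1 i2 that)
  define d where "d s = y1 s - y2 s" for s
  have dg: "d t = integral {0..t} g" if "0 \<le> t" for t
    unfolding d_def g_def e1[OF that] e2[OF that] by (subst Henstock_Kurzweil_Integration.integral_diff[OF i1 i2]) auto
  have dc: "continuous_on {0..T} d"
    using indefinite_integral_continuous_1[OF gi[of 0 T]] by (rule continuous_on_eq) (use dg in auto)
  have dT: "0 < d T" using neg by (simp add: d_def)
  have "\<exists>t\<in>{0..T}. \<forall>s\<in>{0..T}. exp (- (2 * L' * s)) * d s \<le> exp (- (2 * L' * t)) * d t"
    by (rule continuous_attains_sup) (use T in \<open>auto intro!: continuous_intros dc\<close>)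
  then obtain t where t: "t \<in> {0..T}" and tmax: "\<And>s. s \<in> {0..T} \<Longrightarrow> exp (- (2 * L' * s)) * d s \<le> exp (- (2 * L' * t)) * d t" by blast
  define A where "A = exp (- (2 * L' * t)) * d t"
  have "0 < exp (- (2 * L' * T)) * d T" using dT by simp
  also have "\<dots> \<le> A" unfolding A_def by (rule tmax) (use T in simp)
  finally have A: "0 < A" .
  have dt: "d t = A * exp (2 * L' * t)" by (simp add: A_def exp_minus)
  have dA: "d s \<le> A * exp (2 * L' * s)" if "s \<in> {0..T}" for s
    using tmax[OF that] unfolding A_def[symmetric] by (simp add: exp_minus field_simps)
  have dt0: "0 < d t" unfolding dt using A by simp
  define S where "S = {s \<in> {0..t}. d s \<le> 0}"
  have dct: "continuous_on {0..t} d" using dc by (rule continuous_on_subset) (use t in auto)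
  have "compact S"
  proof -
    have "S = {0..t} \<inter> d -` {..0}" by (auto simp: S_def)
    moreover have "closed ({0..t} \<inter> d -` {..0})" by (rule continuous_closed_preimage[OF dct]) auto
    ultimately have "closed S" by simp
    moreover have "bounded S" by (rule bounded_subset[of "{0..t}"]) (auto simp: S_def)
    ultimately show ?thesis by (simp add: compact_eq_bounded_closed)
  qed
  moreover have "0 \<in> S" using t dg[of 0] by (auto simp: S_def)
  ultimately obtain s0 where s0: "s0 \<in> S" and s0max: "\<And>s. s \<in> S \<Longrightarrow> s \<le> s0"
    using compact_attains_sup[of S] by blast
  have s0t: "0 \<le> s0" "s0 \<le> t" "d s0 \<le> 0" using s0 by (auto simp: S_def)
  have pos: "0 \<le> d s" if s: "s \<in> {s0..t}" for s
  proof (cases "s = s0")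
    case False
    then have "s \<notin> S" using s0max[of s] s by auto
    then show ?thesis using s s0t by (auto simp: S_def)
  next
    case True
    have "\<exists>u\<ge>s0. u \<le> t \<and> d u = 0"
      by (rule IVT') (use s0t dt0 in \<open>auto intro: continuous_on_subset[OF dct]\<close>)
    then obtain u where u: "s0 \<le> u" "u \<le> t" "d u = 0" by blast
    then have "u \<in> S" using s0t by (auto simp: S_def)
    then have "u = s0" using s0max[of u] u by simp
    then show ?thesis using u True by simp
  qed
  have "d t - d s0 = integral {s0..t} g"
    using integral_increment[OF s0t(1,2) gi[of 0]] dg s0t by simp
  also have "\<dots> \<le> A * ((exp (2 * L' * t) - exp (2 * L' * s0)) / 2)"
  proof (rule has_integral_le[OF integrable_integral[OF gi[OF s0t(1)]] has_integral_mult_right[OF exp_integral[OF L' s0t(2)]]])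
    fix s assume s: "s \<in> {s0..t}"
    have "g s \<le> f1 (y1 s) - f1 (y2 s)" using le[of "y2 s"] by (simp add: g_def)
    also have "\<dots> \<le> L' * \<bar>d s\<bar>" using lip'[of "y1 s" "y2 s"] by (simp add: d_def abs_le_iff)
    also have "\<dots> = L' * d s" using pos[OF s] by simp
    also have "\<dots> \<le> L' * (A * exp (2 * L' * s))" using L' dA[of s] s s0t t by (intro mult_left_mono) auto
    finally show "g s \<le> A * (L' * exp (2 * L' * s))" by (simp add: mult_ac)
  qed
  also have "\<dots> \<le> A * exp (2 * L' * t) / 2" using A by (simp add: field_simps)
  finally show False using s0t(3) dt0 unfolding dt by simp
qed

text \<open>The integral of a right-continuous function, written so that it depends measurably on
  the values of \<open>f\<close> for all functions \<open>f\<close>: \<open>lim\<close> of a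
  sequence of measurable functions is measurable whether or not the limit exists.\<close>
definition riemann_limit :: "(real \<Rightarrow> real) \<Rightarrow> real \<Rightarrow> real" where
  "riemann_limit f t = lim (\<lambda>m. \<Sum>i<Suc m. (t / real (Suc m)) * f (real (Suc i) * (t / real (Suc m))))"

lemma riemann_limit_eq_integral:
  fixes f :: "real \<Rightarrow> real"
  assumes f: "\<And>s. 0 \<le> s \<Longrightarrow> continuous (at_right s) f" and B: "\<And>s. \<bar>f s\<bar> \<le> B" and t: "0 \<le> t"
  shows "riemann_limit f t = integral {0..t} f"
proof (cases "t = 0")
  case True
  then show ?thesis by (simp add: riemann_limit_def)
next
  case False
  then have t: "0 < t" using t by simp
  define h where "h m = t / real (Suc m)" for m
  have h: "0 < h m" and hT: "real (Suc m) * h m = t" for m using t by (auto simp: h_def)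
  define c where "c m i = f (real (Suc i) * h m)" for m i
  have step: "((\<lambda>s. 1 * c m (min (nat \<lfloor>s / h m\<rfloor>) m)) has_integral (\<Sum>i<Suc m. h m * c m i)) {0..t}" for m
  proof -
    have "(\<lambda>s. 1 :: real) integrable_on {0..real (Suc m) * h m}" by (rule integrable_const_ivl)
    from step_has_integral[OF h[of m] this, of "c m"]
    have "((\<lambda>s. 1 * c m (min (nat \<lfloor>s / h m\<rfloor>) m)) has_integral (\<Sum>i<Suc m. integral {real i * h m..real (Suc i) * h m} (\<lambda>_. 1) * c m i)) {0..t}"
      unfolding hT .
    moreover have "integral {real i * h m..real (Suc i) * h m} (\<lambda>_. 1 :: real) = h m" for i
    proof -
      have "real i * h m \<le> real (Suc i) * h m" using h[of m] by (intro mult_right_mono) auto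
      then show ?thesis by (simp add: algebra_simps)
    qed
    ultimately show ?thesis by simp
  qed
  have "(\<lambda>m. integral {0..t} (\<lambda>s. 1 * c m (min (nat \<lfloor>s / h m\<rfloor>) m))) \<longlonglongrightarrow> integral {0..t} f"
  proof (rule dominated_convergence(2)[where h="\<lambda>_. B"])
    fix s assume s: "s \<in> {0..t}"
    define k where "k m = min (nat \<lfloor>s / h m\<rfloor>) m" for m
    note gb = grid_bracket[OF t s h_def k_def]
    note kb = gb(2,3) and s1 = gb(5)
    have "(\<lambda>m. f (real (Suc (k m)) * h m)) \<longlonglongrightarrow> f s"
      by (rule right_continuous_seq[OF f]) (use s kb(2) s1 in auto)
    then show "(\<lambda>m. 1 * c m (min (nat \<lfloor>s / h m\<rfloor>) m)) \<longlonglongrightarrow> f s" unfolding c_def k_def by simp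
  qed (use step B in \<open>auto simp: has_integral_integrable c_def\<close>)
  then have "(\<lambda>m. \<Sum>i<Suc m. h m * c m i) \<longlonglongrightarrow> integral {0..t} f" unfolding integral_unique[OF step] .
  then show ?thesis unfolding riemann_limit_def h_def c_def by (rule limI)
qed

text \<open>Using \<open>riemann_limit\<close> makes each iterate a measurable function of the path
  up to time \<open>t\<close>, without restriction to the event of right-continuous paths. Such a
  restriction would involve the future and thereby leave the natural filtration.\<close>
primrec picard :: "real \<Rightarrow> (real \<Rightarrow> real) \<Rightarrow> nat \<Rightarrow> (real \<Rightarrow> real) \<Rightarrow> real \<Rightarrow> real" where
  "picard x f 0 z t = x + z t"
| "picard x f (Suc j) z t = x + riemann_limit (\<lambda>s. f (picard x f j z s)) t + z t"

text \<open>The weight \<open>exp (2 L t)\<close> makes the iteration a contraction with factor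
  \<open>1 / 2\<close> on the whole half-line.\<close>
lemma picard_converges:
  fixes f z :: "real \<Rightarrow> real" and x :: real
  assumes z: "\<And>t. 0 \<le> t \<Longrightarrow> continuous (at_right t) z" and B: "\<And>u. \<bar>f u\<bar> \<le> B"
    and lip: "\<And>u v. \<bar>f u - f v\<bar> \<le> L * \<bar>u - v\<bar>"
  defines "y \<equiv> \<lambda>t. lim (\<lambda>j. picard x f j z t)"
  shows "0 \<le> t \<Longrightarrow> y t = x + integral {0..t} (\<lambda>s. f (y s)) + z t"
    and "0 \<le> t \<Longrightarrow> continuous (at_right t) y"
proof -
  define L' where "L' = max 1 L"
  have L': "1 \<le> L'" by (simp add: L'_def)
  have lip': "\<bar>f u - f v\<bar> \<le> L' * \<bar>u - v\<bar>" for u v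
    using lip[of u v] mult_right_mono[of L L' "\<bar>u - v\<bar>"] by (simp add: L'_def)
  have B0: "0 \<le> B" using B[of 0] by linarith
  have fc: "continuous_on UNIV f"
    by (rule lipschitz_on_continuous_on[of L'], rule lipschitz_onI) (use lip' L' in \<open>auto simp: dist_real_def\<close>)
  have fm: "f \<in> borel_measurable borel" using fc by (rule borel_measurable_continuous_onI)
  have fcont: "isCont f u" for u using fc by (simp add: continuous_on_eq_continuous_at)
  have fr: "continuous (at_right s) (\<lambda>s. f (w s))" if "continuous (at_right s) w" for w :: "real \<Rightarrow> real" and s
    using that isCont_tendsto_compose[OF fcont[of "w s"], of w "at_right s"] by (simp add: continuous_within)
  have inv: "(\<forall>t\<ge>0. continuous (at_right t) (picard x f j z)) \<and>
      (\<forall>t\<ge>0. picard x f (Suc j) z t = x + integral {0..t} (\<lambda>s. f (picard x f j z s)) + z t)" for j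
  proof (induction j)
    case 0
    have 1: "continuous (at_right t) (picard x f 0 z)" if "0 \<le> t" for t
    proof -
      have "picard x f 0 z = (\<lambda>t. x + z t)" by (rule ext) simp
      then show ?thesis using z[OF that] by (auto intro!: continuous_intros)
    qed
    then have 2: "riemann_limit (\<lambda>s. f (picard x f 0 z s)) t = integral {0..t} (\<lambda>s. f (picard x f 0 z s))" if "0 \<le> t" for t
      by (intro riemann_limit_eq_integral[where B=B] fr B that)
    show ?case
    proof (intro conjI allI impI)
      show "continuous (at_right t) (picard x f 0 z)" if "0 \<le> t" for t by (rule 1[OF that])
      show "picard x f (Suc 0) z t = x + integral {0..t} (\<lambda>s. f (picard x f 0 z s)) + z t" if "0 \<le> t" for t
        using 2[OF that] by (simp only: picard.simps(2))
    qed
  next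
    case (Suc j)
    have 1: "continuous (at_right t) (picard x f (Suc j) z)" if "0 \<le> t" for t
    proof (rule right_continuous_plus_integral[OF _ z _ that])
      show "(\<lambda>s. f (picard x f j z s)) integrable_on {0..t}" for t
        by (rule drift_integrable[OF _ fm B]) (use Suc in auto)
      show "picard x f (Suc j) z t = x + integral {0..t} (\<lambda>s. f (picard x f j z s)) + z t" if "0 \<le> t" for t using Suc that by blast
    qed
    then have 2: "riemann_limit (\<lambda>s. f (picard x f (Suc j) z s)) t = integral {0..t} (\<lambda>s. f (picard x f (Suc j) z s))" if "0 \<le> t" for t
      by (intro riemann_limit_eq_integral[where B=B] fr B that)
    show ?case
    proof (intro conjI allI impI)
      show "continuous (at_right t) (picard x f (Suc j) z)" if "0 \<le> t" for t by (rule 1[OF that])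
      show "picard x f (Suc (Suc j)) z t = x + integral {0..t} (\<lambda>s. f (picard x f (Suc j) z s)) + z t" if "0 \<le> t" for t
        using 2[OF that] by (simp only: picard.simps(2)[of x f "Suc j"])
    qed
  qed
  have pr: "continuous (at_right t) (picard x f j z)" and peq: "picard x f (Suc j) z t = x + integral {0..t} (\<lambda>s. f (picard x f j z s)) + z t"
    if "0 \<le> t" for t j using inv that by blast+
  have pint: "(\<lambda>s. f (picard x f j z s)) integrable_on {0..t}" for j t
    by (rule drift_integrable[OF pr fm B]) auto
  have step: "\<bar>picard x f (Suc j) z t - picard x f j z t\<bar> \<le> B * (1 / 2) ^ j * exp (2 * L' * t)" if "0 \<le> t" for j t
    using that
  proof (induction j arbitrary: t)
    case 0
    have "\<bar>picard x f (Suc 0) z t - picard x f 0 z t\<bar> = \<bar>integral {0..t} (\<lambda>s. f (picard x f 0 z s))\<bar>"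
      using peq[OF 0, of 0] by simp
    also have "\<dots> \<le> B * (t - 0)" by (rule integral_increment_bound[OF 0 pint B])
    also have "\<dots> \<le> B * exp (2 * L' * t)"
    proof (rule mult_left_mono[OF _ B0])
      have "t \<le> 2 * L' * t" using 0 L' mult_right_mono[of 1 "2 * L'" t] by simp
      also have "\<dots> \<le> exp (2 * L' * t)" using exp_ge_add_one_self[of "2 * L' * t"] by linarith
      finally show "t - 0 \<le> exp (2 * L' * t)" by simp
    qed
    finally show ?case by simp
  next
    case (Suc j)
    have "picard x f (Suc (Suc j)) z t - picard x f (Suc j) z t = integral {0..t} (\<lambda>s. f (picard x f (Suc j) z s) - f (picard x f j z s))"
      unfolding peq[OF Suc.prems] by (subst Henstock_Kurzweil_Integration.integral_diff[OF pint pint]) simp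
    also have "\<bar>\<dots>\<bar> \<le> integral {0..t} (\<lambda>s. (B * (1 / 2) ^ j) * (L' * exp (2 * L' * s)))"
    proof (rule integral_norm_bound_integral[where 'a=real, unfolded real_norm_def])
      show "(\<lambda>s. f (picard x f (Suc j) z s) - f (picard x f j z s)) integrable_on {0..t}" by (intro integrable_diff pint)
      show "(\<lambda>s. (B * (1 / 2) ^ j) * (L' * exp (2 * L' * s))) integrable_on {0..t}"
        using has_integral_mult_right[OF exp_integral[of L' 0 t]] L' Suc.prems by (auto simp: has_integral_integrable)
      fix s assume s: "s \<in> {0..t}"
      have "\<bar>f (picard x f (Suc j) z s) - f (picard x f j z s)\<bar> \<le> L' * \<bar>picard x f (Suc j) z s - picard x f j z s\<bar>" by (rule lip')
      also have "\<dots> \<le> L' * (B * (1 / 2) ^ j * exp (2 * L' * s))" using Suc.IH[of s] s L' by (intro mult_left_mono) auto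
      finally show "\<bar>f (picard x f (Suc j) z s) - f (picard x f j z s)\<bar> \<le> (B * (1 / 2) ^ j) * (L' * exp (2 * L' * s))" by (simp add: mult_ac)
    qed
    also have "\<dots> = (B * (1 / 2) ^ j) * ((exp (2 * L' * t) - exp (2 * L' * 0)) / 2)"
      using L' Suc.prems by (intro integral_unique has_integral_mult_right exp_integral) auto
    also have "\<dots> \<le> (B * (1 / 2) ^ j) * (exp (2 * L' * t) / 2)" using B0 by (intro mult_left_mono) auto
    finally show ?case by simp
  qed
  have conv: "(\<lambda>j. picard x f j z t) \<longlonglongrightarrow> y t" if t: "0 \<le> t" for t
  proof -
    have "summable (\<lambda>j. picard x f (Suc j) z t - picard x f j z t)"
    proof (rule summable_comparison_test')
      show "summable (\<lambda>j. B * exp (2 * L' * t) * (1 / 2) ^ j)" by (intro summable_mult summable_geometric) simp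
      show "norm (picard x f (Suc n) z t - picard x f n z t) \<le> B * exp (2 * L' * t) * (1 / 2) ^ n" if "n \<ge> 0" for n
        using step[OF t, of n] by (simp add: mult_ac)
    qed
    then have "convergent (\<lambda>n. \<Sum>j<n. picard x f (Suc j) z t - picard x f j z t)" by (simp add: summable_iff_convergent)
    then have "convergent (\<lambda>n. picard x f n z t - picard x f 0 z t)" unfolding sum_lessThan_telescope[of "\<lambda>j. picard x f j z t"] .
    then have "convergent (\<lambda>n. picard x f n z t)" using convergent_diff_const_right_iff by blast
    then show ?thesis unfolding y_def by (simp add: convergent_LIMSEQ_iff)
  qed
  have lim: "(\<lambda>s. f (y s)) integrable_on {0..t} \<and> (\<lambda>j. integral {0..t} (\<lambda>s. f (picard x f j z s))) \<longlonglongrightarrow> integral {0..t} (\<lambda>s. f (y s))" for t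
    using dominated_convergence[of "\<lambda>j s. f (picard x f j z s)" "{0..t}" "\<lambda>_. B" "\<lambda>s. f (y s)"] pint B
      isCont_tendsto_compose[OF fcont conv] by auto
  have eq: "y t = x + integral {0..t} (\<lambda>s. f (y s)) + z t" if t: "0 \<le> t" for t
  proof (rule LIMSEQ_unique)
    show "(\<lambda>j. picard x f (Suc j) z t) \<longlonglongrightarrow> y t" using conv[OF t] by (rule LIMSEQ_Suc)
    show "(\<lambda>j. picard x f (Suc j) z t) \<longlonglongrightarrow> x + integral {0..t} (\<lambda>s. f (y s)) + z t"
      unfolding peq[OF t] by (intro tendsto_intros) (use lim in blast)
  qed
  then show "0 \<le> t \<Longrightarrow> y t = x + integral {0..t} (\<lambda>s. f (y s)) + z t" .
  show "0 \<le> t \<Longrightarrow> continuous (at_right t) y"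
    by (rule right_continuous_plus_integral[OF _ z eq]) (use lim in auto)
qed

lemma picard_measurable:
  fixes Z :: "real \<Rightarrow> 'w \<Rightarrow> real"
  assumes f[measurable]: "f \<in> borel_measurable borel" and Z: "\<And>s. 0 \<le> s \<Longrightarrow> s \<le> t \<Longrightarrow> Z s \<in> borel_measurable H" and t: "0 \<le> t"
  shows "(\<lambda>\<omega>. picard x f j (\<lambda>s. Z s \<omega>) t) \<in> borel_measurable H"
  using Z t
proof (induction j arbitrary: t)
  case 0
  then show ?case by simp
next
  case (Suc j)
  have m: "(\<lambda>\<omega>. f (picard x f j (\<lambda>s. Z s \<omega>) (real (Suc i) * (t / real (Suc m))))) \<in> borel_measurable H" if "i < Suc m" for i m
  proof (rule measurable_compose[OF Suc.IH f])
    have "real (Suc i) * (t / real (Suc m)) \<le> real (Suc m) * (t / real (Suc m))"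
      using that Suc.prems by (intro mult_right_mono) auto
    then have "real (Suc i) * (t / real (Suc m)) \<le> t" by simp
    then show "\<And>s. 0 \<le> s \<Longrightarrow> s \<le> real (Suc i) * (t / real (Suc m)) \<Longrightarrow> Z s \<in> borel_measurable H" using Suc.prems(1) by simp
    show "0 \<le> real (Suc i) * (t / real (Suc m))" using Suc.prems by simp
  qed
  have "(\<lambda>\<omega>. riemann_limit (\<lambda>s. f (picard x f j (\<lambda>s. Z s \<omega>) s)) t) \<in> borel_measurable H"
    unfolding riemann_limit_def
    by (intro borel_measurable_lim_metric borel_measurable_sum borel_measurable_times borel_measurable_const m) auto
  then show ?case using Suc.prems by simp
qed

section \<open>Existence\<close>

text \<open>Neither \<open>c\<close> nor the \<open>b k\<close> need be continuous, so pointwise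
  convergence of \<open>b k\<close> to \<open>c\<close> and of \<open>V k\<close> to
  \<open>U\<close> is not enough. The laws of the \<open>V k\<close> and of \<open>U\<close> charge
  sets of small Lebesgue measure little, uniformly in \<open>k\<close>. Outside an open set
  \<open>G\<close> of small measure (and inside a large interval), \<open>b k\<close> is uniformly
  close to \<open>c\<close>, and \<open>c\<close> is uniformly close to a continuous function
  \<open>\<phi> j\<close>; for \<open>\<phi> j\<close> the convergence is clear.\<close>
lemma composition_converges:
  fixes V :: "nat \<Rightarrow> 'a \<Rightarrow> real" and U W :: "'a \<Rightarrow> real" and b :: "nat \<Rightarrow> real \<Rightarrow> real" and c :: "real \<Rightarrow> real"
  assumes N: "finite_measure N" and V[measurable]: "\<And>k. V k \<in> borel_measurable N" and U[measurable]: "U \<in> borel_measurable N"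
    and W[measurable]: "W \<in> borel_measurable N"
    and lim: "\<And>z. z \<in> space N \<Longrightarrow> (\<lambda>k. V k z) \<longlonglongrightarrow> U z" and dom: "\<And>k z. z \<in> space N \<Longrightarrow> \<bar>V k z\<bar> \<le> W z"
    and b[measurable]: "\<And>k. b k \<in> borel_measurable borel" and c[measurable]: "c \<in> borel_measurable borel"
    and B: "\<And>k y. \<bar>b k y\<bar> \<le> B" and bc: "\<And>y. (\<lambda>k. b k y) \<longlonglongrightarrow> c y"
    and C: "0 \<le> C" and \<theta>: "0 < \<theta>"
    and occV: "\<And>k G m. open G \<Longrightarrow> emeasure lborel G = ennreal m \<Longrightarrow> 0 \<le> m \<Longrightarrow> measure N {z \<in> space N. V k z \<in> G} \<le> C * m powr \<theta>"
    and occU: "\<And>G m. open G \<Longrightarrow> emeasure lborel G = ennreal m \<Longrightarrow> 0 \<le> m \<Longrightarrow> measure N {z \<in> space N. U z \<in> G} \<le> C * m powr \<theta>"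
  shows "(\<lambda>k. \<integral>z. \<bar>b k (V k z) - c (U z)\<bar> \<partial>N) \<longlonglongrightarrow> 0"
proof (rule LIMSEQ_I)
  interpret N: finite_measure N by fact
  fix e :: real assume e: "0 < e"
  have B0: "0 \<le> B" using B[of 0 0] by linarith
  have cB: "\<bar>c y\<bar> \<le> B" for y by (rule LIMSEQ_le_const2[OF tendsto_rabs[OF bc]]) (use B in auto)
  define \<mu> where "\<mu> = measure N (space N)"
  have \<mu>0: "0 \<le> \<mu>" by (simp add: \<mu>_def)
  define \<epsilon> where "\<epsilon> = e / (2 * (3 * \<mu> + 6 * B + 1))"
  have \<epsilon>: "0 < \<epsilon>" using e \<mu>0 B0 by (simp add: \<epsilon>_def)
  have \<epsilon>e: "(3 * \<mu> + 6 * B) * \<epsilon> < e / 2"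
  proof -
    have "(3 * \<mu> + 6 * B) * \<epsilon> < (3 * \<mu> + 6 * B + 1) * \<epsilon>" using \<epsilon> by simp
    also have "\<dots> = e / 2" using \<mu>0 B0 by (simp add: \<epsilon>_def field_simps add_nonneg_eq_0_iff)
    finally show ?thesis .
  qed
  \<comment> \<open>The dominating function \<open>W\<close> confines all values to \<open>{-
    R..R}\<close> off a set of small measure, which makes the bad sets \<open>S j\<close> below of
    finite Lebesgue measure.\<close>
  have "(\<lambda>n. measure N {z \<in> space N. real n < W z}) \<longlonglongrightarrow> measure N (\<Inter>n. {z \<in> space N. real n < W z})"
    by (rule N.finite_Lim_measure_decseq) (auto simp: decseq_def)
  moreover have "(\<Inter>n. {z \<in> space N. real n < W z}) = {}"
  proof -
    have "\<exists>n. \<not> real n < W z" for z using real_arch_simple[of "W z"] by (auto simp: not_less)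
    then show ?thesis by blast
  qed
  ultimately have "(\<lambda>n. measure N {z \<in> space N. real n < W z}) \<longlonglongrightarrow> 0" by simp
  then have "\<forall>\<^sub>F n in sequentially. measure N {z \<in> space N. real n < W z} < \<epsilon>" using \<epsilon> by (rule order_tendstoD)
  then obtain R where R: "measure N {z \<in> space N. real R < W z} < \<epsilon>" unfolding eventually_sequentially by blast
  have "c \<in> borel_measurable lebesgue" "AE z in lebesgue. \<bar>c z\<bar> \<le> B" using cB by (auto intro: measurable_completion)
  then obtain \<phi> :: "nat \<Rightarrow> real \<Rightarrow> real" and N0 where \<phi>: "\<And>n. continuous_on UNIV (\<phi> n)" "\<And>n z. \<bar>\<phi> n z\<bar> \<le> B"
    "N0 \<in> null_sets lborel" "\<And>z. z \<notin> N0 \<Longrightarrow> (\<lambda>n. \<phi> n z) \<longlonglongrightarrow> c z"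
    using B0 by (rule continuous_approximation) (blast intro: that)
  have \<phi>m[measurable]: "\<phi> n \<in> borel_measurable borel" for n using \<phi>(1) by (rule borel_measurable_continuous_onI)
  have \<phi>c: "isCont (\<phi> n) y" for n y using \<phi>(1) by (simp add: continuous_on_eq_continuous_at)
  \<comment> \<open>The sets of slow convergence, as in the proof of the theorem of Egorov. They
    decrease to a null set, and \<open>\<delta>\<close> is chosen so that an open set of measure at
    most \<open>2 * \<delta>\<close> is charged by at most \<open>\<epsilon>\<close>.\<close>
  define S where "S j = {y \<in> space borel. y \<in> {- real R..real R} \<and> (\<exists>k. j \<le> k \<and> (\<epsilon> < \<bar>b k y - c y\<bar> \<or> \<epsilon> < \<bar>\<phi> k y - c y\<bar>))}" for j
  have S[measurable]: "S j \<in> sets borel" for j unfolding S_def by measurable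
  define \<delta> where "\<delta> = (\<epsilon> / (C + 1)) powr (1 / \<theta>) / 2"
  have \<delta>: "0 < \<delta>" using \<epsilon> C by (simp add: \<delta>_def)
  have C\<delta>: "C * (2 * \<delta>) powr \<theta> \<le> \<epsilon>"
  proof -
    have "(2 * \<delta>) powr \<theta> = \<epsilon> / (C + 1)" using \<epsilon> C \<theta> by (simp add: \<delta>_def powr_powr)
    moreover have "C * (\<epsilon> / (C + 1)) \<le> (C + 1) * (\<epsilon> / (C + 1))" using \<epsilon> C by (intro mult_right_mono) auto
    ultimately show ?thesis using C by simp
  qed
  have "(\<lambda>j. emeasure lborel (S j)) \<longlonglongrightarrow> emeasure lborel (\<Inter>j. S j)"
  proof (rule Lim_emeasure_decseq)
    show "decseq S" unfolding decseq_def S_def by (auto intro: order_trans)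
    have "emeasure lborel (S j) \<le> emeasure lborel {- real R..real R}" for j by (intro emeasure_mono) (auto simp: S_def)
    also have "emeasure lborel {- real R..real R} < \<infinity>" by (simp add: emeasure_lborel_Icc_eq)
    finally show "emeasure lborel (S j) \<noteq> \<infinity>" for j by (simp add: less_top)
  qed auto
  moreover have "emeasure lborel (\<Inter>j. S j) = 0"
  proof -
    have "(\<Inter>j. S j) \<subseteq> N0"
    proof
      fix y assume y: "y \<in> (\<Inter>j. S j)"
      show "y \<in> N0"
      proof (rule ccontr)
        assume "y \<notin> N0"
        from LIMSEQ_D[OF \<phi>(4)[OF this] \<epsilon>] obtain j1 where j1: "\<And>k. k \<ge> j1 \<Longrightarrow> \<bar>\<phi> k y - c y\<bar> < \<epsilon>" by auto
        from LIMSEQ_D[OF bc \<epsilon>] obtain j2 where j2: "\<And>k. k \<ge> j2 \<Longrightarrow> \<bar>b k y - c y\<bar> < \<epsilon>" by auto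
        have "y \<in> S (max j1 j2)" using y by blast
        then obtain k where "max j1 j2 \<le> k" "\<epsilon> < \<bar>b k y - c y\<bar> \<or> \<epsilon> < \<bar>\<phi> k y - c y\<bar>" unfolding S_def by blast
        then show False using j1[of k] j2[of k] by auto
      qed
    qed
    then have "emeasure lborel (\<Inter>j. S j) \<le> emeasure lborel N0" using \<phi>(3) by (intro emeasure_mono) auto
    then show ?thesis using \<phi>(3) by (simp add: null_sets_def)
  qed
  ultimately have "(\<lambda>j. emeasure lborel (S j)) \<longlonglongrightarrow> 0" by simp
  then have "\<forall>\<^sub>F j in sequentially. emeasure lborel (S j) < ennreal \<delta>" by (rule order_tendstoD(2)) (use \<delta> in simp)
  then obtain j where j: "emeasure lborel (S j) < ennreal \<delta>" unfolding eventually_sequentially by blast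
  from outer_regular_lborel[OF S[of j] \<delta>] obtain G where G: "open G" "S j \<subseteq> G" "emeasure lborel (G - S j) < ennreal \<delta>" by blast
  have Gb[measurable]: "G \<in> sets borel" using G by simp
  have "emeasure lborel G \<le> emeasure lborel (G - S j) + emeasure lborel (S j)"
    using G by (intro order_trans[OF _ emeasure_subadditive] emeasure_mono) auto
  also have "\<dots> < ennreal \<delta> + ennreal \<delta>" using G(3) j by (rule add_strict_mono)
  also have "\<dots> = ennreal (2 * \<delta>)" using \<delta> by (simp add: ennreal_plus[symmetric])
  finally have Glt: "emeasure lborel G < ennreal (2 * \<delta>)" .
  then obtain m where m: "emeasure lborel G = ennreal m" "0 \<le> m" by (cases "emeasure lborel G") auto
  then have "m \<le> 2 * \<delta>" using Glt \<delta> by (simp add: ennreal_less_iff)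
  then have Cm: "C * m powr \<theta> \<le> \<epsilon>"
    using m(2) C \<theta> by (intro order_trans[OF _ C\<delta>] mult_left_mono powr_mono2) auto
  define J where "J k = (\<integral>z. \<bar>\<phi> j (V k z) - \<phi> j (U z)\<bar> \<partial>N)" for k
  have bdi: "integrable N f" if "f \<in> borel_measurable N" "\<And>z. \<bar>f z\<bar> \<le> D" for f :: "'a \<Rightarrow> real" and D
    by (rule N.integrable_const_bound[where B=D]) (use that in auto)
  have two: "\<bar>u - v\<bar> \<le> 2 * B" if "\<bar>u\<bar> \<le> B" "\<bar>v\<bar> \<le> B" for u v :: real using that by linarith
  have J0: "J \<longlonglongrightarrow> 0"
  proof -
    have "J \<longlonglongrightarrow> (\<integral>z. 0 \<partial>N)" unfolding J_def
    proof (rule integral_dominated_convergence[where w="\<lambda>_. 2 * B"])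
      show "AE z in N. (\<lambda>k. \<bar>\<phi> j (V k z) - \<phi> j (U z)\<bar>) \<longlonglongrightarrow> 0"
      proof (rule AE_I2)
        fix z assume "z \<in> space N"
        have "(\<lambda>k. \<phi> j (V k z) - \<phi> j (U z)) \<longlonglongrightarrow> \<phi> j (U z) - \<phi> j (U z)"
          by (intro tendsto_diff tendsto_const isCont_tendsto_compose[OF \<phi>c lim]) fact
        then show "(\<lambda>k. \<bar>\<phi> j (V k z) - \<phi> j (U z)\<bar>) \<longlonglongrightarrow> 0" by (auto intro: tendsto_rabs_zero)
      qed
    qed (use two \<phi>(2) in auto)
    then show ?thesis by simp
  qed
  have UW: "\<bar>U z\<bar> \<le> W z" if "z \<in> space N" for z
    by (rule LIMSEQ_le_const2[OF tendsto_rabs[OF lim[OF that]]]) (use dom that in auto)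
  have bound: "(\<integral>z. \<bar>b k (V k z) - c (U z)\<bar> \<partial>N) \<le> (3 * \<mu> + 6 * B) * \<epsilon> + J k" if k: "j \<le> k" for k
  proof -
    define E1 E2 E3 where "E1 = {z \<in> space N. V k z \<in> G}" and "E2 = {z \<in> space N. U z \<in> G}" and "E3 = {z \<in> space N. real R < W z}"
    have [measurable]: "E1 \<in> sets N" "E2 \<in> sets N" "E3 \<in> sets N" unfolding E1_def E2_def E3_def by measurable
    have pw: "\<bar>b k (V k z) - c (U z)\<bar> \<le> 3 * \<epsilon> + \<bar>\<phi> j (V k z) - \<phi> j (U z)\<bar> + 2 * B * (indicator E1 z + indicator E2 z + indicator E3 z)"
      if z: "z \<in> space N" for z
    proof (cases "z \<in> E1 \<or> z \<in> E2 \<or> z \<in> E3")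
      case True
      then have "1 \<le> indicator E1 z + indicator E2 z + (indicator E3 z :: real)" by (auto simp: indicator_def)
      then have "2 * B * 1 \<le> 2 * B * (indicator E1 z + indicator E2 z + indicator E3 z)" using B0 by (intro mult_left_mono) auto
      moreover have "\<bar>b k (V k z) - c (U z)\<bar> \<le> 2 * B" using two B cB by blast
      ultimately show ?thesis using \<epsilon> by simp
    next
      case False
      then have "V k z \<notin> S j" "U z \<notin> S j" using G(2) z by (auto simp: E1_def E2_def)
      moreover have "\<bar>V k z\<bar> \<le> real R" "\<bar>U z\<bar> \<le> real R" using False dom[OF z, of k] UW[OF z] z by (auto simp: E3_def)
      ultimately have "\<bar>b k (V k z) - c (V k z)\<bar> \<le> \<epsilon>" "\<bar>\<phi> j (V k z) - c (V k z)\<bar> \<le> \<epsilon>" "\<bar>\<phi> j (U z) - c (U z)\<bar> \<le> \<epsilon>"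
        using k unfolding S_def by (fastforce simp: abs_le_iff not_less)+
      then have "\<bar>b k (V k z) - c (U z)\<bar> \<le> 3 * \<epsilon> + \<bar>\<phi> j (V k z) - \<phi> j (U z)\<bar>" by linarith
      then show ?thesis using False by simp
    qed
    have i1: "integrable N (\<lambda>z. \<bar>\<phi> j (V k z) - \<phi> j (U z)\<bar>)" by (rule bdi[where D="2 * B"]) (use two \<phi>(2) in auto)
    have i2: "integrable N (indicator E :: 'a \<Rightarrow> real)" if "E \<in> sets N" for E by (rule bdi[where D=1]) (use that in \<open>auto simp: indicator_def\<close>)
    have "(\<integral>z. \<bar>b k (V k z) - c (U z)\<bar> \<partial>N) \<le> (\<integral>z. 3 * \<epsilon> + \<bar>\<phi> j (V k z) - \<phi> j (U z)\<bar> + 2 * B * (indicator E1 z + indicator E2 z + indicator E3 z) \<partial>N)"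
    proof (rule integral_mono)
      show "integrable N (\<lambda>z. \<bar>b k (V k z) - c (U z)\<bar>)" by (rule bdi[where D="2 * B"]) (use two B cB in auto)
      show "integrable N (\<lambda>z. 3 * \<epsilon> + \<bar>\<phi> j (V k z) - \<phi> j (U z)\<bar> + 2 * B * (indicator E1 z + indicator E2 z + indicator E3 z))"
        by (intro Bochner_Integration.integrable_add integrable_mult_right i1 i2 N.integrable_const) measurable
    qed (use pw in auto)
    also have "\<dots> = 3 * \<epsilon> * \<mu> + J k + 2 * B * (measure N E1 + measure N E2 + measure N E3)"
    proof -
      have "E1 \<subseteq> space N" "E2 \<subseteq> space N" "E3 \<subseteq> space N" by (auto simp: E1_def E2_def E3_def)
      then show ?thesis using i1 i2 by (simp add: J_def \<mu>_def Int_absorb2 mult.commute)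
    qed
    also have "\<dots> \<le> 3 * \<epsilon> * \<mu> + J k + 2 * B * (\<epsilon> + \<epsilon> + \<epsilon>)"
      using occV[OF G(1) m, of k] occU[OF G(1) m] Cm R B0 unfolding E1_def E2_def E3_def
      by (intro add_left_mono mult_left_mono add_mono) auto
    finally show ?thesis by (simp add: algebra_simps)
  qed
  from LIMSEQ_D[OF J0, of "e / 2"] e obtain k0 where k0: "\<And>k. k \<ge> k0 \<Longrightarrow> \<bar>J k\<bar> < e / 2" by auto
  show "\<exists>n0. \<forall>k\<ge>n0. norm ((\<integral>z. \<bar>b k (V k z) - c (U z)\<bar> \<partial>N) - 0) < e"
  proof (intro exI allI impI)
    fix k assume k: "max j k0 \<le> k"
    have "0 \<le> (\<integral>z. \<bar>b k (V k z) - c (U z)\<bar> \<partial>N)" by simp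
    moreover have "(\<integral>z. \<bar>b k (V k z) - c (U z)\<bar> \<partial>N) < e" using bound[of k] k0[of k] \<epsilon>e k by auto
    ultimately show "norm ((\<integral>z. \<bar>b k (V k z) - c (U z)\<bar> \<partial>N) - 0) < e" by simp
  qed
qed

lemma lborel_drift_integral:
  fixes y f :: "real \<Rightarrow> real"
  assumes y: "\<And>t. 0 \<le> t \<Longrightarrow> continuous (at_right t) y" and f[measurable]: "f \<in> borel_measurable borel"
    and B: "\<And>z. \<bar>f z\<bar> \<le> B"
  shows "integrable lborel (\<lambda>t. indicator {0<..<T} t * f (if 0 \<le> t then y t else 0))"
    and "(\<integral>t. indicator {0<..<T} t * f (if 0 \<le> t then y t else 0) \<partial>lborel) = integral {0..T} (\<lambda>s. f (y s))"
proof -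
  define y' where "y' t = (if 0 \<le> t then y t else 0)" for t
  have [measurable]: "y' \<in> borel_measurable borel" unfolding y'_def by (rule right_continuous_measurable) fact
  have i: "set_integrable lborel {0<..<T} (\<lambda>t. f (y' t))"
    unfolding set_integrable_def
  proof (rule integrable_dominated)
    show "integrable lborel (\<lambda>t. B * indicator {0<..<T} t)"
    proof -
      have "emeasure lborel {0<..<T} < \<infinity>" by (cases "0 \<le> T") auto
      then show ?thesis by (intro integrable_mult_right integrable_real_indicator) auto
    qed
    show "\<bar>indicator {0<..<T} t *\<^sub>R f (y' t)\<bar> \<le> B * indicator {0<..<T} t" for t
      using B[of "y' t"] by (auto simp: indicator_def)
  qed measurable
  then show "integrable lborel (\<lambda>t. indicator {0<..<T} t * f (if 0 \<le> t then y t else 0))" by (simp add: set_integrable_def y'_def)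
  have "(\<integral>t. indicator {0<..<T} t * f (y' t) \<partial>lborel) = integral {0<..<T} (\<lambda>t. f (y' t))"
    using set_borel_integral_eq_integral(2)[OF i] by (simp add: set_lebesgue_integral_def)
  also have "\<dots> = integral {0..T} (\<lambda>t. f (y' t))" by (rule integral_open_interval_real[symmetric])
  also have "\<dots> = integral {0..T} (\<lambda>s. f (y s))" by (rule integral_cong) (simp add: y'_def)
  finally show "(\<integral>t. indicator {0<..<T} t * f (if 0 \<le> t then y t else 0) \<partial>lborel) = integral {0..T} (\<lambda>s. f (y s))" by (simp add: y'_def)
qed

context stable_noise begin

text \<open>The limit \<open>Y\<close> inherits from the \<open>X k\<close> that \<open>Y -
  Z\<close> is \<open>B\<close>-Lipschitz, hence right-continuous paths and the occupation estimate.
  So \<open>composition_converges\<close> applies on the product of \<open>{0<..<T}\<close> and the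
  sample space and gives \<open>L\<^sup>1\<close> convergence of the drift integrals. This yields
  the equation at each fixed \<open>T\<close> almost surely, and right continuity yields it at all
  times simultaneously.\<close>
lemma solves_limit:
  assumes Xk: "\<And>k. solves (b k) x (X k)" and b[measurable]: "\<And>k. b k \<in> borel_measurable borel" and c[measurable]: "c \<in> borel_measurable borel"
    and B: "\<And>k y. \<bar>b k y\<bar> \<le> B" and bc: "\<And>y. (\<lambda>k. b k y) \<longlonglongrightarrow> c y"
    and XF: "\<And>t. 0 \<le> t \<Longrightarrow> Y t \<in> borel_measurable (F t)"
    and lim: "AE \<omega> in M. \<forall>t\<ge>0. (\<lambda>k. X k t \<omega>) \<longlonglongrightarrow> Y t \<omega>"
  shows "solves c x Y"
proof -
  have B0: "0 \<le> B" using B[of 0 0] by linarith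
  have cB: "\<bar>c y\<bar> \<le> B" for y by (rule LIMSEQ_le_const2[OF tendsto_rabs[OF bc]]) (use B in auto)
  define good where "good \<omega> \<longleftrightarrow> (\<forall>k. \<forall>t\<ge>0. X k t \<omega> = x + integral {0..t} (\<lambda>s. b k (X k s \<omega>)) + Z t \<omega>) \<and>
     (\<forall>k. \<forall>t\<ge>0. continuous (at_right t) (\<lambda>t. X k t \<omega>)) \<and> (\<forall>t\<ge>0. (\<lambda>k. X k t \<omega>) \<longlonglongrightarrow> Y t \<omega>) \<and>
     (\<forall>t\<ge>0. continuous (at_right t) (\<lambda>t. Z t \<omega>))" for \<omega>
  have "AE \<omega> in M. \<forall>k. \<forall>t\<ge>0. X k t \<omega> = x + integral {0..t} (\<lambda>s. b k (X k s \<omega>)) + Z t \<omega>"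
    "AE \<omega> in M. \<forall>k. \<forall>t\<ge>0. continuous (at_right t) (\<lambda>t. X k t \<omega>)"
    by (rule AE_all_countable[THEN iffD2, OF allI], use Xk in \<open>simp add: solves_def\<close>)+
  with lim Z_right have "AE \<omega> in M. good \<omega>" by eventually_elim (simp add: good_def)
  then obtain N0 where N0: "{\<omega> \<in> space M. \<not> good \<omega>} \<subseteq> N0" "emeasure M N0 = 0" "N0 \<in> sets M" by (rule AE_E)
  define A where "A = space M - N0"
  have A[measurable]: "A \<in> sets M" using N0 by (simp add: A_def)
  have A1: "prob A = 1" unfolding A_def using N0 prob_compl[of N0] by (simp add: emeasure_eq_measure)
  note AEA = AE_good[OF A A1]
  have g: "good \<omega>" if "\<omega> \<in> A" for \<omega> using that N0 by (auto simp: A_def)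
  have eqk: "X k t \<omega> = x + integral {0..t} (\<lambda>s. b k (X k s \<omega>)) + Z t \<omega>" if "\<omega> \<in> A" "0 \<le> t" for \<omega> k t
    using g[OF that(1)] that(2) unfolding good_def by blast
  have rk: "continuous (at_right t) (\<lambda>t. X k t \<omega>)" and rZ: "continuous (at_right t) (\<lambda>t. Z t \<omega>)"
    and l: "(\<lambda>k. X k t \<omega>) \<longlonglongrightarrow> Y t \<omega>" if "\<omega> \<in> A" "0 \<le> t" for \<omega> k t
    using g[OF that(1)] that(2) unfolding good_def by blast+
  have lipk: "\<bar>(X k t \<omega> - Z t \<omega>) - (X k s \<omega> - Z s \<omega>)\<bar> \<le> B * (t - s)" if "\<omega> \<in> A" "0 \<le> s" "s \<le> t" for \<omega> k s t
    by (rule solves_lipschitz[where X="X k" and \<omega>=\<omega> and x=x and b="b k"]) (use rk eqk b B that in auto)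
  have lip: "\<bar>(Y t \<omega> - Z t \<omega>) - (Y s \<omega> - Z s \<omega>)\<bar> \<le> B * (t - s)" if w: "\<omega> \<in> A" "0 \<le> s" "s \<le> t" for \<omega> s t
  proof (rule LIMSEQ_le_const2)
    show "(\<lambda>k. \<bar>(X k t \<omega> - Z t \<omega>) - (X k s \<omega> - Z s \<omega>)\<bar>) \<longlonglongrightarrow> \<bar>(Y t \<omega> - Z t \<omega>) - (Y s \<omega> - Z s \<omega>)\<bar>"
      by (intro tendsto_intros l) (use w in auto)
  qed (use lipk w in blast)
  have r: "continuous (at_right t) (\<lambda>t. Y t \<omega>)" if w: "\<omega> \<in> A" "0 \<le> t" for \<omega> t
  proof -
    have "continuous_on {0..} (\<lambda>t. Y t \<omega> - Z t \<omega>)"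
    proof (rule lipschitz_on_continuous_on[of B], rule lipschitz_onI)
      fix s t :: real assume "s \<in> {0..}" "t \<in> {0..}"
      then show "dist (Y s \<omega> - Z s \<omega>) (Y t \<omega> - Z t \<omega>) \<le> B * dist s t"
        using lip[OF w(1), of s t] lip[OF w(1), of t s] by (cases "s \<le> t") (auto simp: dist_real_def abs_minus_commute)
    qed (rule B0)
    then have "continuous (at t within {0..}) (\<lambda>t. Y t \<omega> - Z t \<omega>)" using w by (simp add: continuous_on_eq_continuous_within)
    then have "continuous (at_right t) (\<lambda>t. Y t \<omega> - Z t \<omega>)" by (rule continuous_within_subset) (use w in auto)
    from continuous_add[OF this rZ[OF w]] show ?thesis by simp
  qed
  have Xkm: "X k t \<in> borel_measurable M" and Ym: "Y t \<in> borel_measurable M" if "0 \<le> t" for k t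
    using solves_measurable[OF Xk that] F_M_measurable[OF XF[OF that] that] .
  define V where "V k t \<omega> = (if \<omega> \<in> A \<and> 0 \<le> t then X k t \<omega> else 0)" for k t \<omega>
  define U where "U t \<omega> = (if \<omega> \<in> A \<and> 0 \<le> t then Y t \<omega> else 0)" for t \<omega>
  define Z' where "Z' t \<omega> = (if \<omega> \<in> A \<and> 0 \<le> t then Z t \<omega> else 0)" for t \<omega>
  have [measurable]: "(\<lambda>(t, \<omega>). V k t \<omega>) \<in> borel_measurable (lborel \<Otimes>\<^sub>M M)" for k unfolding V_def by (rule joint_measurable[OF Xkm A rk])
  have [measurable]: "(\<lambda>(t, \<omega>). U t \<omega>) \<in> borel_measurable (lborel \<Otimes>\<^sub>M M)" unfolding U_def by (rule joint_measurable[OF Ym A r])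
  have [measurable]: "(\<lambda>(t, \<omega>). Z' t \<omega>) \<in> borel_measurable (lborel \<Otimes>\<^sub>M M)" unfolding Z'_def by (rule joint_measurable[OF Z_measurable A rZ])
  interpret pair: pair_sigma_finite lborel M ..
  have main: "AE \<omega> in M. Y T \<omega> = x + integral {0..T} (\<lambda>s. c (Y s \<omega>)) + Z T \<omega>" if T: "0 < T" for T
  proof -
    define I :: "real \<times> 'w \<Rightarrow> real" where "I = indicator ({0<..<T} \<times> space M)"
    have [measurable]: "I \<in> borel_measurable (lborel \<Otimes>\<^sub>M M)" unfolding I_def by measurable
    have I0: "0 \<le> I z" for z by (simp add: I_def)
    define N where "N = density (lborel \<Otimes>\<^sub>M M) (\<lambda>z. ennreal (I z))"
    have sN[simp]: "space N = space (lborel \<Otimes>\<^sub>M M)" by (simp add: N_def)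
    have mN: "borel_measurable N = borel_measurable (lborel \<Otimes>\<^sub>M M)" unfolding N_def by (rule measurable_cong_sets) simp_all
    have eN: "emeasure N {z \<in> space N. P z} = (\<integral>\<^sup>+\<omega>. \<integral>\<^sup>+t. indicator {0<..<T} t * indicator {z. P z} (t, \<omega>) \<partial>lborel \<partial>M)"
      if [measurable]: "{z \<in> space (lborel \<Otimes>\<^sub>M M). P z} \<in> sets (lborel \<Otimes>\<^sub>M M)" for P
    proof -
      have "emeasure N {z \<in> space N. P z} = (\<integral>\<^sup>+z. ennreal (I z) * indicator {z \<in> space (lborel \<Otimes>\<^sub>M M). P z} z \<partial>(lborel \<Otimes>\<^sub>M M))"
        unfolding sN unfolding N_def by (rule emeasure_density) measurable
      also have "\<dots> = (\<integral>\<^sup>+\<omega>. \<integral>\<^sup>+t. ennreal (I (t, \<omega>)) * indicator {z \<in> space (lborel \<Otimes>\<^sub>M M). P z} (t, \<omega>) \<partial>lborel \<partial>M)"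
        by (rule pair.nn_integral_snd[symmetric]) measurable
      also have "\<dots> = (\<integral>\<^sup>+\<omega>. \<integral>\<^sup>+t. indicator {0<..<T} t * indicator {z. P z} (t, \<omega>) \<partial>lborel \<partial>M)"
        by (intro nn_integral_cong) (auto simp: I_def indicator_def space_pair_measure)
      finally show ?thesis .
    qed
    have fin: "finite_measure N"
    proof (rule finite_measureI)
      have "emeasure N (space N) = (\<integral>\<^sup>+\<omega>. \<integral>\<^sup>+t. indicator {0<..<T} t \<partial>lborel \<partial>M)"
      proof -
        have "{z \<in> space (lborel \<Otimes>\<^sub>M M). True} \<in> sets (lborel \<Otimes>\<^sub>M M)" by measurable
        from eN[OF this] show ?thesis by simp
      qed
      also have "\<dots> = ennreal T" using T by (simp add: emeasure_space_1)
      finally show "emeasure N (space N) \<noteq> \<infinity>" by simp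
    qed
    define C where "C = occ_const T * (1 + B * T)"
    have C: "0 \<le> C" using occ_const_nonneg[of T] B0 T by (simp add: C_def)
    have occ: "measure N {z \<in> space N. (case z of (t, \<omega>) \<Rightarrow> H t \<omega>) \<in> G} \<le> C * m powr \<theta>"
      if G: "open G" "emeasure lborel G = ennreal m" "0 \<le> m"
      and H[measurable]: "(\<lambda>(t, \<omega>). H t \<omega>) \<in> borel_measurable (lborel \<Otimes>\<^sub>M M)"
      and HX: "\<And>t \<omega>. \<omega> \<in> A \<Longrightarrow> 0 \<le> t \<Longrightarrow> H t \<omega> = X' t \<omega>"
      and X'F: "\<And>t. 0 \<le> t \<Longrightarrow> X' t \<in> borel_measurable (F t)"
      and X'r: "\<And>\<omega> t. \<omega> \<in> A \<Longrightarrow> 0 \<le> t \<Longrightarrow> continuous (at_right t) (\<lambda>t. X' t \<omega>)"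
      and X'l: "\<And>\<omega> s t. \<omega> \<in> A \<Longrightarrow> 0 \<le> s \<Longrightarrow> s \<le> t \<Longrightarrow> \<bar>(X' t \<omega> - Z t \<omega>) - (X' s \<omega> - Z s \<omega>)\<bar> \<le> B * (t - s)"
      for H X' G m
    proof -
      have Gm[measurable]: "G \<in> sets borel" using G by simp
      have "emeasure N {z \<in> space N. (case z of (t, \<omega>) \<Rightarrow> H t \<omega>) \<in> G} = (\<integral>\<^sup>+\<omega>. \<integral>\<^sup>+t. indicator {0<..<T} t * indicator {z. (case z of (t, \<omega>) \<Rightarrow> H t \<omega>) \<in> G} (t, \<omega>) \<partial>lborel \<partial>M)"
        by (rule eN) measurable
      also have "\<dots> = (\<integral>\<^sup>+\<omega>. indicator A \<omega> * (\<integral>\<^sup>+t. indicator {0<..<T} t * indicator G (X' t \<omega>) \<partial>lborel) \<partial>M)"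
      proof (rule nn_integral_cong_AE)
        show "AE \<omega> in M. (\<integral>\<^sup>+t. indicator {0<..<T} t * indicator {z. (case z of (t, \<omega>) \<Rightarrow> H t \<omega>) \<in> G} (t, \<omega>) \<partial>lborel) =
          indicator A \<omega> * (\<integral>\<^sup>+t. indicator {0<..<T} t * indicator G (X' t \<omega>) \<partial>lborel)"
          using AEA
        proof eventually_elim
          case (elim \<omega>)
          then show ?case by (auto intro!: nn_integral_cong simp: indicator_def HX)
        qed
      qed
      also have "\<dots> \<le> ennreal (occ_const T * m powr \<theta> * (1 + B * T))"
        by (rule lipschitz_drift_occupation(1)[OF T X'F B0 A X'r X'l G])
      also have "occ_const T * m powr \<theta> * (1 + B * T) = C * m powr \<theta>" by (simp add: C_def)
      finally show ?thesis using C by (simp add: measure_def enn2real_leI)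
    qed
    define D where "D k = (\<lambda>(t, \<omega>). \<bar>b k (V k t \<omega>) - c (U t \<omega>)\<bar>)" for k
    have [measurable]: "D k \<in> borel_measurable (lborel \<Otimes>\<^sub>M M)" for k unfolding D_def by measurable
    have D2: "\<bar>D k z\<bar> \<le> 2 * B" for k z
    proof -
      obtain t \<omega> where "z = (t, \<omega>)" by (cases z)
      then show ?thesis using B[of k "V k t \<omega>"] cB[of "U t \<omega>"] by (simp add: D_def)
    qed
    have conv: "(\<lambda>k. \<integral>z. D k z \<partial>N) \<longlonglongrightarrow> 0"
    proof -
      have "(\<lambda>k. \<integral>z. \<bar>b k ((\<lambda>(t, \<omega>). V k t \<omega>) z) - c ((\<lambda>(t, \<omega>). U t \<omega>) z)\<bar> \<partial>N) \<longlonglongrightarrow> 0"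
      proof (rule composition_converges[OF fin _ _ _ _ _ b c B bc C \<theta>_bounds(1)])
        show "(\<lambda>(t, \<omega>). V k t \<omega>) \<in> borel_measurable N" "(\<lambda>(t, \<omega>). U t \<omega>) \<in> borel_measurable N"
          "(\<lambda>(t, \<omega>). \<bar>x\<bar> + B * \<bar>t\<bar> + \<bar>Z' t \<omega>\<bar>) \<in> borel_measurable N" for k
          unfolding mN by measurable
        show "(\<lambda>k. case z of (t, \<omega>) \<Rightarrow> V k t \<omega>) \<longlonglongrightarrow> (case z of (t, \<omega>) \<Rightarrow> U t \<omega>)" for z
          by (cases z) (auto simp: V_def U_def l)
        show "\<bar>case z of (t, \<omega>) \<Rightarrow> V k t \<omega>\<bar> \<le> (case z of (t, \<omega>) \<Rightarrow> \<bar>x\<bar> + B * \<bar>t\<bar> + \<bar>Z' t \<omega>\<bar>)" for k z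
        proof -
          obtain t \<omega> where z: "z = (t, \<omega>)" by (cases z)
          have "\<bar>X k t \<omega>\<bar> \<le> \<bar>x\<bar> + B * t + \<bar>Z t \<omega>\<bar>" if "\<omega> \<in> A" "0 \<le> t"
            using lipk[OF that(1) order_refl that(2), of k] eqk[OF that(1) order_refl, of k] by simp
          then show ?thesis using B0 by (auto simp: z V_def Z'_def)
        qed
        show "measure N {z \<in> space N. (case z of (t, \<omega>) \<Rightarrow> V k t \<omega>) \<in> G} \<le> C * m powr \<theta>"
          if "open G" "emeasure lborel G = ennreal m" "0 \<le> m" for k G m
        proof (rule occ[OF that, of "V k" "X k"])
          show "(\<lambda>(t, \<omega>). V k t \<omega>) \<in> borel_measurable (lborel \<Otimes>\<^sub>M M)" by measurable
          show "V k t \<omega> = X k t \<omega>" if "\<omega> \<in> A" "0 \<le> t" for t \<omega> using that by (simp add: V_def)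
        qed (use rk lipk Xk in \<open>auto simp: solves_def\<close>)
        show "measure N {z \<in> space N. (case z of (t, \<omega>) \<Rightarrow> U t \<omega>) \<in> G} \<le> C * m powr \<theta>"
          if "open G" "emeasure lborel G = ennreal m" "0 \<le> m" for G m
        proof (rule occ[OF that, of U Y])
          show "(\<lambda>(t, \<omega>). U t \<omega>) \<in> borel_measurable (lborel \<Otimes>\<^sub>M M)" by measurable
          show "U t \<omega> = Y t \<omega>" if "\<omega> \<in> A" "0 \<le> t" for t \<omega> using that by (simp add: U_def)
        qed (use r lip XF in auto)
      qed
      then show ?thesis by (simp add: D_def case_prod_beta')
    qed
    have DI: "integrable (lborel \<Otimes>\<^sub>M M) (\<lambda>z. I z * D k z)" for k
    proof -
      interpret NN: finite_measure N by (rule fin)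
      have "integrable N (D k)" by (rule NN.integrable_const_bound[where B="2 * B"]) (use D2 mN in auto)
      then show ?thesis unfolding N_def by (subst (asm) integrable_density) (auto simp: I0)
    qed
    define H where "H k \<omega> = (\<integral>t. I (t, \<omega>) * D k (t, \<omega>) \<partial>lborel)" for k \<omega>
    have EH: "expectation (H k) = (\<integral>z. D k z \<partial>N)" and Hi: "integrable M (H k)" for k
    proof -
      have "(\<integral>z. D k z \<partial>N) = (\<integral>z. I z * D k z \<partial>(lborel \<Otimes>\<^sub>M M))"
        unfolding N_def by (subst integral_density) (auto simp: I0)
      then show "expectation (H k) = (\<integral>z. D k z \<partial>N)" "integrable M (H k)"
        unfolding H_def using pair.integral_snd[of "\<lambda>t \<omega>. I (t, \<omega>) * D k (t, \<omega>)"] pair.integrable_snd[of "\<lambda>t \<omega>. I (t, \<omega>) * D k (t, \<omega>)"] DI[of k]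
        by (auto simp: case_prod_beta')
    qed
    \<comment> \<open>\<open>\<rho>\<close> is the defect of \<open>Y\<close> in the equation at
      time \<open>T\<close>; its expected size is shown to be \<open>0\<close>.\<close>
    define \<rho> where "\<rho> \<omega> = Y T \<omega> - x - Z T \<omega> - (\<integral>t. indicator {0<..<T} t * c (U t \<omega>) \<partial>lborel)" for \<omega>
    have TT: "0 \<le> T" using T by simp
    have \<rho>m[measurable]: "\<rho> \<in> borel_measurable M"
    proof -
      have "(\<lambda>\<omega>. \<integral>t. indicator {0<..<T} t * c (U t \<omega>) \<partial>lborel) \<in> borel_measurable M"
      proof (rule sigma_finite_measure.borel_measurable_lebesgue_integral)
        have "(\<lambda>(\<omega>, t). U t \<omega>) \<in> borel_measurable (M \<Otimes>\<^sub>M lborel)"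
          using measurable_compose[OF measurable_pair_swap' \<open>(\<lambda>(t, \<omega>). U t \<omega>) \<in> borel_measurable (lborel \<Otimes>\<^sub>M M)\<close>]
          by (simp add: case_prod_beta')
        then show "(\<lambda>(\<omega>, t). indicator {0<..<T} t * c (U t \<omega>)) \<in> borel_measurable (M \<Otimes>\<^sub>M lborel)" by measurable
      qed (rule lborel.sigma_finite_measure_axioms)
      then show ?thesis unfolding \<rho>_def using Ym[OF TT] Z_measurable[OF TT] by measurable
    qed
    have UA: "U t \<omega> = (if 0 \<le> t then Y t \<omega> else 0)" and VA: "V k t \<omega> = (if 0 \<le> t then X k t \<omega> else 0)" if "\<omega> \<in> A" for t \<omega> k
      using that by (auto simp: U_def V_def)
    have \<rho>H: "\<bar>\<rho> \<omega>\<bar> \<le> \<bar>Y T \<omega> - X k T \<omega>\<bar> + H k \<omega>" if w: "\<omega> \<in> A" for k \<omega>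
    proof -
      have ws: "\<omega> \<in> space M" using w A sets.sets_into_space by blast
      have rkw: "\<And>t. 0 \<le> t \<Longrightarrow> continuous (at_right t) (\<lambda>t. X k t \<omega>)" using rk[OF w] .
      have VAk: "V k t \<omega> = (if 0 \<le> t then X k t \<omega> else 0)" for t using VA[OF w] .
      note iX = lborel_drift_integral[where T=T and y="\<lambda>t. X k t \<omega>" and f="b k" and B=B, OF rkw b B, folded VAk]
      note iY = lborel_drift_integral(1)[where T=T and y="\<lambda>t. Y t \<omega>" and f=c and B=B, OF r[OF w] c cB, folded UA[OF w]]
      have "X k T \<omega> - x - Z T \<omega> = (\<integral>t. indicator {0<..<T} t * b k (V k t \<omega>) \<partial>lborel)"
        using iX(2) eqk[OF w TT, of k] by linarith
      then have "\<rho> \<omega> = (Y T \<omega> - X k T \<omega>) + ((\<integral>t. indicator {0<..<T} t * b k (V k t \<omega>) \<partial>lborel) - (\<integral>t. indicator {0<..<T} t * c (U t \<omega>) \<partial>lborel))"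
        unfolding \<rho>_def by simp
      also have "(\<integral>t. indicator {0<..<T} t * b k (V k t \<omega>) \<partial>lborel) - (\<integral>t. indicator {0<..<T} t * c (U t \<omega>) \<partial>lborel) =
          (\<integral>t. indicator {0<..<T} t * b k (V k t \<omega>) - indicator {0<..<T} t * c (U t \<omega>) \<partial>lborel)"
        using iX(1) iY by simp
      finally have \<rho>eq: "\<rho> \<omega> = (Y T \<omega> - X k T \<omega>) + (\<integral>t. indicator {0<..<T} t * b k (V k t \<omega>) - indicator {0<..<T} t * c (U t \<omega>) \<partial>lborel)" .
      have "\<bar>\<integral>t. indicator {0<..<T} t * b k (V k t \<omega>) - indicator {0<..<T} t * c (U t \<omega>) \<partial>lborel\<bar> \<le>
          (\<integral>t. \<bar>indicator {0<..<T} t * b k (V k t \<omega>) - indicator {0<..<T} t * c (U t \<omega>)\<bar> \<partial>lborel)"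
        by (rule integral_abs_bound)
      also have "\<dots> = H k \<omega>" unfolding H_def D_def I_def
        by (rule Bochner_Integration.integral_cong) (use ws in \<open>auto simp: indicator_def\<close>)
      finally show ?thesis unfolding \<rho>eq by linarith
    qed
    have d2: "\<bar>Y T \<omega> - X k T \<omega>\<bar> \<le> 2 * (B * T)" if w: "\<omega> \<in> A" for k \<omega>
    proof -
      have "Y 0 \<omega> = x + Z 0 \<omega>"
        using LIMSEQ_unique[OF l[OF w order_refl], of "x + Z 0 \<omega>"] eqk[OF w order_refl] by simp
      then show ?thesis using lip[OF w order_refl TT] lipk[OF w order_refl TT, of k] eqk[OF w order_refl, of k] by simp
    qed
    have [measurable]: "X k T \<in> borel_measurable M" "Y T \<in> borel_measurable M" for k using Xkm Ym TT by auto
    have "(\<lambda>k. expectation (\<lambda>\<omega>. \<bar>Y T \<omega> - X k T \<omega>\<bar>)) \<longlonglongrightarrow> expectation (\<lambda>_. 0)"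
    proof (rule integral_dominated_convergence[where w="\<lambda>_. 2 * (B * T)"])
      show "AE \<omega> in M. (\<lambda>k. \<bar>Y T \<omega> - X k T \<omega>\<bar>) \<longlonglongrightarrow> 0"
        using AEA
      proof eventually_elim
        case (elim \<omega>)
        from tendsto_diff[OF tendsto_const l[OF elim TT], of "Y T \<omega>"] show ?case by (auto intro: tendsto_rabs_zero)
      qed
      show "AE \<omega> in M. norm \<bar>Y T \<omega> - X k T \<omega>\<bar> \<le> 2 * (B * T)" for k using AEA by eventually_elim (use d2 in simp)
    qed auto
    from tendsto_add[OF this conv]
    have lim0: "(\<lambda>k. expectation (\<lambda>\<omega>. \<bar>Y T \<omega> - X k T \<omega>\<bar>) + expectation (H k)) \<longlonglongrightarrow> 0" by (simp add: EH)
    have di: "integrable M (\<lambda>\<omega>. \<bar>Y T \<omega> - X k T \<omega>\<bar>)" for k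
      by (rule integrable_const_bound[where B="2 * (B * T)"]) (use AEA d2 in \<open>auto elim!: AE_mp\<close>)
    have \<rho>i: "integrable M (\<lambda>\<omega>. \<bar>\<rho> \<omega>\<bar>)"
    proof (rule Bochner_Integration.integrable_bound[OF Bochner_Integration.integrable_add[OF di Hi]])
      show "AE \<omega> in M. norm \<bar>\<rho> \<omega>\<bar> \<le> norm (\<bar>Y T \<omega> - X 0 T \<omega>\<bar> + H 0 \<omega>)"
        using AEA
      proof eventually_elim
        case (elim \<omega>)
        then show ?case using order_trans[OF \<rho>H[OF elim, of 0] abs_ge_self] by (simp only: real_norm_def abs_abs)
      qed
    qed measurable
    have "expectation (\<lambda>\<omega>. \<bar>\<rho> \<omega>\<bar>) \<le> expectation (\<lambda>\<omega>. \<bar>Y T \<omega> - X k T \<omega>\<bar>) + expectation (H k)" for k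
    proof -
      have "expectation (\<lambda>\<omega>. \<bar>\<rho> \<omega>\<bar>) \<le> expectation (\<lambda>\<omega>. \<bar>Y T \<omega> - X k T \<omega>\<bar> + H k \<omega>)"
        by (rule integral_mono_AE[OF \<rho>i]) (use di Hi AEA \<rho>H in \<open>auto elim!: AE_mp\<close>)
      then show ?thesis using di Hi by simp
    qed
    then have "expectation (\<lambda>\<omega>. \<bar>\<rho> \<omega>\<bar>) \<le> 0" by (intro LIMSEQ_le_const[OF lim0]) auto
    then have "expectation (\<lambda>\<omega>. \<bar>\<rho> \<omega>\<bar>) = 0" by (intro antisym) auto
    then have "AE \<omega> in M. \<bar>\<rho> \<omega>\<bar> = 0" by (subst (asm) integral_nonneg_eq_0_iff_AE) (use \<rho>i in auto)
    with AEA show ?thesis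
    proof eventually_elim
      case (elim \<omega>)
      then show ?case
        using lborel_drift_integral(2)[where T=T and y="\<lambda>t. Y t \<omega>" and f=c and B=B, OF r[OF elim(1)] c cB, folded UA[OF elim(1)]] by (simp add: \<rho>_def)
    qed
  qed
  have ci: "(\<lambda>s. c (Y s \<omega>)) integrable_on {0..t}" if "\<omega> \<in> A" for \<omega> t
    by (rule drift_integrable[of "\<lambda>t. Y t \<omega>" c B]) (use r[OF that] cB in auto)
  have "AE \<omega> in M. \<forall>t\<ge>0. Y t \<omega> = x + integral {0..t} (\<lambda>s. c (Y s \<omega>)) + Z t \<omega>"
  proof (rule right_continuous_AE_eq)
    show "AE \<omega> in M. \<forall>t\<ge>0. continuous (at_right t) (\<lambda>t. Y t \<omega>)" using AEA by eventually_elim (use r in auto)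
    show "AE \<omega> in M. \<forall>t\<ge>0. continuous (at_right t) (\<lambda>t. x + integral {0..t} (\<lambda>s. c (Y s \<omega>)) + Z t \<omega>)"
      using AEA
    proof eventually_elim
      case (elim \<omega>)
      show ?case
      proof (intro allI impI)
        fix t :: real assume "0 \<le> t"
        then show "continuous (at_right t) (\<lambda>t. x + integral {0..t} (\<lambda>s. c (Y s \<omega>)) + Z t \<omega>)"
          using right_continuous_plus_integral[where f="\<lambda>s. c (Y s \<omega>)" and z="\<lambda>t. Z t \<omega>" and x=x and t=t
            and y="\<lambda>t. x + integral {0..t} (\<lambda>s. c (Y s \<omega>)) + Z t \<omega>", OF ci[OF elim] rZ[OF elim]] by blast
      qed
    qed
    show "AE \<omega> in M. Y t \<omega> = x + integral {0..t} (\<lambda>s. c (Y s \<omega>)) + Z t \<omega>" if "0 \<le> t" for t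
    proof (cases "t = 0")
      case True
      show ?thesis using AEA
      proof eventually_elim
        case (elim \<omega>)
        then show ?case using LIMSEQ_unique[OF l[OF elim order_refl], of "x + Z 0 \<omega>"] eqk[OF elim order_refl] True by simp
      qed
    next
      case False
      then show ?thesis using main[of t] that by simp
    qed
  qed
  moreover have "AE \<omega> in M. \<forall>t\<ge>0. continuous (at_right t) (\<lambda>t. Y t \<omega>)" using AEA by eventually_elim (use r in auto)
  ultimately show ?thesis using XF unfolding solves_def by blast
qed

text \<open>The filtration generated by \<open>Z\<close> without null sets. A process adapted to it
  is adapted both to \<open>F\<close>, which need not contain the null sets, and to the completed
  natural filtration.\<close>
definition natural_filtration :: "real \<Rightarrow> 'w measure" where
  "natural_filtration t = sigma (space M) {Z s -` B \<inter> space M | s B. 0 \<le> s \<and> s \<le> t \<and> B \<in> sets borel}"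

lemma natural_filtration_sets: "sets (natural_filtration t) = sigma_sets (space M) {Z s -` B \<inter> space M | s B. 0 \<le> s \<and> s \<le> t \<and> B \<in> sets borel}"
  and natural_filtration_space: "space (natural_filtration t) = space M"
  unfolding natural_filtration_def by (rule sets_measure_of, blast) (rule space_measure_of, blast)

lemma Z_natural: "0 \<le> s \<Longrightarrow> s \<le> t \<Longrightarrow> Z s \<in> borel_measurable (natural_filtration t)"
  unfolding measurable_def natural_filtration_sets natural_filtration_space by (auto intro!: sigma_sets.Basic)

lemma natural_filtration_imp_F:
  fixes f :: "'w \<Rightarrow> real"
  assumes f: "f \<in> borel_measurable (natural_filtration t)" and t: "0 \<le> t" shows "f \<in> borel_measurable (F t)"
proof -
  have "{Z s -` B \<inter> space M | s B. 0 \<le> s \<and> s \<le> t \<and> B \<in> sets borel} \<subseteq> sets (F t)"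
  proof safe
    fix s and B :: "real set" assume "0 \<le> s" "s \<le> t" "B \<in> sets borel"
    then show "Z s -` B \<inter> space M \<in> sets (F t)"
      using measurable_sets[OF F_mono_measurable[OF adapted_Z[of s], of t]] space_F[OF t] by simp
  qed
  then have "sets (natural_filtration t) \<subseteq> sets (F t)"
    unfolding natural_filtration_sets using sets.sigma_sets_subset[of _ "F t"] space_F[OF t] by simp
  then show ?thesis using f space_F[OF t] natural_filtration_space by (auto simp: measurable_def)
qed

lemma natural_filtration_imp_completed:
  fixes f :: "'w \<Rightarrow> real"
  assumes f: "f \<in> borel_measurable (natural_filtration t)" shows "f \<in> borel_measurable (completed_natural_filtration M Z t)"
proof -
  let ?G = "{Z s -` B \<inter> space M | s B. 0 \<le> s \<and> s \<le> t \<and> B \<in> sets borel} \<union> {N. \<exists>N'\<in>null_sets M. N \<subseteq> N'}"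
  have G: "?G \<subseteq> Pow (space M)" using sets.sets_into_space by (fastforce simp: null_sets_def)
  have s: "sets (completed_natural_filtration M Z t) = sigma_sets (space M) ?G"
    "space (completed_natural_filtration M Z t) = space M"
    unfolding completed_natural_filtration_def using sets_measure_of[OF G] space_measure_of[OF G] by auto
  have "sets (natural_filtration t) \<subseteq> sets (completed_natural_filtration M Z t)"
    unfolding natural_filtration_sets s by (rule sigma_sets_mono') auto
  then show ?thesis using f natural_filtration_space s(2) by (auto simp: measurable_def)
qed

text \<open>All limits are taken with \<open>lim\<close> at every sample point, so that the
  processes are adapted to the uncompleted natural filtration; on the event where \<open>Z\<close>
  is right-continuous, monotonicity and the bound \<open>\<bar>X t - x - Z t\<bar> \<le> B *
  t\<close> make them genuine limits.\<close>
lemma solution_exists: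
  fixes a :: "nat \<Rightarrow> real \<Rightarrow> real"
  assumes lip: "\<And>n y y'. \<bar>a n y - a n y'\<bar> \<le> L n * \<bar>y - y'\<bar>" and B: "\<And>n y. \<bar>a n y\<bar> \<le> B"
  obtains c X where "c \<in> borel_measurable borel" "\<And>y. \<bar>c y\<bar> \<le> B" "\<And>y l. (\<lambda>n. a n y) \<longlonglongrightarrow> l \<Longrightarrow> c y = l"
    "solves c x X" "\<And>t. 0 \<le> t \<Longrightarrow> X t \<in> borel_measurable (natural_filtration t)"
proof -
  have am: "a n \<in> borel_measurable borel" for n
  proof (rule borel_measurable_continuous_onI, rule lipschitz_on_continuous_on[of "max 0 (L n)"], rule lipschitz_onI)
    fix y y' :: real
    have "L n * \<bar>y - y'\<bar> \<le> max 0 (L n) * \<bar>y - y'\<bar>" by (intro mult_right_mono) auto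
    then show "dist (a n y) (a n y') \<le> max 0 (L n) * dist y y'" using lip[of n y y'] by (simp add: dist_real_def)
  qed simp
  obtain b c where bm: "\<And>n. b n \<in> borel_measurable borel" and cm: "c \<in> borel_measurable borel"
    and bB: "\<And>n y. \<bar>b n y\<bar> \<le> B" and cB: "\<And>y. \<bar>c y\<bar> \<le> B"
    and wb: "\<And>n y. (\<lambda>k. window_min a n k y) \<longlonglongrightarrow> b n y" and bc: "\<And>y. (\<lambda>n. b n y) \<longlonglongrightarrow> c y"
    and cl: "\<And>y l. (\<lambda>n. a n y) \<longlonglongrightarrow> l \<Longrightarrow> c y = l"
    by (rule window_min_limits[where a=a and B=B, OF am B]) (blast intro: that)
  obtain L' where L': "\<And>n k y y'. \<bar>window_min a n k y - window_min a n k y'\<bar> \<le> L' n k * \<bar>y - y'\<bar>"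
    using window_min_lipschitz[of a L, OF lip] by metis
  have lo: "- B \<le> a n y" and hi: "a n y \<le> B" for n y using B[of n y] by (auto simp: abs_le_iff)
  have wB: "\<bar>window_min a n k y\<bar> \<le> B" for n k y
    using window_min_bounds(1)[of n k "- B" a y] window_min_bounds(2)[of n k a y B] lo hi by (auto simp: abs_le_iff minus_le_iff)
  have wm: "window_min a n k \<in> borel_measurable borel" for n k
    by (induction k) (use am in \<open>simp_all add: window_min.simps[abs_def]\<close>)
  define X2 where "X2 n k t \<omega> = lim (\<lambda>j. picard x (window_min a n k) j (\<lambda>s. Z s \<omega>) t)" for n k t \<omega>
  define X1 where "X1 n t \<omega> = lim (\<lambda>k. X2 n k t \<omega>)" for n t \<omega>
  define X where "X t \<omega> = lim (\<lambda>n. X1 n t \<omega>)" for t \<omega>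
  have m2: "X2 n k t \<in> borel_measurable (natural_filtration t)" if "0 \<le> t" for n k t
    unfolding X2_def by (intro borel_measurable_lim_metric picard_measurable wm Z_natural that)
  have m1: "X1 n t \<in> borel_measurable (natural_filtration t)" if "0 \<le> t" for n t
    unfolding X1_def by (intro borel_measurable_lim_metric m2 that)
  have m: "X t \<in> borel_measurable (natural_filtration t)" if "0 \<le> t" for t
    unfolding X_def by (intro borel_measurable_lim_metric m1 that)
  define good where "good \<omega> \<longleftrightarrow> (\<forall>t\<ge>0. continuous (at_right t) (\<lambda>t. Z t \<omega>))" for \<omega>
  have ae: "AE \<omega> in M. good \<omega>" using Z_right by (simp add: good_def)
  have eq2: "X2 n k t \<omega> = x + integral {0..t} (\<lambda>s. window_min a n k (X2 n k s \<omega>)) + Z t \<omega>"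
    and r2: "continuous (at_right t) (\<lambda>t. X2 n k t \<omega>)" if "good \<omega>" "0 \<le> t" for n k t \<omega>
    using picard_converges[of "\<lambda>t. Z t \<omega>" "window_min a n k" B "L' n k" t x] that wB L' unfolding X2_def good_def by auto
  have bd2: "\<bar>X2 n k t \<omega> - (x + Z t \<omega>)\<bar> \<le> B * t" if w: "good \<omega>" "0 \<le> t" for n k t \<omega>
  proof -
    have "\<bar>integral {0..t} (\<lambda>s. window_min a n k (X2 n k s \<omega>))\<bar> \<le> B * (t - 0)"
      by (rule integral_increment_bound[OF w(2) drift_integrable[of "\<lambda>t. X2 n k t \<omega>" "window_min a n k" B]])
         (use r2[OF w(1)] wm wB in auto)
    then show ?thesis using eq2[OF w, of n k] by simp
  qed
  have mono: "X2 n k t \<omega> \<le> X2 n' k' t \<omega>" if le: "\<And>y. window_min a n k y \<le> window_min a n' k' y" and w: "good \<omega>" "0 \<le> t" for n k n' k' t \<omega>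
    by (rule drift_comparison[where ?y1.0="\<lambda>t. X2 n k t \<omega>" and ?y2.0="\<lambda>t. X2 n' k' t \<omega>" and ?f1.0="window_min a n k" and ?f2.0="window_min a n' k'"
          and z="\<lambda>t. Z t \<omega>" and x=x and B=B and L="L' n k"])
       (use r2[OF w(1)] eq2[OF w(1)] wm wB L' le w in auto)
  have bdlim: "convergent u" if "\<And>k. \<bar>u k - d\<bar> \<le> D" "monoseq u" for u :: "nat \<Rightarrow> real" and d D
  proof (rule Bseq_monoseq_convergent[OF BseqI'[of _ "\<bar>d\<bar> + D"] that(2)])
    show "norm (u k) \<le> \<bar>d\<bar> + D" for k using that(1)[of k] by simp
  qed
  have lim2: "(\<lambda>k. X2 n k t \<omega>) \<longlonglongrightarrow> X1 n t \<omega>" if w: "good \<omega>" "0 \<le> t" for n t \<omega>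
  proof -
    have "monoseq (\<lambda>k. X2 n k t \<omega>)" unfolding monoseq_Suc using mono[OF _ w, of n "Suc _" n _] by auto
    with bdlim[of "\<lambda>k. X2 n k t \<omega>" "x + Z t \<omega>" "B * t"] bd2[OF w] have "convergent (\<lambda>k. X2 n k t \<omega>)" by blast
    then show ?thesis unfolding X1_def by (simp add: convergent_LIMSEQ_iff)
  qed
  have bd1: "\<bar>X1 n t \<omega> - (x + Z t \<omega>)\<bar> \<le> B * t" if w: "good \<omega>" "0 \<le> t" for n t \<omega>
    by (rule LIMSEQ_le_const2[OF tendsto_rabs[OF tendsto_diff[OF lim2[OF w] tendsto_const]]]) (use bd2[OF w] in auto)
  have mono1: "X1 n t \<omega> \<le> X1 (Suc n) t \<omega>" if w: "good \<omega>" "0 \<le> t" for n t \<omega>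
    by (rule LIMSEQ_le[OF LIMSEQ_Suc[OF lim2[OF w]] lim2[OF w]]) (use mono[OF window_min_shift w] in blast)
  have lim1: "(\<lambda>n. X1 n t \<omega>) \<longlonglongrightarrow> X t \<omega>" if w: "good \<omega>" "0 \<le> t" for t \<omega>
  proof -
    have "monoseq (\<lambda>n. X1 n t \<omega>)" unfolding monoseq_Suc using mono1[OF w] by auto
    with bdlim[of "\<lambda>n. X1 n t \<omega>" "x + Z t \<omega>" "B * t"] bd1[OF w] have "convergent (\<lambda>n. X1 n t \<omega>)" by blast
    then show ?thesis unfolding X_def by (simp add: convergent_LIMSEQ_iff)
  qed
  have s2: "solves (window_min a n k) x (X2 n k)" for n k
    unfolding solves_def
  proof (intro conjI allI impI)
    show "X2 n k t \<in> borel_measurable (F t)" if "0 \<le> t" for t by (rule natural_filtration_imp_F[OF m2[OF that] that])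
    show "AE \<omega> in M. \<forall>t\<ge>0. X2 n k t \<omega> = x + integral {0..t} (\<lambda>s. window_min a n k (X2 n k s \<omega>)) + Z t \<omega>"
      using ae by eventually_elim (use eq2 in blast)
    show "AE \<omega> in M. \<forall>t\<ge>0. continuous (at_right t) (\<lambda>t. X2 n k t \<omega>)"
      using ae by eventually_elim (use r2 in blast)
  qed
  have s1: "solves (b n) x (X1 n)" for n
    by (rule solves_limit[of "window_min a n" x "X2 n" "b n" B])
       (use s2 wm bm wB wb natural_filtration_imp_F[OF m1] ae lim2 in \<open>auto elim!: AE_mp\<close>)
  have s: "solves c x X"
    by (rule solves_limit[of b x X1 c B])
       (use s1 bm cm bB bc natural_filtration_imp_F[OF m] ae lim1 in \<open>auto elim!: AE_mp\<close>)
  show ?thesis by (rule that[OF cm cB cl s m])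
qed

end

text \<open>By stationarity an increment over time \<open>s\<close> has the law of \<open>Z
  s\<close>, whose characteristic function is that of \<open>s powr (1 / \<alpha>) * Z
  1\<close>.\<close>
lemma stable_process_noise:
  fixes M :: "'w measure"
  assumes fps: "filtered_prob_space M F" and \<alpha>: "1 < \<alpha>" "\<alpha> < 2" and Z: "symmetric_stable_process M \<alpha> Z"
    and ad: "adapted F Z" and ind: "increments_independent_of M F Z"
  obtains p p' C where "stable_noise M F p p' C Z \<alpha>"
proof -
  interpret filtered_prob_space M F by fact
  have Zm: "Z t \<in> borel_measurable M" if "0 \<le> t" for t using Z that by (simp add: symmetric_stable_process_def)
  have cad: "AE \<omega> in M. cadlag (\<lambda>t. Z t \<omega>)" and Z0: "AE \<omega> in M. Z 0 \<omega> = 0" and stat: "stationary_increments M Z"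
    using Z by (auto simp: symmetric_stable_process_def)
  obtain c where c: "0 < c" and ch: "\<And>t u. 0 \<le> t \<Longrightarrow> char (distr M borel (Z t)) u = complex_of_real (exp (- (c * t * \<bar>u\<bar> powr \<alpha>)))"
    using Z unfolding symmetric_stable_process_def by blast
  interpret Z1: real_distribution "distr M borel (Z 1)" by (rule real_distribution_distr) (use Zm in simp)
  obtain p p' C where p: "0 < C" "\<And>z. (p has_real_derivative p' z) (at z)" "\<And>z. 0 \<le> p z"
    "\<And>z. p z \<le> C" "\<And>z. \<bar>p' z\<bar> \<le> C * (1 / (1 + z\<^sup>2))" "p' \<in> borel_measurable borel" "distr M borel (Z 1) = density lborel p"
    by (rule Z1.stable_density[OF c \<alpha>]) (use ch[of 1] in auto)
  have law: "distr M borel (\<lambda>\<omega>. Z (t + s) \<omega> - Z t \<omega>) = distr (density lborel p) borel (\<lambda>z. s powr (1 / \<alpha>) * z)"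
    if t: "0 \<le> t" and s: "0 < s" for t s
  proof -
    have [measurable]: "Z s \<in> borel_measurable M" "Z 0 \<in> borel_measurable M" using Zm s by auto
    have "distr M borel (\<lambda>\<omega>. Z (t + s) \<omega> - Z t \<omega>) = distr M borel (\<lambda>\<omega>. Z s \<omega> - Z 0 \<omega>)"
      using stat t s by (simp add: stationary_increments_def)
    also have "\<dots> = distr M borel (Z s)"
      by (rule distr_cong_AE) (use Z0 in \<open>auto elim!: AE_mp\<close>)
    also have "\<dots> = distr (density lborel p) borel (\<lambda>z. s powr (1 / \<alpha>) * z)"
    proof (rule Levy_uniqueness)
      interpret D: prob_space "density lborel p" using Z1.prob_space_axioms p(7) by simp
      show "real_distribution (distr M borel (Z s))" by (rule real_distribution_distr) simp
      show "real_distribution (distr (density lborel p) borel (\<lambda>z. s powr (1 / \<alpha>) * z))"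
        by (rule D.real_distribution_distr) simp
      show "char (distr M borel (Z s)) = char (distr (density lborel p) borel (\<lambda>z. s powr (1 / \<alpha>) * z))"
      proof
        fix u
        have "char (distr (density lborel p) borel (\<lambda>z. s powr (1 / \<alpha>) * z)) u = char (density lborel p) (u * s powr (1 / \<alpha>))"
          unfolding char_def by (subst integral_distr) (auto simp: mult_ac)
        also have "\<dots> = complex_of_real (exp (- (c * 1 * \<bar>u * s powr (1 / \<alpha>)\<bar> powr \<alpha>)))"
          using ch[of 1] p(7) by simp
        also have "\<bar>u * s powr (1 / \<alpha>)\<bar> powr \<alpha> = \<bar>u\<bar> powr \<alpha> * s"
          using s \<alpha> by (simp add: abs_mult powr_mult powr_powr)
        finally show "char (distr M borel (Z s)) u = char (distr (density lborel p) borel (\<lambda>z. s powr (1 / \<alpha>) * z)) u"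
          using ch[of s u] s by (simp add: mult_ac)
      qed
    qed
    finally show ?thesis .
  qed
  show ?thesis
  proof (rule that)
    have sd: "smooth_density p p' C"
      by (rule smooth_density.intro) (use p Z1.prob_space_axioms in auto)
    show "stable_noise M F p p' C Z \<alpha>"
    proof (intro stable_noise.intro stable_noise_axioms.intro fps sd \<alpha> Z0 law)
      show "Z t \<in> borel_measurable (F t)" if "0 \<le> t" for t using ad that by (simp add: adapted_def)
      show "indep_set (sets (F t)) (sets (vimage_algebra (space M) (\<lambda>\<omega>. Z (t + s) \<omega> - Z t \<omega>) borel))" if "0 \<le> t" "0 \<le> s" for t s
        using ind that by (simp add: increments_independent_of_def)
      show "AE \<omega> in M. \<forall>t\<ge>0. continuous (at_right t) (\<lambda>t. Z t \<omega>)" using cad by eventually_elim (simp add: cadlag_def)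
    qed
  qed
qed

theorem corollary1p3:
  fixes M :: "'w measure" and F :: "real \<Rightarrow> 'w measure" and Z :: "real \<Rightarrow> 'w \<Rightarrow> real"
    and a :: "real \<Rightarrow> real" and x \<alpha> :: real
  assumes "filtered_prob_space M F"
    and "1 < \<alpha>" and "\<alpha> < 2"
    and "symmetric_stable_process M \<alpha> Z"
    and "adapted F Z"
    and "increments_independent_of M F Z"
    and "L_infinity a"
  shows "(\<exists>\<xi>. strong_solution M F Z a x \<xi>) \<and> pathwise_unique M F Z a x"
proof -
  obtain p p' C where "stable_noise M F p p' C Z \<alpha>" using assms(1-6) by (rule stable_process_noise)
  then interpret stable_noise M F p p' C Z \<alpha> .
  obtain K where "a \<in> borel_measurable lebesgue" "AE y in lebesgue. \<bar>a y\<bar> \<le> K" using assms(7) by (auto simp: L_infinity_def)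
  then have a: "a \<in> borel_measurable lebesgue" "AE y in lebesgue. \<bar>a y\<bar> \<le> max 0 K" "0 \<le> max 0 K" by auto
  obtain \<phi> L N where \<phi>: "\<And>n y y'. \<bar>\<phi> n y - \<phi> n y'\<bar> \<le> L n * \<bar>y - y'\<bar>" "\<And>n y. \<bar>\<phi> n y\<bar> \<le> max 0 K"
    and N: "N \<in> null_sets lborel" and lim: "\<And>z. z \<notin> N \<Longrightarrow> (\<lambda>n. \<phi> n z) \<longlonglongrightarrow> a z"
    using a by (rule lipschitz_sequence_approximation) (blast intro: that)
  obtain c X where c: "c \<in> borel_measurable borel" "\<And>y. \<bar>c y\<bar> \<le> max 0 K" and cl: "\<And>y l. (\<lambda>n. \<phi> n y) \<longlonglongrightarrow> l \<Longrightarrow> c y = l"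
    and X: "solves c x X" and Xm: "\<And>t. 0 \<le> t \<Longrightarrow> X t \<in> borel_measurable (natural_filtration t)"
    by (rule solution_exists[where a=\<phi> and L=L and B="max 0 K" and x=x, OF \<phi>]) (blast intro: that)
  have Nl: "N \<in> null_sets lebesgue" using N by (rule null_sets_completionI)
  have ac: "a z = c z" if "z \<notin> N" for z using cl[OF lim[OF that]] by simp
  have "strong_solution M F Z a x X"
    unfolding strong_solution_def adapted_def
    using solves_imp_sde_solution[OF X c Nl ac] natural_filtration_imp_completed[OF Xm] by blast
  moreover have "pathwise_unique M F Z a x"
    unfolding pathwise_unique_def
    using solves_unique[OF sde_solution_imp_solves[OF _ c Nl ac] sde_solution_imp_solves[OF _ c Nl ac] c] by blast
  ultimately show ?thesis by blast
qed

end
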